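(* In the regression setup described in the context, assume that $(X_i,\varepsilon_i)_{i\ge1}$ is ergodic, that $\mathbb{E}\|U_1\|^2<\infty$, that $h_n\to0$, $nh_n\to\infty$ and $nh_n\,\lambda_{\max}(\operatorname{Cov}(\overline U_n))\to0$ with $\overline U_n=\frac1n\sum_{i=1}^nU_i$, that $c_2(K)=\int K^2(u)\,du<\infty$, that $\mu\in\mathcal{D}$, that $\mathbb{E}\|X_1\|^4<\infty$, that $0<\mathbb{E}[\varepsilon_1^2\mid X_1]<\infty$ almost surely, and that the support of $X_1$ has nonempty interior in $\mathbb{R}^p$. Let $c_n=(nh_n)^{-1/2}L_n$, where $L_n\to\infty$ is slowly varying and $c_n\to0$. Let $\alpha\in(0,1)$; components of vectors in $\mathbb{R}^{p+1}$ and diagonal entries of $(p+1)\times(p+1)$ matrices are indexed by $j=0,\dots,p$. Then $$\sqrt{nh_n}\,(\widetilde\beta_n^{\mathrm T}-\widetilde\beta_n)\to0\quad\text{in probability}.$$ Moreover, with $\Sigma_\beta=\frac{c_2(K)}{f(0)}\nabla g(\mu)\,\mathbb{E}[U_1U_1^\top]\,\nabla g(\mu)^\top$: (1) If $\sqrt{nh_n}\,\|A_n-I_q\|\to0$, then $\sqrt{nh_n}(\widetilde\beta_n^{\mathrm T}-\beta)\Rightarrow\mathcal{N}(0,\Sigma_\beta)$; the set $$\Big\{b\in\mathbb{R}^{p+1}:\ nh_n\,(\widetilde\beta_n^{\mathrm T}-b)^\top\widehat\Sigma_{\beta,n}^{-1}(\widetilde\beta_n^{\mathrm T}-b)\le\chi^2_{p+1,1-\alpha}\Big\}$$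 is an asymptotic $(1-\alpha)100\%$ confidence region for $\beta$; and for each $j$ the interval with endpoints $\widetilde\beta^{\mathrm T}_{n,j}\pm z_{1-\alpha/2}\sqrt{(\widehat\Sigma_{\beta,n})_{jj}/(nh_n)}$ is an asymptotic $(1-\alpha)100\%$ confidence interval for $\beta_j$. (2) Suppose that $f$ has a bounded and continuous second derivative at $0$ with $f''(0)\ne0$, that $d_2(K)=\int u^2K(u)\,du<\infty$, and that $h_n$ is of exact order $n^{-1/5}$ (i.e. $n^{1/5}h_n$ is bounded away from $0$ and $\infty$). Put $\kappa=\frac{f''(0)d_2(K)}{2f(0)}$, $\Lambda=\operatorname{diag}(\lambda_\Sigma^2I_{q_1},\lambda_\Gamma^2I_{p+1})$, $$\widetilde D_n^{\mathrm T}=\kappa h_n^2\,\nabla g_{c_n}(\widetilde\mu_n)\Lambda\widetilde\mu_n,\qquad \widetilde\Sigma^{\mathrm T}_{\beta,n}=\nabla g_{c_n}(\widetilde\mu_n)\,\widehat\Sigma_{\mu,n}\,\nabla g_{c_n}(\widetilde\mu_n)^\top .$$ Then $\sqrt{nh_n}\,(\widetilde\beta_n^{\mathrm T}-\widetilde D_n^{\mathrm T}-\beta)\Rightarrow\mathcal{N}(0,\Sigma_\beta)$; the set $$\Big\{b\in\mathbb{R}^{p+1}:\ nh_n\,(\widetilde\beta_n^{\mathrm T}-\widetilde D_n^{\mathrm T}-b)^\top(\widetilde\Sigma^{\mathrm T}_{\beta,n})^{-1}(\widetilde\beta_n^{\mathrm T}-\widetilde D_n^{\mathrm T}-b)\le\chi^2_{p+1,1-\alpha}\Big\}$$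 is an asymptotic $(1-\alpha)100\%$ confidence region for $\beta$; and for each $j$ the interval with endpoints $\widetilde\beta^{\mathrm T}_{n,j}-\widetilde D^{\mathrm T}_{n,j}\pm z_{1-\alpha/2}\sqrt{(\widehat\Sigma_{\beta,n})_{jj}/(nh_n)}$ is an asymptotic $(1-\alpha)100\%$ confidence interval for $\beta_j$.
   Context: Regression setup. Let $p\ge1$, $m=p+1$, $q_1=m(m+1)/2$, $q=q_1+m$. $(X_i,\varepsilon_i)_{i\ge1}$ is a stationary sequence with $X_i=(X_{i,1},\dots,X_{i,p})^\top\in\mathbb{R}^p$, $\varepsilon_i\in\mathbb{R}$, $\mathbb{E}[\varepsilon_1\mid X_1]=0$, $\mathbb{E}\|X_1\|^2<\infty$, and $Y_i=\beta_0+\beta_1X_{i,1}+\cdots+\beta_pX_{i,p}+\varepsilon_i$. Put $\widetilde X_i=(1,X_i^\top)^\top\in\mathbb{R}^{m}$, $\beta=(\beta_0,\dots,\beta_p)^\top$, $\Sigma=\mathbb{E}[\widetilde X_1\widetilde X_1^\top]$, $\Gamma=\mathbb{E}[\widetilde X_1Y_1]$, $\mu=(\operatorname{Vech}(\Sigma)^\top,\Gamma^\top)^\top\in\mathbb{R}^q$, where $\operatorname{Vech}$ stacks the lower-triangular entries of a symmetric matrix. For $\mathbf{x}\in\mathbb{R}^q$, let $\Sigma(\mathbf{x})$ (symmetric $m\times m$) and $\Gamma(\mathbf{x})\in\mathbb{R}^m$ be determined by $\mathbf{x}=(\operatorname{Vech}(\Sigma(\mathbf{x}))^\top,\Gamma(\mathbf{x})^\top)^\top$;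 let $\Delta(\mathbf{x})=\det\Sigma(\mathbf{x})$, $\mathcal{D}=\{\mathbf{x}\in\mathbb{R}^q:\Delta(\mathbf{x})>0\}$, and $g:\mathcal{D}\to\mathbb{R}^{p+1}$, $g(\mathbf{x})=\Sigma(\mathbf{x})^{-1}\Gamma(\mathbf{x})$; $\nabla g$ is its $(p+1)\times q$ Jacobian. By Cramer's rule $g_\ell=P_\ell/\Delta$ for $\ell=0,\dots,p$, where $P_\ell(\mathbf{x})$ is the determinant of $\Sigma(\mathbf{x})$ with its $(\ell+1)$-th column replaced by $\Gamma(\mathbf{x})$. If $\mu\in\mathcal{D}$ then $\beta=g(\mu)$. Let $U_i=(\operatorname{Vech}(\widetilde X_i\widetilde X_i^\top)^\top,(\widetilde X_iY_i)^\top)^\top\in\mathbb{R}^q$, so $\mathbb{E}[U_1]=\mu$. Smoothing. $(V_i)_{i\ge1}$ is i.i.d., real, independent of $(U_i)_{i\ge1}$, with bounded density $f$ continuous at $0$ and $f(0)>0$; $K$ is a symmetric bounded probability density on $\mathbb{R}$; $(h_n)$ are positive (deterministic) bandwidths. Define $$\widehat\mu_n=\frac{1}{n\,\mathbb{E}[K(V_1/h_n)]}\sum_{i=1}^nU_i\,K(V_i/h_n),\quad \widehat\Sigma_{\mu,n}=\frac{c_2(K)}{f(0)}\cdot\frac1n\sum_{i=1}^nU_iU_i^\top,\quad \widehat\Sigma_{\beta,n}=\nabla g(\widehat\mu_n)\,\widehat\Sigma_{\mu,n}\,\nabla g(\widehat\mu_n)^\top.$$ Scaled and truncated estimators. Fix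 $\lambda_\Sigma,\lambda_\Gamma>0$ with $\lambda_\Sigma\ne\lambda_\Gamma$. For $\lambda>0$ let $\hat f_{n,\lambda}(x)=\frac{1}{n\lambda h_n}\sum_{i=1}^nK\big(\frac{x-V_i}{\lambda h_n}\big)$, and let $a_{\Sigma,n}=\mathbb{E}[\hat f_{n,\lambda_\Sigma}(0)]/f(0)$, $a_{\Gamma,n}=\mathbb{E}[\hat f_{n,\lambda_\Gamma}(0)]/f(0)$, $A_n=\operatorname{diag}(a_{\Sigma,n}I_{q_1},a_{\Gamma,n}I_m)$, $\widetilde\mu_n=A_n\widehat\mu_n$, $\widetilde\beta_n=g(\widetilde\mu_n)$ whenever $\widetilde\mu_n\in\mathcal{D}$. For $c_n>0$ let $$\widetilde\beta_n^{\mathrm T}=g_{c_n}(\widetilde\mu_n),\qquad g_{c_n}(\mathbf{x})=\frac{1}{\max\{\Delta(\mathbf{x}),c_n\}}\big(P_0(\mathbf{x}),\dots,P_p(\mathbf{x})\big)^\top,\quad \mathbf{x}\in\mathbb{R}^q,$$ with Jacobian $\nabla g_{c_n}$ (where it exists, in particular on $\{\Delta>c_n\}$). Quantities are defined arbitrarily (measurably) on the events where the formulas make no sense; these events have probability tending to $0$. "Asymptotic $(1-\alpha)100\%$ confidence region/interval" means that the coverage probability tends to $1-\alpha$. $\chi^2_{p+1,1-\alpha}$ and $z_{1-\alpha/2}$ are quantiles of the $\chi^2_{p+1}$ and standard normal laws; $\lambda_{\max}$ is the largest eigenvalue; $\Rightarrow$ is convergence in distribution. *)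

theory Defs
  imports "HOL-Probability.Probability" "HOL-Library.Option_ord"
begin

text \<open>Positions \<open>(i, j)\<close> with \<open>j \<le> i\<close> in the lower triangle of an \<open>'m \<times> 'm\<close> matrix; for
  \<open>m = CARD('m)\<close> there are \<open>m (m + 1) / 2\<close> of them.\<close>

typedef (overloaded) ('m :: linorder) ltri = "{(i :: 'm, j). j \<le> i}"
  by auto

instance ltri :: ("{finite, linorder}") finite
proof
  have "UNIV = Abs_ltri ` {(i :: 'a, j). j \<le> i}"
    by (metis type_definition.Abs_image type_definition_ltri)
  then show "finite (UNIV :: 'a ltri set)"
    by (metis finite_code finite_imageI)
qed

definition vech :: "real ^ ('m :: {finite, linorder}) ^ ('m :: {finite, linorder}) \<Rightarrow> real ^ ('m ltri)" where
  "vech S = (\<chi> k. S $ fst (Rep_ltri k) $ snd (Rep_ltri k))"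

definition join_vec :: "real ^ 'a \<Rightarrow> real ^ 'b \<Rightarrow> real ^ ('a + 'b)" where
  "join_vec u v = (\<chi> k. case k of Inl i \<Rightarrow> u $ i | Inr j \<Rightarrow> v $ j)"

text \<open>The space of dimension \<open>q = m (m + 1) / 2 + m\<close> is \<open>real ^ ('m ltri + 'm)\<close>, the lower triangle
  supplying the first \<open>m (m + 1) / 2\<close> coordinates. As \<open>(max i j, min i j)\<close> is the position of the
  entry in the lower triangle, \<open>Sigma_of x\<close> is symmetric.\<close>

definition Sigma_of :: "real ^ ('m ltri + 'm) \<Rightarrow> real ^ ('m :: {finite, linorder}) ^ ('m :: {finite, linorder})" where
  "Sigma_of x = (\<chi> i j. x $ Inl (Abs_ltri (max i j, min i j)))"

definition Gamma_of :: "real ^ ('m ltri + 'm) \<Rightarrow> real ^ ('m :: {finite, linorder})" where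
  "Gamma_of x = (\<chi> i. x $ Inr i)"

lemma transpose_Sigma_of: "transpose (Sigma_of x) = Sigma_of x"
  by (simp add: transpose_def Sigma_of_def max.commute min.commute)

lemma join_vec_vech_Sigma_of: "join_vec (vech (Sigma_of x)) (Gamma_of x) = x"
proof -
  have "Abs_ltri (max (fst (Rep_ltri k)) (snd (Rep_ltri k)),
      min (fst (Rep_ltri k)) (snd (Rep_ltri k))) = k" for k :: "'a ltri"
  proof -
    obtain i j where ij: "Rep_ltri k = (i, j)"
      by fastforce
    have "j \<le> i"
      using Rep_ltri[of k] ij by simp
    then show ?thesis
      using Rep_ltri_inverse[of k] ij by (simp add: max_absorb1 min_absorb2)
  qed
  then show ?thesis
    by (auto simp: vec_eq_iff join_vec_def vech_def Sigma_of_def Gamma_of_def split: sum.split)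
qed

lemma Sigma_of_join_vec_vech:
  assumes "transpose S = S"
  shows "Sigma_of (join_vec (vech S) v) = S"
proof -
  have "S $ i $ j = S $ j $ i" for i j
    by (metis assms transpose_def vec_lambda_beta)
  moreover have "Rep_ltri (Abs_ltri (max i j, min i j)) = (max i j, min i j)" for i j :: 'a
    by (rule Abs_ltri_inverse) (auto simp: max_def)
  ultimately show ?thesis
    by (auto simp: vec_eq_iff Sigma_of_def join_vec_def vech_def max_def min_def)
qed

lemma Gamma_of_join_vec: "Gamma_of (join_vec u v) = v"
  by (simp add: vec_eq_iff Gamma_of_def join_vec_def)

definition Delta :: "real ^ ('m ltri + 'm :: {finite, linorder}) \<Rightarrow> real" where
  "Delta x = det (Sigma_of x)"

definition reg_dom :: "(real ^ ('m ltri + 'm :: {finite, linorder})) set" where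
  "reg_dom = {x. Delta x > 0}"

definition g_reg :: "real ^ ('m ltri + 'm) \<Rightarrow> real ^ ('m :: {finite, linorder})" where
  "g_reg x = matrix_inv (Sigma_of x) *v Gamma_of x"

definition cramer_num :: "real ^ ('m ltri + 'm) \<Rightarrow> ('m :: {finite, linorder}) \<Rightarrow> real" where
  "cramer_num x l = det (\<chi> i k. if k = l then Gamma_of x $ i else Sigma_of x $ i $ k)"

definition g_trunc :: "real \<Rightarrow> real ^ ('m ltri + 'm) \<Rightarrow> real ^ ('m :: {finite, linorder})" where
  "g_trunc c x = (1 / max (Delta x) c) *\<^sub>R (\<chi> l. cramer_num x l)"

definition outer :: "real ^ 'n \<Rightarrow> real ^ 'n \<Rightarrow> real ^ 'n ^ 'n" where
  "outer u v = (\<chi> i j. u $ i * v $ j)"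

definition block_diag :: "real \<Rightarrow> real \<Rightarrow> real ^ ('a :: finite + 'b :: finite) ^ ('a + 'b)" where
  "block_diag a b = (\<chi> k l. if k = l then (case k of Inl _ \<Rightarrow> a | Inr _ \<Rightarrow> b) else 0)"

text \<open>Intended for symmetric matrices, where the set of eigenvalues is finite and nonempty.\<close>

definition lambda_max :: "real ^ 'n ^ 'n \<Rightarrow> real" where
  "lambda_max A = Max {l. \<exists>v. v \<noteq> 0 \<and> A *v v = l *s v}"

definition cov_matrix :: "'a measure \<Rightarrow> ('a \<Rightarrow> real ^ 'n) \<Rightarrow> real ^ 'n ^ 'n" where
  "cov_matrix M Z = (let m = (\<integral>\<omega>. Z \<omega> \<partial>M) in \<integral>\<omega>. outer (Z \<omega> - m) (Z \<omega> - m) \<partial>M)"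

definition stationary_seq :: "'a measure \<Rightarrow> (nat \<Rightarrow> 'a \<Rightarrow> 'b :: topological_space) \<Rightarrow> bool" where
  "stationary_seq M Z \<longleftrightarrow> (\<forall>i. Z i \<in> borel_measurable M) \<and>
    (\<forall>k. distr M (\<Pi>\<^sub>M i\<in>UNIV. borel) (\<lambda>\<omega> i. Z (i + k) \<omega>) =
         distr M (\<Pi>\<^sub>M i\<in>UNIV. borel) (\<lambda>\<omega> i. Z i \<omega>))"

text \<open>For a stationary sequence: shift-invariant sets have probability zero or one.\<close>

definition ergodic_seq :: "'a measure \<Rightarrow> (nat \<Rightarrow> 'a \<Rightarrow> 'b :: topological_space) \<Rightarrow> bool" where
  "ergodic_seq M Z \<longleftrightarrow>
    (\<forall>A \<in> sets (\<Pi>\<^sub>M i\<in>UNIV. borel). {z. (\<lambda>i. z (Suc i)) \<in> A} = A \<longrightarrow>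
       measure M {\<omega> \<in> space M. (\<lambda>i. Z i \<omega>) \<in> A} \<in> {0, 1})"

definition law_support :: "'a measure \<Rightarrow> ('a \<Rightarrow> 'b :: topological_space) \<Rightarrow> 'b set" where
  "law_support M Z = {x. \<forall>S. open S \<and> x \<in> S \<longrightarrow> measure M {\<omega> \<in> space M. Z \<omega> \<in> S} > 0}"

definition to_zero_in_prob ::
    "'a measure \<Rightarrow> (nat \<Rightarrow> 'a \<Rightarrow> 'b :: real_normed_vector) \<Rightarrow> bool" where
  "to_zero_in_prob M Z \<longleftrightarrow>
    (\<forall>e>0. (\<lambda>n. measure M {\<omega> \<in> space M. norm (Z n \<omega>) > e}) \<longlonglongrightarrow> 0)"

definition conv_in_distr ::
    "'a measure \<Rightarrow> (nat \<Rightarrow> 'a \<Rightarrow> 'b :: topological_space) \<Rightarrow> 'b measure \<Rightarrow> bool" where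
  "conv_in_distr M Z \<nu> \<longleftrightarrow>
    (\<forall>\<phi> :: 'b \<Rightarrow> real. continuous_on UNIV \<phi> \<and> bounded (range \<phi>) \<longrightarrow>
       (\<lambda>n. \<integral>\<omega>. \<phi> (Z n \<omega>) \<partial>M) \<longlonglongrightarrow> (\<integral>x. \<phi> x \<partial>\<nu>))"

definition std_normal :: "real measure" where
  "std_normal = density lborel (\<lambda>x. ennreal (std_normal_density x))"

definition std_normal_vec :: "(real ^ 'n) measure" where
  "std_normal_vec = distr (\<Pi>\<^sub>M i\<in>UNIV. std_normal) borel (\<lambda>z. \<chi> i. z i)"

text \<open>The centred Gaussian law with covariance matrix \<open>S\<close>, for positive semidefinite \<open>S\<close>: the law
  of \<open>B Z\<close> with \<open>Z\<close> standard normal and \<open>B B\<^sup>T = S\<close>. It does not depend on the choice of \<open>B\<close>.\<close>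

definition centred_normal :: "real ^ 'n ^ 'n \<Rightarrow> (real ^ 'n) measure" where
  "centred_normal S =
    distr std_normal_vec borel (\<lambda>z. (SOME B :: real ^ 'n ^ 'n. B ** transpose B = S) *v z)"

definition chi_square :: "nat \<Rightarrow> real measure" where
  "chi_square k = distr (\<Pi>\<^sub>M i\<in>{..<k}. std_normal) borel (\<lambda>z. \<Sum>i<k. (z i)\<^sup>2)"

definition quantile :: "real measure \<Rightarrow> real \<Rightarrow> real" where
  "quantile \<nu> t = Inf {x. t \<le> cdf \<nu> x}"

definition asymp_confidence_set ::
    "'a measure \<Rightarrow> real \<Rightarrow> (nat \<Rightarrow> 'a \<Rightarrow> 'b set) \<Rightarrow> 'b \<Rightarrow> bool" where
  "asymp_confidence_set M level R \<theta> \<longleftrightarrow>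
    (\<lambda>n. measure M {\<omega> \<in> space M. \<theta> \<in> R n \<omega>}) \<longlonglongrightarrow> level"

text \<open>\<open>Z\<close> is the plug-in \<open>F (T)\<close> on the event \<open>T \<in> S\<close> where the formula makes sense, and is
  arbitrary, but measurable, elsewhere.\<close>

definition plug_in :: "'a measure \<Rightarrow> 't set \<Rightarrow> ('t \<Rightarrow> 'b :: topological_space) \<Rightarrow>
    ('a \<Rightarrow> 't) \<Rightarrow> ('a \<Rightarrow> 'b) \<Rightarrow> bool" where
  "plug_in M S F T Z \<longleftrightarrow>
    Z \<in> borel_measurable M \<and> (\<forall>\<omega>\<in>space M. T \<omega> \<in> S \<longrightarrow> Z \<omega> = F (T \<omega>))"

definition slowly_varying :: "(nat \<Rightarrow> real) \<Rightarrow> bool" where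
  "slowly_varying L \<longleftrightarrow> (\<forall>n\<ge>1. L n > 0) \<and>
    (\<forall>t>0. (\<lambda>n. L (nat \<lfloor>t * real n\<rfloor>) / L n) \<longlonglongrightarrow> 1)"

text \<open>Sequences of observations start at index zero, so that \<open>X 0, ..., X (n - 1)\<close> is the sample
  of size \<open>n\<close>. Coefficients are indexed by \<open>'p option\<close>, with \<open>None\<close> for the intercept.\<close>

definition with_intercept :: "real ^ 'p \<Rightarrow> real ^ ('p option)" where
  "with_intercept x = (\<chi> j. case j of None \<Rightarrow> 1 | Some k \<Rightarrow> x $ k)"

definition mean_hat :: "'a measure \<Rightarrow> (real \<Rightarrow> real) \<Rightarrow> (nat \<Rightarrow> 'a \<Rightarrow> real) \<Rightarrow> (nat \<Rightarrow> real) \<Rightarrow>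
    (nat \<Rightarrow> 'a \<Rightarrow> real ^ 'q) \<Rightarrow> nat \<Rightarrow> 'a \<Rightarrow> real ^ 'q" where
  "mean_hat M K V h U n \<omega> =
    (1 / (real n * (\<integral>\<omega>'. K (V 0 \<omega>' / h n) \<partial>M))) *\<^sub>R (\<Sum>i<n. K (V i \<omega> / h n) *\<^sub>R U i \<omega>)"

definition dens_hat :: "(real \<Rightarrow> real) \<Rightarrow> (nat \<Rightarrow> 'a \<Rightarrow> real) \<Rightarrow> (nat \<Rightarrow> real) \<Rightarrow>
    real \<Rightarrow> nat \<Rightarrow> real \<Rightarrow> 'a \<Rightarrow> real" where
  "dens_hat K V h l n x \<omega> =
    1 / (real n * l * h n) * (\<Sum>i<n. K ((x - V i \<omega>) / (l * h n)))"

end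

theory Submission
  imports Defs
begin

text \<open>Write \<open>r = sqrt (n h)\<close>. Since \<open>V\<close> is independent of \<open>U\<close>, the smoothed mean splits as
  \<open>r (mu_hat - \<mu>) = r (mean of U - \<mu>) + N\<close>, where the first term vanishes in mean square by the
  covariance hypothesis and \<open>N\<close> is, conditionally on \<open>U\<close>, a sum of independent centred terms. The
  conditional characteristic function of \<open>N\<close> is a product that is compared with a Gaussian one; its
  conditional variance converges by the ergodic theorem. Since \<open>\<Delta>(\<mu>) > 0\<close> and \<open>c n \<rightarrow> 0\<close>, the
  truncation is inactive with probability tending to one, and the delta method transfers the limit
  to the regression coefficients. At \<open>\<mu>\<close> the derivative of \<open>g\<close> maps \<open>U\<close> to \<open>\<Sigma>\<^sup>-\<^sup>1 X \<epsilon>\<close>, so the limit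
  covariance is positive definite because the conditional variance of \<open>\<epsilon>\<close> is positive.
  The deterministic scaling \<open>A\<close> contributes the bias \<open>\<kappa> h\<^sup>2 \<Lambda> \<mu>\<close>, which the correction \<open>D_T\<close> removes.\<close>

section \<open>Convergence in probability\<close>

text \<open>The \<open>U i\<close> may be dependent, and their own fluctuations are made negligible;
  the randomness of the \<open>V i\<close> alone produces the limit law. Centring is therefore done
  in the kernel weights, \<open>K (V i / h)\<close> minus its mean, and not in \<open>U i\<close>,
  which is why the limit covariance contains the raw second moment of \<open>U\<close> and not its
  covariance. The limit is carried as pointwise convergence of characteristic functions: a linear
  map acts on it by transposing the argument, and negligible errors drop out. Weak convergence is
  extracted only when test functions and confidence sets are met. In the first case the scaling
  error \<open>A n - mat 1\<close> is o(1 / r). In the second \<open>r h\<^sup>2\<close> is only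
  bounded, so the bias has the same order as the noise; subtracting \<open>D_T\<close> works because
  the bounded factor multiplies a difference of consistent estimates that tends to 0 in
  probability.\<close>

text \<open>Convergence in probability becomes convergence along a filter on pairs of an index and a sample
  point, so that the limit calculus (continuous mappings, sums, sandwiching) applies to it.\<close>

definition in_prob :: "'a measure \<Rightarrow> (nat \<times> 'a) filter" where
  "in_prob M = Abs_filter (\<lambda>P. \<forall>e>0. \<forall>\<^sub>F n in sequentially.
     \<exists>E\<in>sets M. measure M (space M - E) < e \<and> (\<forall>\<omega>\<in>E. P (n, \<omega>)))"

context prob_space
begin

lemma prob_compl_Int_less:
  assumes "E \<in> events" "F \<in> events" "prob (space M - E) < e / 2" "prob (space M - F) < e / 2"
  shows "prob (space M - (E \<inter> F)) < e"
proof -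
  have "prob (space M - (E \<inter> F)) = prob ((space M - E) \<union> (space M - F))"
    by (rule arg_cong[where f = prob]) auto
  also have "\<dots> \<le> prob (space M - E) + prob (space M - F)"
    using assms by (intro measure_Un_le) auto
  finally show ?thesis using assms by simp
qed

text \<open>The measurable witness \<open>E\<close> lets \<open>P\<close> be an arbitrary predicate.
  The filter axiom for conjunctions holds because two exceptional sets of probability below
  \<open>e / 2\<close> have a union of probability below \<open>e\<close>.\<close>

lemma eventually_in_prob:
  "eventually P (in_prob M) \<longleftrightarrow> (\<forall>e>0. \<forall>\<^sub>F n in sequentially.
     \<exists>E\<in>sets M. prob (space M - E) < e \<and> (\<forall>\<omega>\<in>E. P (n, \<omega>)))"
  unfolding in_prob_def
proof (subst eventually_Abs_filter, goal_cases)
  case 1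
  show ?case
  proof
    show "\<forall>e>0. \<forall>\<^sub>F n in sequentially. \<exists>E\<in>events. prob (space M - E) < e \<and> (\<forall>\<omega>\<in>E. True)"
      by (intro allI impI always_eventually bexI[of _ "space M"]) auto
  next
    fix P Q :: "nat \<times> 'a \<Rightarrow> bool"
    assume P: "\<forall>e>0. \<forall>\<^sub>F n in sequentially. \<exists>E\<in>events. prob (space M - E) < e \<and> (\<forall>\<omega>\<in>E. P (n, \<omega>))"
      and Q: "\<forall>e>0. \<forall>\<^sub>F n in sequentially. \<exists>E\<in>events. prob (space M - E) < e \<and> (\<forall>\<omega>\<in>E. Q (n, \<omega>))"
    show "\<forall>e>0. \<forall>\<^sub>F n in sequentially. \<exists>E\<in>events. prob (space M - E) < e \<and> (\<forall>\<omega>\<in>E. P (n, \<omega>) \<and> Q (n, \<omega>))"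
    proof (intro allI impI)
      fix e :: real assume "e > 0"
      then have "e / 2 > 0" by simp
      with P Q have "\<forall>\<^sub>F n in sequentially. \<exists>E\<in>events. prob (space M - E) < e / 2 \<and> (\<forall>\<omega>\<in>E. P (n, \<omega>))"
        "\<forall>\<^sub>F n in sequentially. \<exists>E\<in>events. prob (space M - E) < e / 2 \<and> (\<forall>\<omega>\<in>E. Q (n, \<omega>))"
        by blast+
      then show "\<forall>\<^sub>F n in sequentially. \<exists>E\<in>events. prob (space M - E) < e \<and> (\<forall>\<omega>\<in>E. P (n, \<omega>) \<and> Q (n, \<omega>))"
      proof eventually_elim
        case (elim n)
        then obtain E F where E: "E \<in> events" "prob (space M - E) < e / 2" "\<forall>\<omega>\<in>E. P (n, \<omega>)"
          and F: "F \<in> events" "prob (space M - F) < e / 2" "\<forall>\<omega>\<in>F. Q (n, \<omega>)"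
          by blast
        from E F prob_compl_Int_less[of E F e] show ?case by (intro bexI[of _ "E \<inter> F"]) auto
      qed
    qed
  next
    fix P Q :: "nat \<times> 'a \<Rightarrow> bool"
    assume PQ: "\<forall>x. P x \<longrightarrow> Q x"
      and P: "\<forall>e>0. \<forall>\<^sub>F n in sequentially. \<exists>E\<in>events. prob (space M - E) < e \<and> (\<forall>\<omega>\<in>E. P (n, \<omega>))"
    show "\<forall>e>0. \<forall>\<^sub>F n in sequentially. \<exists>E\<in>events. prob (space M - E) < e \<and> (\<forall>\<omega>\<in>E. Q (n, \<omega>))"
    proof (intro allI impI)
      fix e :: real assume "e > 0"
      with P have "\<forall>\<^sub>F n in sequentially. \<exists>E\<in>events. prob (space M - E) < e \<and> (\<forall>\<omega>\<in>E. P (n, \<omega>))"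
        by blast
      then show "\<forall>\<^sub>F n in sequentially. \<exists>E\<in>events. prob (space M - E) < e \<and> (\<forall>\<omega>\<in>E. Q (n, \<omega>))"
        by eventually_elim (use PQ in blast)
    qed
  qed
qed auto

lemma filterlim_fst_in_prob: "filterlim fst sequentially (in_prob M)"
proof (rule filterlim_iff[THEN iffD2], intro allI impI)
  fix P :: "nat \<Rightarrow> bool" assume P: "eventually P sequentially"
  show "eventually (\<lambda>x. P (fst x)) (in_prob M)"
    unfolding eventually_in_prob
  proof (intro allI impI)
    fix e :: real assume "e > 0"
    then show "\<forall>\<^sub>F n in sequentially. \<exists>E\<in>events. prob (space M - E) < e \<and> (\<forall>\<omega>\<in>E. P (fst (n, \<omega>)))"
      by (intro eventually_mono[OF P] bexI[of _ "space M"]) auto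
  qed
qed

lemma eventually_in_prob_fst:
  "eventually P sequentially \<Longrightarrow> eventually (\<lambda>x. P (fst x)) (in_prob M)"
  using filterlim_fst_in_prob by (auto simp: filterlim_iff)

lemma tendsto_in_prob_fst:
  "filterlim a F sequentially \<Longrightarrow> filterlim (\<lambda>x. a (fst x)) F (in_prob M)"
  by (rule filterlim_compose[OF _ filterlim_fst_in_prob])

lemma eventually_in_prob_space: "eventually (\<lambda>x. snd x \<in> space M) (in_prob M)"
  unfolding eventually_in_prob
  by (intro allI impI always_eventually bexI[of _ "space M"]) auto

lemma eventually_in_probI:
  assumes "(\<lambda>n. prob {\<omega> \<in> space M. \<not> P n \<omega>}) \<longlonglongrightarrow> 0"
    and "\<And>n. {\<omega> \<in> space M. P n \<omega>} \<in> events"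
  shows "eventually (\<lambda>x. P (fst x) (snd x)) (in_prob M)"
  unfolding eventually_in_prob
proof (intro allI impI)
  fix e :: real assume "e > 0"
  then have "\<forall>\<^sub>F n in sequentially. prob {\<omega> \<in> space M. \<not> P n \<omega>} < e"
    using assms(1) by (auto simp: order_tendsto_iff)
  then show "\<forall>\<^sub>F n in sequentially. \<exists>E\<in>events. prob (space M - E) < e \<and> (\<forall>\<omega>\<in>E. P (fst (n, \<omega>)) (snd (n, \<omega>)))"
  proof eventually_elim
    case (elim n)
    have "space M - {\<omega> \<in> space M. P n \<omega>} = {\<omega> \<in> space M. \<not> P n \<omega>}" by auto
    then show ?case using elim assms(2)[of n] by (intro bexI[of _ "{\<omega> \<in> space M. P n \<omega>}"]) auto
  qed
qed

lemma to_zero_in_prob_tendsto: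
  fixes Z :: "nat \<Rightarrow> 'a \<Rightarrow> 'b :: real_normed_vector"
  assumes "((\<lambda>x. Z (fst x) (snd x)) \<longlongrightarrow> 0) (in_prob M)"
  shows "to_zero_in_prob M Z"
  unfolding to_zero_in_prob_def
proof (intro allI impI tendstoI)
  fix r e :: real assume "r > 0" "e > 0"
  from tendstoD[OF assms \<open>r > 0\<close>]
  have "eventually (\<lambda>x. norm (Z (fst x) (snd x)) < r) (in_prob M)" by simp
  with \<open>e > 0\<close> have "\<forall>\<^sub>F n in sequentially. \<exists>E\<in>events. prob (space M - E) < e \<and> (\<forall>\<omega>\<in>E. norm (Z n \<omega>) < r)"
    by (auto simp: eventually_in_prob)
  then show "\<forall>\<^sub>F n in sequentially. dist (prob {\<omega> \<in> space M. norm (Z n \<omega>) > r}) 0 < e"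
  proof eventually_elim
    case (elim n)
    then obtain E where E: "E \<in> events" "prob (space M - E) < e" "\<forall>\<omega>\<in>E. norm (Z n \<omega>) < r" by blast
    have "prob {\<omega> \<in> space M. norm (Z n \<omega>) > r} \<le> prob (space M - E)"
      using E by (intro finite_measure_mono) force+
    with E show ?case by simp
  qed
qed

lemma tendsto_in_probI:
  fixes Z :: "nat \<Rightarrow> 'a \<Rightarrow> 'b :: {metric_space, second_countable_topology}"
  assumes [measurable]: "\<And>n. Z n \<in> borel_measurable M"
    and "\<And>e. e > 0 \<Longrightarrow> (\<lambda>n. prob {\<omega> \<in> space M. e \<le> dist (Z n \<omega>) l}) \<longlonglongrightarrow> 0"
  shows "((\<lambda>x. Z (fst x) (snd x)) \<longlongrightarrow> l) (in_prob M)"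
proof (rule tendstoI)
  fix e :: real assume "e > 0"
  then show "eventually (\<lambda>x. dist (Z (fst x) (snd x)) l < e) (in_prob M)"
    using assms(2)[of e] by (intro eventually_in_probI) (simp_all add: not_less)
qed

text \<open>The indicators of the bad events tend to 0 almost surely and are bounded by 1, so
  dominated convergence sends their probabilities to 0.\<close>

lemma tendsto_in_prob_AE:
  fixes Z :: "nat \<Rightarrow> 'a \<Rightarrow> 'b :: {metric_space, second_countable_topology}"
  assumes [measurable]: "\<And>n. Z n \<in> borel_measurable M"
    and lim: "AE \<omega> in M. (\<lambda>n. Z n \<omega>) \<longlonglongrightarrow> l"
  shows "((\<lambda>x. Z (fst x) (snd x)) \<longlongrightarrow> l) (in_prob M)"
proof (rule tendsto_in_probI)
  fix e :: real assume e: "e > 0"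
  have "(\<lambda>n. \<integral>\<omega>. indicator {\<omega> \<in> space M. e \<le> dist (Z n \<omega>) l} \<omega> \<partial>M) \<longlonglongrightarrow> (\<integral>\<omega>. (0::real) \<partial>M)"
  proof (rule integral_dominated_convergence[where w = "\<lambda>_. 1"])
    show "AE \<omega> in M. (\<lambda>n. indicat_real {\<omega> \<in> space M. e \<le> dist (Z n \<omega>) l} \<omega>) \<longlonglongrightarrow> 0"
      using lim
    proof eventually_elim
      case (elim \<omega>)
      then have "\<forall>\<^sub>F n in sequentially. dist (Z n \<omega>) l < e" using e by (rule tendstoD)
      then show ?case
        by (intro tendsto_eventually) (auto elim!: eventually_mono simp: indicator_def)
    qed
  qed auto
  then show "(\<lambda>n. prob {\<omega> \<in> space M. e \<le> dist (Z n \<omega>) l}) \<longlonglongrightarrow> 0"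
    by simp
qed fact

text \<open>Tightness, usually written O_P(1). Only large \<open>n\<close> count, which leaves room
  for indices where the estimators are degenerate.\<close>

definition bounded_in_prob :: "(nat \<Rightarrow> 'a \<Rightarrow> 'b :: real_normed_vector) \<Rightarrow> bool" where
  "bounded_in_prob Z \<longleftrightarrow> (\<forall>e>0. \<exists>B. \<forall>\<^sub>F n in sequentially.
     \<exists>E\<in>events. prob (space M - E) < e \<and> (\<forall>\<omega>\<in>E. norm (Z n \<omega>) \<le> B))"

text \<open>The rule that o_P(1) times O_P(1) is o_P(1). It disposes of the remainders in the delta
  method and in quadratic forms, and yields consistency of \<open>mu_hat\<close>.\<close>

lemma bounded_in_prob_tendsto_0:
  fixes W :: "nat \<times> 'a \<Rightarrow> real" and Z :: "nat \<Rightarrow> 'a \<Rightarrow> 'b :: real_normed_vector"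
  assumes W: "(W \<longlongrightarrow> 0) (in_prob M)" and Z: "bounded_in_prob Z"
  shows "((\<lambda>x. W x * norm (Z (fst x) (snd x))) \<longlongrightarrow> 0) (in_prob M)"
proof (rule tendstoI, unfold eventually_in_prob, intro allI impI)
  fix r e :: real assume r: "r > 0" and e: "e > 0"
  then have e2: "e / 2 > 0" by simp
  from Z e2 obtain B where B: "\<forall>\<^sub>F n in sequentially.
     \<exists>E\<in>events. prob (space M - E) < e / 2 \<and> (\<forall>\<omega>\<in>E. norm (Z n \<omega>) \<le> B)"
    unfolding bounded_in_prob_def by blast
  \<comment> \<open>\<open>B\<close> need not be positive, so \<open>\<bar>B\<bar> + 1\<close>
    serves as the divisor.\<close>
  have "r / (\<bar>B\<bar> + 1) > 0" using r by simp
  from tendstoD[OF W this] have "eventually (\<lambda>x. \<bar>W x\<bar> < r / (\<bar>B\<bar> + 1)) (in_prob M)"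
    by simp
  from this[unfolded eventually_in_prob, rule_format, OF e2] have "\<forall>\<^sub>F n in sequentially.
     \<exists>E\<in>events. prob (space M - E) < e / 2 \<and> (\<forall>\<omega>\<in>E. \<bar>W (n, \<omega>)\<bar> < r / (\<bar>B\<bar> + 1))"
    .
  with B show "\<forall>\<^sub>F n in sequentially. \<exists>E\<in>events. prob (space M - E) < e \<and>
     (\<forall>\<omega>\<in>E. dist (W (n, \<omega>) * norm (Z (fst (n, \<omega>)) (snd (n, \<omega>)))) 0 < r)"
  proof eventually_elim
    case (elim n)
    then obtain E F where E: "E \<in> events" "prob (space M - E) < e / 2" "\<forall>\<omega>\<in>E. norm (Z n \<omega>) \<le> B"
      and F: "F \<in> events" "prob (space M - F) < e / 2" "\<forall>\<omega>\<in>F. \<bar>W (n, \<omega>)\<bar> < r / (\<bar>B\<bar> + 1)"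
      by blast
    have "prob (space M - (E \<inter> F)) < e"
      using E F by (intro prob_compl_Int_less)
    moreover have "\<bar>W (n, \<omega>)\<bar> * norm (Z n \<omega>) < r" if "\<omega> \<in> E \<inter> F" for \<omega>
    proof -
      have "\<bar>W (n, \<omega>)\<bar> * norm (Z n \<omega>) \<le> \<bar>W (n, \<omega>)\<bar> * (\<bar>B\<bar> + 1)"
        using that E by (intro mult_left_mono) force+
      also have "\<dots> < r"
        using that F by (auto simp: field_simps)
      finally show ?thesis .
    qed
    ultimately show ?case using E F
      by (intro bexI[of _ "E \<inter> F"]) (auto simp: abs_mult)
  qed
qed

lemma bounded_in_prob_tendsto:
  fixes Z :: "nat \<Rightarrow> 'a \<Rightarrow> 'b :: real_normed_vector"
  assumes "((\<lambda>x. Z (fst x) (snd x)) \<longlongrightarrow> l) (in_prob M)"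
  shows "bounded_in_prob Z"
  unfolding bounded_in_prob_def
proof (intro allI impI exI)
  fix e :: real assume "e > 0"
  with tendstoD[OF assms zero_less_one]
  have "\<forall>\<^sub>F n in sequentially. \<exists>E\<in>events. prob (space M - E) < e \<and> (\<forall>\<omega>\<in>E. dist (Z n \<omega>) l < 1)"
    by (auto simp: eventually_in_prob)
  then show "\<forall>\<^sub>F n in sequentially. \<exists>E\<in>events. prob (space M - E) < e \<and> (\<forall>\<omega>\<in>E. norm (Z n \<omega>) \<le> norm l + 1)"
  proof eventually_elim
    case (elim n)
    then obtain E where E: "E \<in> events" "prob (space M - E) < e" "\<forall>\<omega>\<in>E. dist (Z n \<omega>) l < 1" by blast
    have "norm (Z n \<omega>) \<le> norm l + 1" if "\<omega> \<in> E" for \<omega>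
      using E(3) that norm_triangle_sub[of "Z n \<omega>" l] by (force simp: dist_norm)
    with E show ?case by blast
  qed
qed

lemma bounded_in_prob_add:
  fixes Z W :: "nat \<Rightarrow> 'a \<Rightarrow> 'b :: real_normed_vector"
  assumes Z: "bounded_in_prob Z" and W: "bounded_in_prob W"
  shows "bounded_in_prob (\<lambda>n \<omega>. Z n \<omega> + W n \<omega>)"
  unfolding bounded_in_prob_def
proof (intro allI impI)
  fix e :: real assume "e > 0"
  then have e2: "e / 2 > 0" by simp
  from Z e2 obtain B where B: "\<forall>\<^sub>F n in sequentially.
     \<exists>E\<in>events. prob (space M - E) < e / 2 \<and> (\<forall>\<omega>\<in>E. norm (Z n \<omega>) \<le> B)"
    unfolding bounded_in_prob_def by blast
  from W e2 obtain C where C: "\<forall>\<^sub>F n in sequentially.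
     \<exists>E\<in>events. prob (space M - E) < e / 2 \<and> (\<forall>\<omega>\<in>E. norm (W n \<omega>) \<le> C)"
    unfolding bounded_in_prob_def by blast
  from B C have "\<forall>\<^sub>F n in sequentially. \<exists>E\<in>events. prob (space M - E) < e \<and>
     (\<forall>\<omega>\<in>E. norm (Z n \<omega> + W n \<omega>) \<le> B + C)"
  proof eventually_elim
    case (elim n)
    then obtain E F where E: "E \<in> events" "prob (space M - E) < e / 2" "\<forall>\<omega>\<in>E. norm (Z n \<omega>) \<le> B"
      and F: "F \<in> events" "prob (space M - F) < e / 2" "\<forall>\<omega>\<in>F. norm (W n \<omega>) \<le> C"
      by blast
    have "prob (space M - (E \<inter> F)) < e"
      using E F by (intro prob_compl_Int_less)
    then show ?case using E F
      by (intro bexI[of _ "E \<inter> F"]) (auto intro!: norm_triangle_le add_mono)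
  qed
  then show "\<exists>B. \<forall>\<^sub>F n in sequentially. \<exists>E\<in>events. prob (space M - E) < e \<and>
     (\<forall>\<omega>\<in>E. norm (Z n \<omega> + W n \<omega>) \<le> B)" by blast
qed

lemma bounded_in_probI:
  fixes Z :: "nat \<Rightarrow> 'a \<Rightarrow> 'b :: {real_normed_vector, second_countable_topology}"
  assumes [measurable]: "\<And>n. Z n \<in> borel_measurable M"
    and "\<And>e. e > 0 \<Longrightarrow> \<exists>B. \<forall>\<^sub>F n in sequentially. prob {\<omega> \<in> space M. norm (Z n \<omega>) > B} < e"
  shows "bounded_in_prob Z"
  unfolding bounded_in_prob_def
proof (intro allI impI)
  fix e :: real assume "e > 0"
  from assms(2)[OF this] obtain B
    where B: "\<forall>\<^sub>F n in sequentially. prob {\<omega> \<in> space M. norm (Z n \<omega>) > B} < e" by blast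
  have eq: "space M - {\<omega> \<in> space M. norm (Z n \<omega>) \<le> B} = {\<omega> \<in> space M. norm (Z n \<omega>) > B}" for n
    by auto
  have "\<forall>\<^sub>F n in sequentially. \<exists>E\<in>events. prob (space M - E) < e \<and> (\<forall>\<omega>\<in>E. norm (Z n \<omega>) \<le> B)"
    using B
  proof eventually_elim
    case (elim n)
    show ?case
      by (rule bexI[of _ "{\<omega> \<in> space M. norm (Z n \<omega>) \<le> B}"]) (use elim eq in auto)
  qed
  then show "\<exists>B. \<forall>\<^sub>F n in sequentially. \<exists>E\<in>events. prob (space M - E) < e \<and> (\<forall>\<omega>\<in>E. norm (Z n \<omega>) \<le> B)"
    by blast
qed

end

section \<open>Gaussian vectors and characteristic functions\<close>

lemma iexp_add: "iexp (x + y) = iexp x * iexp y"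
  by (simp add: distrib_left exp_add)

lemma borel_measurable_vec_lambda:
  fixes f :: "'n :: finite \<Rightarrow> 'a \<Rightarrow> 'b :: euclidean_space"
  assumes [measurable]: "\<And>i. f i \<in> borel_measurable M"
  shows "(\<lambda>x. \<chi> i. f i x) \<in> borel_measurable M"
  by (subst borel_measurable_euclidean_space) (auto simp: Basis_vec_def inner_axis)

lemma borel_measurable_vec_nth [measurable (raw)]:
  fixes f :: "'a \<Rightarrow> 'b :: {real_normed_vector, second_countable_topology} ^ 'n"
  assumes [measurable]: "f \<in> borel_measurable M"
  shows "(\<lambda>x. f x $ i) \<in> borel_measurable M"
proof -
  have "(\<lambda>v :: 'b ^ 'n. v $ i) \<in> borel_measurable borel"
    by (intro borel_measurable_continuous_onI continuous_intros)
  from measurable_compose[OF assms this] show ?thesis .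
qed

section \<open>Gaussian laws and their characteristic functions\<close>

lemma prob_space_std_normal: "prob_space std_normal"
  unfolding std_normal_def by (rule prob_space_normal_density) simp

lemma sets_std_normal [measurable_cong, simp]: "sets std_normal = sets borel"
  by (simp add: std_normal_def)

lemma space_std_normal [simp]: "space std_normal = UNIV"
  by (simp add: std_normal_def)

lemma char_std_normal: "(CLINT x|std_normal. iexp (t * x)) = exp (- t\<^sup>2 / 2)"
  using char_std_normal_distribution
  by (auto simp: fun_eq_iff char_def std_normal_def[symmetric] exp_of_real[symmetric])

lemma prob_space_PiM_std_normal: "prob_space (\<Pi>\<^sub>M i\<in>I. std_normal)"
  by (intro prob_space_PiM prob_space_std_normal)

lemma measurable_vec_of_PiM [measurable]:
  "(\<lambda>z. \<chi> i. z i) \<in> (\<Pi>\<^sub>M i\<in>(UNIV :: 'n :: finite set). std_normal) \<rightarrow>\<^sub>M (borel :: (real ^ 'n) measure)"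
  by (intro borel_measurable_vec_lambda) measurable

lemma sets_std_normal_vec [measurable_cong, simp]: "sets std_normal_vec = sets borel"
  by (simp add: std_normal_vec_def)

lemma space_std_normal_vec [simp]: "space std_normal_vec = UNIV"
  by (simp add: std_normal_vec_def)

lemma prob_space_std_normal_vec: "prob_space std_normal_vec"
  unfolding std_normal_vec_def
  by (intro prob_space.prob_space_distr prob_space_PiM_std_normal measurable_vec_of_PiM)

lemma char_std_normal_vec:
  fixes t :: "real ^ 'n"
  shows "(CLINT x|std_normal_vec. iexp (t \<bullet> x)) = exp (- (t \<bullet> t) / 2)"
proof -
  interpret N: prob_space std_normal by (rule prob_space_std_normal)
  interpret product_prob_space "\<lambda>_ :: 'n. std_normal" UNIV ..
  have "(CLINT x|std_normal_vec. iexp (t \<bullet> x)) =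
      (CLINT z|(\<Pi>\<^sub>M i\<in>(UNIV :: 'n set). std_normal). iexp (t \<bullet> (\<chi> i. z i)))"
    unfolding std_normal_vec_def by (subst integral_distr) simp_all
  also have "\<dots> = (CLINT z|(\<Pi>\<^sub>M i\<in>(UNIV :: 'n set). std_normal). (\<Prod>i\<in>UNIV. iexp (t $ i * z i)))"
    by (simp add: inner_vec_def sum_distrib_left exp_sum)
  also have "\<dots> = (\<Prod>i\<in>UNIV. CLINT x|std_normal. iexp (t $ i * x))"
    by (rule product_integral_prod) (auto intro!: N.integrable_const_bound[where B = 1])
  also have "\<dots> = exp (- (t \<bullet> t) / 2)"
    unfolding char_std_normal
    unfolding of_real_prod[symmetric]
    by (simp add: inner_vec_def exp_sum[symmetric] power2_eq_square sum_negf sum_divide_distrib)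
  finally show ?thesis .
qed

lemma borel_measurable_matrix_vector [measurable (raw)]:
  fixes F :: "'a \<Rightarrow> real ^ 'n ^ 'm" and v :: "'a \<Rightarrow> real ^ 'n"
  assumes [measurable]: "F \<in> borel_measurable M" "v \<in> borel_measurable M"
  shows "(\<lambda>x. F x *v v x) \<in> borel_measurable M"
  unfolding matrix_vector_mult_def by (intro borel_measurable_vec_lambda) measurable

lemma sets_centred_normal [measurable_cong, simp]: "sets (centred_normal S) = sets borel"
  by (simp add: centred_normal_def)

lemma prob_space_centred_normal: "prob_space (centred_normal S)"
  unfolding centred_normal_def
  by (intro prob_space.prob_space_distr prob_space_std_normal_vec) measurable

text \<open>The choice operator in \<open>centred_normal\<close> does no harm: a root
  \<open>C\<close> enters the exponent only through \<open>C ** transpose C\<close>, which is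
  \<open>S\<close> for every root. The given \<open>B\<close> guarantees that the choice
  succeeds.\<close>

lemma char_centred_normal:
  fixes S B :: "real ^ 'n ^ 'n"
  assumes "B ** transpose B = S"
  shows "(CLINT x|centred_normal S. iexp (t \<bullet> x)) = exp (- (t \<bullet> (S *v t)) / 2)"
proof -
  define C :: "real ^ 'n ^ 'n" where "C = (SOME B. B ** transpose B = S)"
  have C: "C ** transpose C = S"
    unfolding C_def using assms by (rule someI)
  have "(CLINT x|centred_normal S. iexp (t \<bullet> x)) = (CLINT z|std_normal_vec. iexp (t \<bullet> (C *v z)))"
    unfolding centred_normal_def C_def[symmetric] by (subst integral_distr) measurable
  also have "\<dots> = (CLINT z|std_normal_vec. iexp ((transpose C *v t) \<bullet> z))"
    by (simp add: dot_lmul_matrix)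
  also have "\<dots> = exp (- (t \<bullet> (S *v t)) / 2)"
    unfolding char_std_normal_vec C[symmetric]
    by (simp add: dot_lmul_matrix matrix_vector_mul_assoc[symmetric])
  finally show ?thesis .
qed

section \<open>Tightness and Slutsky's theorem through characteristic functions\<close>

context prob_space
begin

lemma integrable_iexp_inner:
  fixes Z :: "'a \<Rightarrow> 'b :: euclidean_space"
  assumes "Z \<in> borel_measurable M"
  shows "integrable M (\<lambda>\<omega>. iexp (t \<bullet> Z \<omega>))"
  using assms by (intro integrable_const_bound[where B = 1]) auto

text \<open>Averaging the characteristic function over a Gaussian argument of scale \<open>s\<close>
  gives, by Fubini, the expectation of
  \<open>exp (- (s\<^sup>2 * (norm (Z n \<omega>))\<^sup>2) / 2)\<close>. If this is close to 1,
  large norms are improbable. The rotation-invariant average treats all dimensions at once.\<close>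

lemma tight_of_char_tendsto:
  fixes Z :: "nat \<Rightarrow> 'a \<Rightarrow> real ^ 'n"
  assumes Z[measurable]: "\<And>n. Z n \<in> borel_measurable M"
    and lim: "\<And>t. (\<lambda>n. CLINT \<omega>|M. iexp (t \<bullet> Z n \<omega>)) \<longlonglongrightarrow> c t"
    and cont: "isCont c 0" and "e > 0"
  shows "\<exists>B>0. \<forall>\<^sub>F n in sequentially. prob {\<omega> \<in> space M. norm (Z n \<omega>) > B} < e"
proof -
  let ?\<gamma> = "std_normal_vec :: (real ^ 'n) measure"
  note M_1 = prob_space
  interpret G: prob_space ?\<gamma> by (rule prob_space_std_normal_vec)
  have G_1: "G.prob UNIV = 1" using G.prob_space by simp
  interpret P2: pair_prob_space M ?\<gamma> ..
  define \<phi> where "\<phi> n t = (CLINT \<omega>|M. iexp (t \<bullet> Z n \<omega>))" for n t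
  have \<phi>_meas [measurable]: "\<phi> n \<in> borel_measurable borel" for n
    unfolding \<phi>_def by measurable
  have lim': "(\<lambda>n. \<phi> n t) \<longlonglongrightarrow> c t" for t
    using lim by (simp add: \<phi>_def)
  have c_meas [measurable]: "c \<in> borel_measurable borel"
    by (rule borel_measurable_LIMSEQ_metric[OF \<phi>_meas lim'])
  have \<phi>_le: "norm (\<phi> n t) \<le> 1" for n t
    unfolding \<phi>_def
    by (rule order_trans[OF integral_norm_bound]) (simp add: M_1)
  have c_le: "norm (c t) \<le> 1" for t
    by (rule LIMSEQ_le_const2[OF tendsto_norm[OF lim']]) (use \<phi>_le in auto)
  have c0: "c 0 = 1"
    using LIMSEQ_unique[OF lim'[of 0], of 1] by (simp add: \<phi>_def M_1)
  have id: "(CLINT g|?\<gamma>. \<phi> n (s *\<^sub>R g)) = (LINT \<omega>|M. exp (- (s\<^sup>2 * (norm (Z n \<omega>))\<^sup>2) / 2))" for n s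
  proof -
    have "integrable (M \<Otimes>\<^sub>M ?\<gamma>) (\<lambda>(\<omega>, g). iexp ((s *\<^sub>R g) \<bullet> Z n \<omega>))"
      by (rule P2.P.integrable_const_bound[where B = 1]) (auto simp: split_beta')
    then have "(CLINT g|?\<gamma>. \<phi> n (s *\<^sub>R g)) = (CLINT \<omega>|M. CLINT g|?\<gamma>. iexp ((s *\<^sub>R g) \<bullet> Z n \<omega>))"
      unfolding \<phi>_def by (rule P2.Fubini_integral)
    also have "\<dots> = (CLINT \<omega>|M. complex_of_real (exp (- (s\<^sup>2 * (norm (Z n \<omega>))\<^sup>2) / 2)))"
    proof (rule Bochner_Integration.integral_cong[OF refl])
      fix \<omega>
      show "(CLINT g|?\<gamma>. iexp ((s *\<^sub>R g) \<bullet> Z n \<omega>)) = complex_of_real (exp (- (s\<^sup>2 * (norm (Z n \<omega>))\<^sup>2) / 2))"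
        using char_std_normal_vec[of "s *\<^sub>R Z n \<omega>"]
        by (simp add: inner_commute power2_eq_square dot_square_norm mult_ac)
    qed
    finally show ?thesis by simp
  qed
  \<comment> \<open>Shrinking the Gaussian argument concentrates it at 0, where \<open>c\<close> is
    continuous with value 1; this fixes the scale \<open>s\<close> before \<open>n\<close> is sent
    to infinity.\<close>
  have "(\<lambda>k. CLINT g|?\<gamma>. c ((1 / Suc k) *\<^sub>R g)) \<longlonglongrightarrow> (CLINT g|?\<gamma>. 1)"
  proof (rule integral_dominated_convergence[where w = "\<lambda>_. 1"])
    show "AE g in ?\<gamma>. (\<lambda>k. c ((1 / Suc k) *\<^sub>R g)) \<longlonglongrightarrow> 1"
    proof (rule AE_I2)
      fix g :: "real ^ 'n"
      have "(\<lambda>k. (1 / Suc k) *\<^sub>R g) \<longlonglongrightarrow> 0 *\<^sub>R g"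
        by (intro tendsto_scaleR tendsto_const LIMSEQ_Suc[OF lim_1_over_n])
      then show "(\<lambda>k. c ((1 / Suc k) *\<^sub>R g)) \<longlonglongrightarrow> 1"
        using isCont_tendsto_compose[OF cont] c0 by force
    qed
  qed (use c_le in auto)
  then have "(\<lambda>k. CLINT g|?\<gamma>. c ((1 / Suc k) *\<^sub>R g)) \<longlonglongrightarrow> 1"
    by (simp add: G_1)
  then have "\<forall>\<^sub>F k in sequentially. dist (CLINT g|?\<gamma>. c ((1 / Suc k) *\<^sub>R g)) 1 < e / 4"
    using \<open>e > 0\<close> by (intro tendstoD) auto
  then obtain k where k: "dist (CLINT g|?\<gamma>. c ((1 / Suc k) *\<^sub>R g)) 1 < e / 4"
    by (auto simp: eventually_sequentially)
  define s where "s = 1 / real (Suc k)"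
  have s: "s > 0" by (simp add: s_def)
  have "(\<lambda>n. CLINT g|?\<gamma>. \<phi> n (s *\<^sub>R g)) \<longlonglongrightarrow> (CLINT g|?\<gamma>. c (s *\<^sub>R g))"
    by (rule integral_dominated_convergence[where w = "\<lambda>_. 1"]) (use \<phi>_le lim' in auto)
  then have "\<forall>\<^sub>F n in sequentially. dist (CLINT g|?\<gamma>. \<phi> n (s *\<^sub>R g)) (CLINT g|?\<gamma>. c (s *\<^sub>R g)) < e / 4"
    using \<open>e > 0\<close> by (intro tendstoD) auto
  then have "\<forall>\<^sub>F n in sequentially. prob {\<omega> \<in> space M. norm (Z n \<omega>) > 2 / s} < e"
  proof eventually_elim
    case (elim n)
    let ?f = "\<lambda>\<omega>. exp (- (s\<^sup>2 * (norm (Z n \<omega>))\<^sup>2) / 2)"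
    have "dist (complex_of_real (expectation ?f)) (complex_of_real 1) < e / 2"
      using elim k dist_triangle2[of "CLINT g|?\<gamma>. \<phi> n (s *\<^sub>R g)" 1 "CLINT g|?\<gamma>. c (s *\<^sub>R g)"]
      by (simp add: id s_def dist_commute)
    then have f1: "1 - expectation ?f < e / 2"
      unfolding dist_of_real dist_real_def by linarith
    have int: "integrable M ?f"
      by (rule integrable_const_bound[where B = 1]) auto
    have "prob {\<omega> \<in> space M. norm (Z n \<omega>) > 2 / s} =
        expectation (indicator {\<omega> \<in> space M. norm (Z n \<omega>) > 2 / s})"
      by simp
    \<comment> \<open>Beyond the radius \<open>2 / s\<close> the exponent is below -2, and
      \<open>exp (-2)\<close> is at most 1/2, so \<open>2 * (1 - ?f \<omega>)\<close> dominates the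
      indicator.\<close>
    also have "\<dots> \<le> expectation (\<lambda>\<omega>. 2 * (1 - ?f \<omega>))"
    proof (rule integral_mono)
      show "integrable M (\<lambda>\<omega>. 2 * (1 - ?f \<omega>))" using int by simp
      show "integrable M (indicat_real {\<omega> \<in> space M. norm (Z n \<omega>) > 2 / s})"
        by (intro integrable_real_indicator) (auto simp: emeasure_eq_measure)
      fix \<omega> assume "\<omega> \<in> space M"
      have "?f \<omega> \<le> 1 / 2" if "norm (Z n \<omega>) > 2 / s"
      proof -
        have "2 < s * norm (Z n \<omega>)" using that s by (simp add: field_simps)
        then have "2\<^sup>2 < (s * norm (Z n \<omega>))\<^sup>2" by (intro power_strict_mono) auto
        then have "?f \<omega> \<le> exp (-2)" by (simp add: power_mult_distrib)
        also have "exp (-2 :: real) \<le> 1 / 2"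
          using exp_ge_add_one_self[of 2] by (simp add: exp_minus field_simps)
        finally show ?thesis .
      qed
      then show "indicator {\<omega> \<in> space M. norm (Z n \<omega>) > 2 / s} \<omega> \<le> 2 * (1 - ?f \<omega>)"
        by (auto simp: indicator_def)
    qed
    also have "\<dots> = 2 * (1 - expectation ?f)"
      using int by (simp add: M_1)
    also have "\<dots> < e" using f1 by simp
    finally show ?case .
  qed
  then show ?thesis using s by (intro exI[of _ "2 / s"]) auto
qed

lemma bounded_in_prob_of_char_tendsto:
  fixes Z :: "nat \<Rightarrow> 'a \<Rightarrow> real ^ 'n"
  assumes "\<And>n. Z n \<in> borel_measurable M"
    and "\<And>t. (\<lambda>n. CLINT \<omega>|M. iexp (t \<bullet> Z n \<omega>)) \<longlonglongrightarrow> c t"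
    and "isCont c 0"
  shows "bounded_in_prob Z"
  using assms tight_of_char_tendsto[OF assms] by (intro bounded_in_probI) blast+

text \<open>Slutsky's theorem: the integrands differ by a unimodular factor times
  \<open>iexp\<close> of the difference minus 1, which is small on the good event and at most 2 in
  modulus elsewhere.\<close>

lemma char_tendsto_cong:
  fixes Z W :: "nat \<Rightarrow> 'a \<Rightarrow> 'b :: euclidean_space"
  assumes [measurable]: "\<And>n. Z n \<in> borel_measurable M" "\<And>n. W n \<in> borel_measurable M"
    and lim: "(\<lambda>n. CLINT \<omega>|M. iexp (t \<bullet> Z n \<omega>)) \<longlonglongrightarrow> c"
    and diff: "((\<lambda>x. W (fst x) (snd x) - Z (fst x) (snd x)) \<longlongrightarrow> 0) (in_prob M)"
  shows "(\<lambda>n. CLINT \<omega>|M. iexp (t \<bullet> W n \<omega>)) \<longlonglongrightarrow> c"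
proof -
  have "(\<lambda>n. (CLINT \<omega>|M. iexp (t \<bullet> W n \<omega>)) - (CLINT \<omega>|M. iexp (t \<bullet> Z n \<omega>))) \<longlonglongrightarrow> 0"
  proof (rule tendstoI)
    fix e :: real assume "e > 0"
    then have e4: "e / 4 > 0" by simp
    have "((\<lambda>x. iexp (t \<bullet> (W (fst x) (snd x) - Z (fst x) (snd x)))) \<longlongrightarrow> iexp (t \<bullet> 0)) (in_prob M)"
      by (intro tendsto_intros diff)
    from tendstoD[OF this e4]
    have "eventually (\<lambda>x. cmod (iexp (t \<bullet> (W (fst x) (snd x) - Z (fst x) (snd x))) - 1) < e / 4) (in_prob M)"
      by (simp add: dist_norm)
    from this[unfolded eventually_in_prob, rule_format, OF e4]
    have "\<forall>\<^sub>F n in sequentially. \<exists>E\<in>events. prob (space M - E) < e / 4 \<and>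
        (\<forall>\<omega>\<in>E. cmod (iexp (t \<bullet> (W n \<omega> - Z n \<omega>)) - 1) < e / 4)"
      by simp
    then show "\<forall>\<^sub>F n in sequentially. dist ((CLINT \<omega>|M. iexp (t \<bullet> W n \<omega>)) - (CLINT \<omega>|M. iexp (t \<bullet> Z n \<omega>))) 0 < e"
    proof eventually_elim
      case (elim n)
      then obtain E where E[measurable]: "E \<in> events" "prob (space M - E) < e / 4"
        "\<forall>\<omega>\<in>E. cmod (iexp (t \<bullet> (W n \<omega> - Z n \<omega>)) - 1) < e / 4" by blast
      have int: "integrable M (indicat_real (space M - E))"
        by (intro integrable_real_indicator) (auto simp: emeasure_eq_measure)
      have "norm ((CLINT \<omega>|M. iexp (t \<bullet> W n \<omega>)) - (CLINT \<omega>|M. iexp (t \<bullet> Z n \<omega>)))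
          = norm (CLINT \<omega>|M. iexp (t \<bullet> W n \<omega>) - iexp (t \<bullet> Z n \<omega>))"
        by (simp add: integrable_iexp_inner)
      also have "\<dots> \<le> expectation (\<lambda>\<omega>. norm (iexp (t \<bullet> W n \<omega>) - iexp (t \<bullet> Z n \<omega>)))"
        by (rule integral_norm_bound)
      also have "\<dots> \<le> expectation (\<lambda>\<omega>. e / 4 + 2 * indicat_real (space M - E) \<omega>)"
      proof (rule integral_mono)
        show "integrable M (\<lambda>\<omega>. norm (iexp (t \<bullet> W n \<omega>) - iexp (t \<bullet> Z n \<omega>)))"
          by (intro integrable_norm Bochner_Integration.integrable_diff integrable_iexp_inner) auto
        show "integrable M (\<lambda>\<omega>. e / 4 + 2 * indicat_real (space M - E) \<omega>)"
          using int by simp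
        fix \<omega> assume w: "\<omega> \<in> space M"
        have eq: "iexp (t \<bullet> W n \<omega>) - iexp (t \<bullet> Z n \<omega>) =
            iexp (t \<bullet> Z n \<omega>) * (iexp (t \<bullet> (W n \<omega> - Z n \<omega>)) - 1)"
          unfolding right_diff_distrib iexp_add[symmetric] by (simp add: inner_diff_right)
        show "norm (iexp (t \<bullet> W n \<omega>) - iexp (t \<bullet> Z n \<omega>)) \<le> e / 4 + 2 * indicator (space M - E) \<omega>"
        proof (cases "\<omega> \<in> E")
          case True
          then show ?thesis using E(3) \<open>e > 0\<close>
            unfolding eq norm_mult by (auto simp: indicator_def intro: less_imp_le)
        next
          case False
          have "norm (iexp (t \<bullet> W n \<omega>) - iexp (t \<bullet> Z n \<omega>)) \<le> 1 + 1"
            by (rule norm_triangle_le_diff) simp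
          then show ?thesis using False w \<open>e > 0\<close> by (simp add: indicator_def)
        qed
      qed
      also have "\<dots> = e / 4 + 2 * prob (space M - E)"
        using int by (simp add: prob_space Int_absorb2)
      also have "\<dots> < e" using E(2) \<open>e > 0\<close> by simp
      finally show ?case by simp
    qed
  qed
  from tendsto_add[OF this lim] show ?thesis by simp
qed

end

section \<open>Levy's continuity theorem for random vectors\<close>

text \<open>Arbitrary phases \<open>b\<close> include the sines and, by the product-to-sum formula,
  close the class under multiplication, as Stone-Weierstrass requires.\<close>

inductive trig_poly :: "('b :: real_inner \<Rightarrow> real) \<Rightarrow> bool" where
  cos: "trig_poly (\<lambda>x. a * cos (t \<bullet> x + b))"
| add: "trig_poly f \<Longrightarrow> trig_poly g \<Longrightarrow> trig_poly (\<lambda>x. f x + g x)"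

lemma trig_poly_const: "trig_poly (\<lambda>x. a)"
  using trig_poly.cos[of a 0 0] by simp

lemma trig_poly_mult:
  assumes "trig_poly f" "trig_poly g"
  shows "trig_poly (\<lambda>x. f x * g x)"
  using assms(1)
proof induction
  case (cos a t b)
  from assms(2) show ?case
  proof induction
    case (cos a' t' b')
    have "(\<lambda>x. a * cos (t \<bullet> x + b) * (a' * cos (t' \<bullet> x + b'))) =
        (\<lambda>x. (a * a' / 2) * cos ((t - t') \<bullet> x + (b - b')) + (a * a' / 2) * cos ((t + t') \<bullet> x + (b + b')))"
    proof
      fix x
      have aux: "a * C * (a' * C') = (a * a' / 2) * D + (a * a' / 2) * E"
        if "C * C' = (D + E) / 2" for C C' D E :: real
      proof -
        have "a * C * (a' * C') = a * a' * (C * C')" by simp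
        then show ?thesis unfolding that by (simp add: field_simps)
      qed
      have eq: "(t - t') \<bullet> x + (b - b') = (t \<bullet> x + b) - (t' \<bullet> x + b')"
        "(t + t') \<bullet> x + (b + b') = (t \<bullet> x + b) + (t' \<bullet> x + b')"
        by (simp_all add: inner_simps)
      show "a * cos (t \<bullet> x + b) * (a' * cos (t' \<bullet> x + b')) =
        (a * a' / 2) * cos ((t - t') \<bullet> x + (b - b')) + (a * a' / 2) * cos ((t + t') \<bullet> x + (b + b'))"
        unfolding eq by (rule aux[OF cos_times_cos])
    qed
    then show ?case by (simp only:) (intro trig_poly.intros)
  next
    case (add f g)
    then show ?case by (simp add: distrib_left trig_poly.intros)
  qed
next
  case (add f g)
  then show ?case by (simp add: distrib_right trig_poly.intros)
qed

text \<open>The function is periodised through the torus of angles \<open>x j / L\<close>: Stone-Weierstrass on the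
  torus controls the trigonometric polynomial on the whole space, not only on a box.\<close>

lemma trig_poly_approx:
  fixes \<Phi> :: "real ^ 'n \<Rightarrow> real"
  assumes cont: "continuous_on UNIV \<Phi>" and L: "L > 0"
    and supp: "\<And>x. (\<exists>j. \<bar>x $ j\<bar> \<ge> L * pi / 2) \<Longrightarrow> \<Phi> x = 0"
    and B: "\<And>x. \<bar>\<Phi> x\<bar> \<le> B" and "e > 0"
  obtains p where "trig_poly p" "\<And>x. \<bar>p x\<bar> \<le> B + e"
    "\<And>x. (\<And>j. \<bar>x $ j\<bar> < L * pi) \<Longrightarrow> \<bar>p x - \<Phi> x\<bar> < e"
proof -
  define T :: "(complex ^ 'n) set" where "T = {z. \<forall>j. norm (z $ j) = 1}"
  define E :: "real ^ 'n \<Rightarrow> complex ^ 'n" where "E x = (\<chi> j. cis (x $ j / L))" for x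
  define F where "F z = \<Phi> (\<chi> j. L * Arg (z $ j))" for z :: "complex ^ 'n"
  have ET: "E x \<in> T" for x by (simp add: E_def T_def)
  have T_nz: "z $ j \<noteq> 0" if "z \<in> T" for z j
    using that unfolding T_def by (metis (mono_tags) mem_Collect_eq norm_zero zero_neq_one)
  have "closed T"
    unfolding T_def by (intro closed_Collect_all closed_Collect_eq continuous_intros)
  moreover have "bounded T"
    unfolding bounded_iff
  proof (intro exI ballI)
    fix z assume "z \<in> T"
    have "norm z \<le> (\<Sum>j\<in>UNIV. norm (z $ j))"
      unfolding norm_vec_def by (rule L2_set_le_sum) simp
    also have "\<dots> = real CARD('n)" using \<open>z \<in> T\<close> by (simp add: T_def)
    finally show "norm z \<le> real CARD('n)" .
  qed
  ultimately have T: "compact T" by (simp add: compact_eq_bounded_closed)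
  \<comment> \<open>\<open>Arg\<close> jumps on the negative real axis. The open cover avoids the
    jump: \<open>A None\<close> stays away from every cut, and on \<open>A (Some j)\<close> the
    angle in coordinate \<open>j\<close> exceeds pi / 2 in modulus, where the support condition
    makes \<open>F\<close> vanish.\<close>
  define A :: "'n option \<Rightarrow> (complex ^ 'n) set" where
    "A k = (case k of None \<Rightarrow> {z. \<forall>j. z $ j \<notin> \<real>\<^sub>\<le>\<^sub>0} | Some j \<Rightarrow> {z. Re (z $ j) < 0})" for k
  have "continuous_on (\<Union>k\<in>UNIV. A k) F"
  proof (rule continuous_on_open_UN)
    fix k :: "'n option"
    have o: "open {z :: complex ^ 'n. z $ j \<notin> \<real>\<^sub>\<le>\<^sub>0}" for j
    proof -
      have "closed ((\<lambda>z :: complex ^ 'n. z $ j) -` \<real>\<^sub>\<le>\<^sub>0)"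
        by (intro closed_vimage continuous_intros) auto
      then show ?thesis by (simp add: open_closed vimage_def Compl_eq)
    qed
    show "open (A k)"
    proof (cases k)
      case None
      have "A k = (\<Inter>j. {z. z $ j \<notin> \<real>\<^sub>\<le>\<^sub>0})" using None by (auto simp: A_def)
      then show ?thesis using o by (simp add: open_INT)
    next
      case (Some j)
      then show ?thesis by (auto simp: A_def intro!: open_Collect_less continuous_intros)
    qed
    show "continuous_on (A k) F"
    proof (cases k)
      case None
      then have Ak: "A k = {z. \<forall>j. z $ j \<notin> \<real>\<^sub>\<le>\<^sub>0}" by (simp add: A_def)
      have "continuous_on (A k) (\<lambda>z. Arg (z $ j))" for j
        by (rule continuous_on_compose2[of "{z. z \<notin> \<real>\<^sub>\<le>\<^sub>0}" Arg])
           (auto simp: Ak intro!: continuous_intros continuous_at_imp_continuous_on continuous_at_Arg)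
      then show ?thesis
        unfolding F_def
        by (intro continuous_on_compose2[OF cont] continuous_on_vec_lambda continuous_on_mult
          continuous_on_const) auto
    next
      case (Some j)
      have "F z = 0" if "z \<in> A k" for z
      proof -
        have "Re (z $ j) < 0" using that Some by (simp add: A_def)
        then have "\<bar>Arg (z $ j)\<bar> \<ge> pi / 2"
          using Re_Ln_pos_lt[of "z $ j"] Arg_eq_Im_Ln[of "z $ j"] by force
        then have "L * (pi / 2) \<le> L * \<bar>Arg (z $ j)\<bar>" using L by (intro mult_left_mono) auto
        then show ?thesis using L unfolding F_def by (intro supp exI[of _ j]) (auto simp: abs_mult)
      qed
      then show ?thesis using continuous_on_cong[of "A k" "A k" F "\<lambda>_. 0"] by simp
    qed
  qed
  moreover have "T \<subseteq> (\<Union>k\<in>UNIV. A k)"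
  proof
    fix z assume z: "z \<in> T"
    show "z \<in> (\<Union>k\<in>UNIV. A k)"
    proof (cases "\<forall>j. z $ j \<notin> \<real>\<^sub>\<le>\<^sub>0")
      case True
      then have "z \<in> A None" by (simp add: A_def)
      then show ?thesis by blast
    next
      case False
      then obtain j where j: "z $ j \<in> \<real>\<^sub>\<le>\<^sub>0" by blast
      with T_nz[OF z, of j] have "z \<in> A (Some j)"
        by (auto simp: A_def complex_nonpos_Reals_iff complex_eq_iff)
      then show ?thesis by blast
    qed
  qed
  ultimately have F: "continuous_on T F" by (rule continuous_on_subset)
  let ?P = "\<lambda>g. continuous_on T g \<and> trig_poly (\<lambda>x. g (E x))"
  have Re_E: "trig_poly (\<lambda>x. Re (E x $ j))" for j
    using trig_poly.cos[of 1 "axis j (1 / L)" 0] by (simp add: E_def inner_axis')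
  \<comment> \<open>The sine is a cosine with phase \<open>- pi / 2\<close>.\<close>
  have Im_E: "trig_poly (\<lambda>x. Im (E x $ j))" for j
    using trig_poly.cos[of 1 "axis j (1 / L)" "- pi / 2"]
    by (simp add: E_def inner_axis' cos_diff)
  have "\<exists>g. ?P g \<and> (\<forall>z\<in>T. \<bar>F z - g z\<bar> < e)"
  proof (rule Stone_Weierstrass_HOL[OF T _ _ _ _ _ F \<open>e > 0\<close>])
    fix y z assume "y \<in> T \<and> z \<in> T \<and> y \<noteq> z"
    then obtain j where "y $ j \<noteq> z $ j" by (auto simp: vec_eq_iff)
    then have "Re (y $ j) \<noteq> Re (z $ j) \<or> Im (y $ j) \<noteq> Im (z $ j)"
      by (simp add: complex_eq_iff)
    moreover have "?P (\<lambda>z. Re (z $ j))" "?P (\<lambda>z. Im (z $ j))"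
      using Re_E Im_E by (auto intro!: continuous_intros)
    ultimately show "\<exists>g. ?P g \<and> g y \<noteq> g z" by blast
  qed (auto intro!: continuous_intros trig_poly_const trig_poly.add trig_poly_mult)
  then obtain g where g: "?P g" "\<And>z. z \<in> T \<Longrightarrow> \<bar>F z - g z\<bar> < e" by blast
  show thesis
  proof
    show "trig_poly (\<lambda>x. g (E x))" using g by blast
    fix x
    show "\<bar>g (E x)\<bar> \<le> B + e"
      using g(2)[OF ET, of x] B[of "\<chi> j. L * Arg (E x $ j)"] unfolding F_def by linarith
    assume x: "\<And>j. \<bar>x $ j\<bar> < L * pi"
    have "L * Arg (E x $ j) = x $ j" for j
    proof -
      have "x $ j / L \<in> {-pi<..pi}"
        using x[of j] L by (auto simp: field_simps abs_less_iff)
      then show ?thesis using L by (simp add: E_def Arg_cis)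
    qed
    then have "F (E x) = \<Phi> x" by (simp add: F_def)
    with g(2)[OF ET, of x] show "\<bar>g (E x) - \<Phi> x\<bar> < e" by (simp add: abs_minus_commute)
  qed
qed

text \<open>A phase-shifted cosine is the real part of a constant times a character. Measurability
  and boundedness ride along because splitting the integral of a sum calls for
  integrability.\<close>

lemma (in prob_space) tendsto_trig_poly:
  fixes Z :: "nat \<Rightarrow> 'a \<Rightarrow> 'b :: euclidean_space"
  assumes Z[measurable]: "\<And>n. Z n \<in> borel_measurable M"
    and \<nu>: "prob_space \<nu>" "sets \<nu> = sets borel"
    and lim: "\<And>t. (\<lambda>n. CLINT \<omega>|M. iexp (t \<bullet> Z n \<omega>)) \<longlonglongrightarrow> (CLINT x|\<nu>. iexp (t \<bullet> x))"
    and "trig_poly p"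
  shows "p \<in> borel_measurable borel \<and> (\<exists>B. \<forall>x. \<bar>p x\<bar> \<le> B) \<and>
    (\<lambda>n. \<integral>\<omega>. p (Z n \<omega>) \<partial>M) \<longlonglongrightarrow> (\<integral>x. p x \<partial>\<nu>)"
  using \<open>trig_poly p\<close>
proof induction
  interpret N: prob_space \<nu> by fact
  note \<nu>(2)[measurable_cong]
  case (cos a t b)
  have eq: "a * cos (t \<bullet> x + b) = Re (complex_of_real a * iexp b * iexp (t \<bullet> x))" for x
    by (simp add: cos_add exp_Euler cos_of_real sin_of_real algebra_simps)
  have "(\<lambda>n. Re (complex_of_real a * iexp b * (CLINT \<omega>|M. iexp (t \<bullet> Z n \<omega>)))) \<longlonglongrightarrow>
      Re (complex_of_real a * iexp b * (CLINT x|\<nu>. iexp (t \<bullet> x)))"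
    by (intro tendsto_intros lim)
  moreover have "Re (complex_of_real a * iexp b * (CLINT \<omega>|M. iexp (t \<bullet> Z n \<omega>))) =
      (\<integral>\<omega>. a * cos (t \<bullet> Z n \<omega> + b) \<partial>M)" for n
    unfolding eq
    by (subst integral_Re) (auto intro!: integrable_mult_right integrable_iexp_inner simp del: exp_Euler)
  moreover have "Re (complex_of_real a * iexp b * (CLINT x|\<nu>. iexp (t \<bullet> x))) =
      (\<integral>x. a * cos (t \<bullet> x + b) \<partial>\<nu>)"
    unfolding eq
    by (subst integral_Re) (auto intro!: integrable_mult_right N.integrable_iexp_inner)
  moreover have "\<bar>a * cos (t \<bullet> x + b)\<bar> \<le> \<bar>a\<bar>" for x
    by (simp add: abs_mult mult_left_le)
  ultimately show ?case by (auto intro!: borel_measurable_continuous_onI continuous_intros)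
next
  interpret N: prob_space \<nu> by fact
  note \<nu>(2)[measurable_cong]
  case (add f g)
  then obtain Bf Bg where B: "\<And>x. \<bar>f x\<bar> \<le> Bf" "\<And>x. \<bar>g x\<bar> \<le> Bg" by blast
  note [measurable] = add.IH(1)[THEN conjunct1] add.IH(2)[THEN conjunct1]
  have "integrable M (\<lambda>\<omega>. f (Z n \<omega>))" "integrable M (\<lambda>\<omega>. g (Z n \<omega>))" for n
    using B by (auto intro: integrable_const_bound[where B = Bf] integrable_const_bound[where B = Bg])
  moreover have "integrable \<nu> f" "integrable \<nu> g"
    using B by (auto intro: N.integrable_const_bound[where B = Bf] N.integrable_const_bound[where B = Bg])
  moreover have "(\<lambda>n. (\<integral>\<omega>. f (Z n \<omega>) \<partial>M) + (\<integral>\<omega>. g (Z n \<omega>) \<partial>M)) \<longlonglongrightarrow>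
     (\<integral>x. f x \<partial>\<nu>) + (\<integral>x. g x \<partial>\<nu>)"
    using add.IH by (intro tendsto_add) auto
  moreover have "\<bar>f x + g x\<bar> \<le> Bf + Bg" for x
    using B[of x] by linarith
  ultimately show ?case by auto
qed

text \<open>Tightness allows the test function to be cut off outside a large ball. The trigonometric
  approximant of the cut-off is then close to it on the ball and merely bounded off the ball, where
  all laws involved have little mass.\<close>

theorem (in prob_space) conv_in_distr_of_char_tendsto:
  fixes Z :: "nat \<Rightarrow> 'a \<Rightarrow> real ^ 'n"
  assumes Z[measurable]: "\<And>n. Z n \<in> borel_measurable M"
    and \<nu>: "prob_space \<nu>" "sets \<nu> = sets borel"
    and lim: "\<And>t. (\<lambda>n. CLINT \<omega>|M. iexp (t \<bullet> Z n \<omega>)) \<longlonglongrightarrow> (CLINT x|\<nu>. iexp (t \<bullet> x))"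
  shows "conv_in_distr M Z \<nu>"
  unfolding conv_in_distr_def
proof (intro allI impI, elim conjE)
  fix \<phi> :: "real ^ 'n \<Rightarrow> real"
  assume cont: "continuous_on UNIV \<phi>" and bdd: "bounded (range \<phi>)"
  interpret N: prob_space \<nu> by fact
  note \<nu>(2)[measurable_cong]
  have [measurable]: "\<phi> \<in> borel_measurable borel"
    using cont by (rule borel_measurable_continuous_onI)
  from bdd obtain B where B: "B > 0" "\<And>x. \<bar>\<phi> x\<bar> \<le> B"
    unfolding bounded_pos by auto
  have isCont: "isCont (\<lambda>t. CLINT x|\<nu>. iexp (t \<bullet> x)) 0"
    unfolding continuous_at_sequentially
  proof (intro allI impI)
    fix s :: "nat \<Rightarrow> real ^ 'n" assume s: "s \<longlonglongrightarrow> 0"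
    show "((\<lambda>t. CLINT x|\<nu>. iexp (t \<bullet> x)) \<circ> s) \<longlonglongrightarrow> (CLINT x|\<nu>. iexp (0 \<bullet> x))"
      unfolding comp_def
      by (rule integral_dominated_convergence[where w = "\<lambda>_. 1"])
         (auto intro!: tendsto_eq_intros s)
  qed
  show "(\<lambda>n. \<integral>\<omega>. \<phi> (Z n \<omega>) \<partial>M) \<longlonglongrightarrow> (\<integral>x. \<phi> x \<partial>\<nu>)"
  proof (rule tendstoI)
    fix e :: real assume e: "e > 0"
    \<comment> \<open>The final error is \<open>d * (4 * B + 5)\<close>: exchanging \<phi> and the
      approximant costs \<open>d + (2 * B + 1) * d\<close> under each of the two laws, and the limit
      for the approximant costs another \<open>d\<close>.\<close>
    define d where "d = e / (6 * (B + 1) + 6)"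
    have d: "d > 0" using e B(1) by (simp add: d_def)
    obtain R1 where R1: "\<forall>\<^sub>F n in sequentially. prob {\<omega> \<in> space M. norm (Z n \<omega>) > R1} < d"
      using tight_of_char_tendsto[OF Z lim isCont d] by blast
    \<comment> \<open>The limit law is tight as well, by the same lemma applied to a constant
      sequence.\<close>
    obtain R2 where R2: "N.prob {x \<in> space \<nu>. norm x > R2} < d"
      using N.tight_of_char_tendsto[of "\<lambda>_ x. x", OF _ tendsto_const isCont d]
      by (auto simp: eventually_sequentially)
    define R where "R = max 1 (max R1 R2)"
    have R: "R > 0" by (simp add: R_def)
    define \<Phi> where "\<Phi> x = \<phi> x * max 0 (min 1 (2 - norm x / R))" for x
    have \<Phi>_B: "\<bar>\<Phi> x\<bar> \<le> B" for x
    proof -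
      have "\<bar>\<Phi> x\<bar> \<le> \<bar>\<phi> x\<bar> * 1"
        unfolding \<Phi>_def abs_mult by (intro mult_left_mono) auto
      then show ?thesis using B(2)[of x] by simp
    qed
    have \<Phi>_eq: "\<Phi> x = \<phi> x" if "norm x \<le> R" for x
    proof -
      have "norm x / R \<le> 1" using that R by simp
      then show ?thesis by (simp add: \<Phi>_def)
    qed
    \<comment> \<open>With torus scale \<open>L = 2 * R\<close> the function must vanish once a
      coordinate reaches \<open>R * pi\<close>. The cut-off already vanishes from norm
      \<open>2 * R\<close> on, and pi is at least 2.\<close>
    have \<Phi>_0: "\<Phi> x = 0" if "\<exists>j. \<bar>x $ j\<bar> \<ge> (2 * R) * pi / 2" for x
    proof -
      from that obtain j where j: "\<bar>x $ j\<bar> \<ge> (2 * R) * pi / 2" by blast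
      have "2 * R \<le> R * pi" using R pi_ge_two by (simp add: mult.commute)
      also have "\<dots> \<le> norm x" using j component_le_norm_cart[of x j] by simp
      finally have "2 \<le> norm x / R" using R by (simp add: field_simps)
      then show ?thesis by (simp add: \<Phi>_def)
    qed
    have \<Phi>_cont: "continuous_on UNIV \<Phi>"
      unfolding \<Phi>_def using R by (intro continuous_intros cont) auto
    have "2 * R > 0" "min d 1 > 0" using R d by auto
    from trig_poly_approx[OF \<Phi>_cont this(1) \<Phi>_0 \<Phi>_B this(2)] obtain p where p: "trig_poly p"
      "\<And>x. \<bar>p x\<bar> \<le> B + min d 1" "\<And>x. (\<And>j. \<bar>x $ j\<bar> < 2 * R * pi) \<Longrightarrow> \<bar>p x - \<Phi> x\<bar> < min d 1"
      by blast
    have p_\<phi>: "\<bar>p x - \<phi> x\<bar> \<le> d + (2 * B + 1) * indicator {x. norm x > R} x" for x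
    proof (cases "norm x \<le> R")
      case True
      have "\<bar>x $ j\<bar> < 2 * R * pi" for j
      proof -
        have "\<bar>x $ j\<bar> \<le> R * 1" using True component_le_norm_cart[of x j] by simp
        also have "\<dots> < R * (2 * pi)" using R pi_ge_two by (intro mult_strict_left_mono) auto
        finally show ?thesis by (simp add: mult_ac)
      qed
      from p(3)[OF this] True show ?thesis by (simp add: \<Phi>_eq)
    next
      case False
      then show ?thesis using p(2)[of x] B(2)[of x] d by (simp add: indicator_def)
    qed
    note tp = tendsto_trig_poly[OF Z \<nu> lim p(1)]
    then have [measurable]: "p \<in> borel_measurable borel" by blast
    have bnd: "\<bar>(\<integral>x. p x \<partial>\<mu>) - (\<integral>x. \<phi> x \<partial>\<mu>)\<bar> \<le> d + (2 * B + 1) * d"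
      if "prob_space \<mu>" "sets \<mu> = sets borel" "measure \<mu> {x \<in> space \<mu>. norm x > R} \<le> d" for \<mu>
    proof -
      interpret X: prob_space \<mu> by fact
      note that(2)[measurable_cong]
      have "{x \<in> space \<mu>. norm x > R} = {x. norm x > R}"
        using sets_eq_imp_space_eq[OF that(2)] by simp
      then have le: "measure \<mu> {x. norm x > R} \<le> d" using that(3) by simp
      have i1: "integrable \<mu> p" "integrable \<mu> \<phi>"
        using p(2) B(2) by (auto intro: X.integrable_const_bound[where B = "B + min d 1"]
          X.integrable_const_bound[where B = B])
      have i2: "integrable \<mu> (indicat_real {x. norm x > R})"
        by (intro integrable_real_indicator) (auto simp: X.emeasure_eq_measure)
      have "\<bar>(\<integral>x. p x \<partial>\<mu>) - (\<integral>x. \<phi> x \<partial>\<mu>)\<bar> = \<bar>\<integral>x. p x - \<phi> x \<partial>\<mu>\<bar>"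
        using i1 by simp
      also have "\<dots> \<le> (\<integral>x. \<bar>p x - \<phi> x\<bar> \<partial>\<mu>)"
        by (rule integral_abs_bound)
      also have "\<dots> \<le> (\<integral>x. d + (2 * B + 1) * indicat_real {x. norm x > R} x \<partial>\<mu>)"
        by (intro integral_mono p_\<phi> integrable_abs Bochner_Integration.integrable_diff i1
          Bochner_Integration.integrable_add integrable_mult_right i2 X.integrable_const)
      also have "\<dots> = d + (2 * B + 1) * measure \<mu> {x. norm x > R}"
        using i2 sets_eq_imp_space_eq[OF that(2)] X.prob_space by simp
      also have "\<dots> \<le> d + (2 * B + 1) * d"
        using le B(1) by (intro add_left_mono mult_left_mono) auto
      finally show ?thesis .
    qed
    have "\<forall>\<^sub>F n in sequentially. dist (\<integral>\<omega>. p (Z n \<omega>) \<partial>M) (\<integral>x. p x \<partial>\<nu>) < d"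
      using tp d by (intro tendstoD) auto
    with R1 show "\<forall>\<^sub>F n in sequentially. dist (\<integral>\<omega>. \<phi> (Z n \<omega>) \<partial>M) (\<integral>x. \<phi> x \<partial>\<nu>) < e"
    proof eventually_elim
      case (elim n)
      have "prob {\<omega> \<in> space M. norm (Z n \<omega>) > R} \<le> prob {\<omega> \<in> space M. norm (Z n \<omega>) > R1}"
        by (intro finite_measure_mono) (auto simp: R_def)
      then have "measure (distr M borel (Z n)) {x \<in> space (distr M borel (Z n)). norm x > R} \<le> d"
        using elim(1) by (subst measure_distr) (auto simp: vimage_def Int_def conj_commute)
      from bnd[OF prob_space_distr[OF Z] sets_distr this]
      have 1: "\<bar>(\<integral>\<omega>. p (Z n \<omega>) \<partial>M) - (\<integral>\<omega>. \<phi> (Z n \<omega>) \<partial>M)\<bar> \<le> d + (2 * B + 1) * d"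
        by (simp add: integral_distr)
      have "N.prob {x \<in> space \<nu>. norm x > R} \<le> N.prob {x \<in> space \<nu>. norm x > R2}"
        by (intro N.finite_measure_mono) (auto simp: R_def)
      then have 2: "\<bar>(\<integral>x. p x \<partial>\<nu>) - (\<integral>x. \<phi> x \<partial>\<nu>)\<bar> \<le> d + (2 * B + 1) * d"
        using R2 by (intro bnd \<nu>) auto
      have "dist (\<integral>\<omega>. \<phi> (Z n \<omega>) \<partial>M) (\<integral>x. \<phi> x \<partial>\<nu>) < 2 * (d + (2 * B + 1) * d) + d"
      proof -
        have "\<bar>b - b'\<bar> < 2 * q + d" if "\<bar>a - b\<bar> \<le> q" "\<bar>a' - b'\<bar> \<le> q" "\<bar>a - a'\<bar> < d"
          for a a' b b' q :: real
          using that by linarith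
        from this[OF 1 2] elim(2) show ?thesis by (simp add: dist_real_def)
      qed
      also have "\<dots> = d * (4 * B + 5)" by (simp add: algebra_simps)
      also have "\<dots> \<le> d * (6 * (B + 1) + 6)" using d B(1) by (intro mult_left_mono) auto
      also have "\<dots> = e" using B(1) by (simp add: d_def)
      finally show ?case .
    qed
  qed
qed

section \<open>Symmetric matrices\<close>

lemma inner_symmetric_matrix:
  fixes A :: "real ^ 'n ^ 'n"
  assumes "transpose A = A"
  shows "x \<bullet> (A *v y) = (A *v x) \<bullet> y"
  by (metis assms dot_lmul_matrix vector_transpose_matrix)

lemma linear_coeff_zero_of_nonneg:
  fixes b c :: real
  assumes "\<And>t. 0 \<le> 2 * t * b + t\<^sup>2 * c" "0 \<le> c"
  shows "b = 0"
proof -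
  \<comment> \<open>The parabola has its minimum at \<open>- b / c\<close>; using
    \<open>c + 1\<close> avoids division by 0 and still gives a negative value unless
    \<open>b = 0\<close>.\<close>
  have "0 \<le> 2 * (- b / (c + 1)) * b + (- b / (c + 1))\<^sup>2 * c" by (rule assms)
  also have "\<dots> = - (b\<^sup>2 * (c + 2)) / (c + 1)\<^sup>2"
    using assms(2) by (simp add: field_simps power2_eq_square add_nonneg_eq_0_iff)
  finally have "b\<^sup>2 * (c + 2) \<le> 0"
    using assms(2) by (subst (asm) pos_le_divide_eq) auto
  moreover have "0 \<le> b\<^sup>2 * (c + 2)" using assms(2) by simp
  ultimately show ?thesis using assms(2) by simp
qed

text \<open>A maximiser \<open>v\<close> of the Rayleigh quotient on the unit sphere of
  \<open>W\<close> is an eigenvector. The form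
  \<open>l * (x \<bullet> x) - x \<bullet> (A *v x)\<close> is nonnegative on \<open>W\<close> and
  zero at \<open>v\<close>; moving from \<open>v\<close> along its own residual \<open>u\<close> has
  linear coefficient \<open>u \<bullet> u\<close>, which must vanish. Working in an invariant
  subspace permits iteration on orthogonal complements.\<close>

lemma symmetric_matrix_max_eigenvector:
  fixes A :: "real ^ 'n ^ 'n"
  assumes sym: "transpose A = A" and W: "subspace W" "W \<noteq> {0}"
    and inv: "\<And>x. x \<in> W \<Longrightarrow> A *v x \<in> W"
  obtains v l where "v \<in> W" "norm v = 1" "A *v v = l *\<^sub>R v"
    "\<And>x. x \<in> W \<Longrightarrow> x \<bullet> (A *v x) \<le> l * (x \<bullet> x)"
proof -
  let ?S = "sphere 0 1 \<inter> W"
  have "0 \<in> W" using W(1) by (rule subspace_0)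
  with W obtain w where w: "w \<in> W" "w \<noteq> 0" by blast
  have normalize: "(1 / norm x) *\<^sub>R x \<in> ?S" if "x \<in> W" "x \<noteq> 0" for x
    using that W(1) by (auto intro: subspace_scale)
  have "compact ?S" using W(1) by (intro compact_Int_closed closed_subspace) auto
  moreover have "?S \<noteq> {}" using normalize[OF w] by blast
  moreover have "continuous_on ?S (\<lambda>x. x \<bullet> (A *v x))"
    by (intro continuous_intros linear_continuous_on matrix_vector_mul_bounded_linear)
  ultimately obtain v where v: "v \<in> ?S" and max: "\<And>x. x \<in> ?S \<Longrightarrow> x \<bullet> (A *v x) \<le> v \<bullet> (A *v v)"
    using continuous_attains_sup[of ?S "\<lambda>x. x \<bullet> (A *v x)"] by blast
  define l where "l = v \<bullet> (A *v v)"
  have vv: "v \<bullet> v = 1" "v \<in> W" using v by (auto simp: dot_square_norm)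
  have le: "x \<bullet> (A *v x) \<le> l * (x \<bullet> x)" if x: "x \<in> W" for x
  proof (cases "x = 0")
    case False
    have "((1 / norm x) *\<^sub>R x) \<bullet> (A *v ((1 / norm x) *\<^sub>R x)) \<le> l"
      unfolding l_def by (intro max normalize x False)
    then have "(x \<bullet> (A *v x)) / (norm x)\<^sup>2 \<le> l"
      by (simp add: matrix_vector_mult_scaleR power2_eq_square)
    then show ?thesis using False by (simp add: divide_le_eq dot_square_norm)
  qed simp
  define u where "u = l *\<^sub>R v - A *v v"
  have u: "u \<in> W"
    unfolding u_def using vv W(1) inv by (intro subspace_diff subspace_scale) auto
  have "u \<bullet> u = 0"
  proof (rule linear_coeff_zero_of_nonneg)
    show "0 \<le> l * (u \<bullet> u) - u \<bullet> (A *v u)" using le[OF u] by simp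
    fix t :: real
    have "v + t *\<^sub>R u \<in> W" using vv u W(1) by (intro subspace_add subspace_scale) auto
    from le[OF this] have "0 \<le> l * ((v + t *\<^sub>R u) \<bullet> (v + t *\<^sub>R u)) - (v + t *\<^sub>R u) \<bullet> (A *v (v + t *\<^sub>R u))"
      by simp
    also have "\<dots> = 2 * t * (u \<bullet> u) + t\<^sup>2 * (l * (u \<bullet> u) - u \<bullet> (A *v u))"
    proof -
      have 1: "u \<bullet> u = l * (u \<bullet> v) - u \<bullet> (A *v v)"
        by (subst (2) u_def) (simp add: inner_diff_right)
      have 2: "v \<bullet> (A *v u) = u \<bullet> (A *v v)"
        using inner_symmetric_matrix[OF sym, of v u] by (simp add: inner_commute)
      have 3: "(v + t *\<^sub>R u) \<bullet> (v + t *\<^sub>R u) = 1 + 2 * t * (u \<bullet> v) + t\<^sup>2 * (u \<bullet> u)"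
        by (simp add: inner_simps vv inner_commute[of v u] power2_eq_square algebra_simps)
      have 4: "(v + t *\<^sub>R u) \<bullet> (A *v (v + t *\<^sub>R u)) =
          l + 2 * t * (u \<bullet> (A *v v)) + t\<^sup>2 * (u \<bullet> (A *v u))"
        by (simp add: matrix_vector_right_distrib matrix_vector_mult_scaleR inner_simps 2
          l_def[symmetric] power2_eq_square algebra_simps)
      have 5: "2 * t * (u \<bullet> u) = 2 * t * (l * (u \<bullet> v) - u \<bullet> (A *v v))"
        using 1 by simp
      show ?thesis unfolding 3 4 5 by (simp add: algebra_simps)
    qed
    finally show "0 \<le> 2 * t * (u \<bullet> u) + t\<^sup>2 * (l * (u \<bullet> u) - u \<bullet> (A *v u))" .
  qed
  then have "u = 0" by simp
  then have "A *v v = l *\<^sub>R v" unfolding u_def by simp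
  then show ?thesis using that[of v l] v le by simp
qed

text \<open>Makes the maximum in \<open>lambda_max\<close> meaningful: eigenvectors for distinct
  eigenvalues are orthogonal, and an orthogonal family in finite dimension is finite.\<close>

lemma finite_eigenvalues_symmetric:
  fixes A :: "real ^ 'n ^ 'n"
  assumes sym: "transpose A = A"
  shows "finite {l. \<exists>v. v \<noteq> 0 \<and> A *v v = l *s v}" (is "finite ?L")
proof -
  have "\<exists>f. \<forall>l\<in>?L. f l \<noteq> 0 \<and> A *v f l = l *s f l"
    by (rule bchoice) blast
  then obtain f where f: "\<And>l. l \<in> ?L \<Longrightarrow> f l \<noteq> 0 \<and> A *v f l = l *s f l"
    by blast
  have orth: "orthogonal (f k) (f l)" if "k \<in> ?L" "l \<in> ?L" "k \<noteq> l" for k l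
  proof -
    have "l * (f k \<bullet> f l) = f k \<bullet> (A *v f l)"
      using f[OF that(2)] by (simp add: scalar_mult_eq_scaleR)
    also have "\<dots> = k * (f k \<bullet> f l)"
      using f[OF that(1)] by (simp add: inner_symmetric_matrix[OF sym] scalar_mult_eq_scaleR)
    finally show ?thesis using that(3) by (simp add: orthogonal_def)
  qed
  have inj: "inj_on f ?L"
  proof (rule inj_onI, rule ccontr)
    fix k l assume "k \<in> ?L" "l \<in> ?L" "f k = f l" "k \<noteq> l"
    with orth[of k l] f[of k] show False by (simp add: orthogonal_self)
  qed
  have "finite (f ` ?L)"
    by (rule pairwise_orthogonal_imp_finite) (auto simp: pairwise_def intro: orth)
  then show ?thesis using inj by (rule finite_imageD)
qed

text \<open>The largest Rayleigh quotient is itself an eigenvalue.\<close>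

lemma rayleigh_le_lambda_max:
  fixes A :: "real ^ 'n ^ 'n"
  assumes sym: "transpose A = A"
  shows "x \<bullet> (A *v x) \<le> lambda_max A * (x \<bullet> x)"
proof -
  have "(axis undefined 1 :: real ^ 'n) \<noteq> 0" by (simp add: axis_eq_0_iff)
  then have "(UNIV :: (real ^ 'n) set) \<noteq> {0}" by (metis UNIV_I singletonD)
  from symmetric_matrix_max_eigenvector[OF sym subspace_UNIV this]
  obtain v l where v: "norm v = 1" "A *v v = l *\<^sub>R v" and le: "x \<bullet> (A *v x) \<le> l * (x \<bullet> x)"
    using UNIV_I by metis
  have "l \<le> lambda_max A"
    unfolding lambda_max_def using v
    by (intro Max_ge finite_eigenvalues_symmetric[OF sym])
       (auto simp: scalar_mult_eq_scaleR intro!: exI[of _ v])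
  then have "l * (x \<bullet> x) \<le> lambda_max A * (x \<bullet> x)" by (intro mult_right_mono) auto
  with le show ?thesis by simp
qed

text \<open>An orthonormal set of eigenvectors of largest cardinality must span: its orthogonal
  complement is invariant, and a nonzero complement would contain one more unit eigenvector.\<close>

lemma symmetric_matrix_orthonormal_eigenbasis:
  fixes A :: "real ^ 'n ^ 'n"
  assumes sym: "transpose A = A"
  shows "\<exists>E l. finite E \<and> (\<forall>e\<in>E. norm e = 1 \<and> A *v e = l e *\<^sub>R e) \<and>
    (\<forall>x. (\<Sum>e\<in>E. (e \<bullet> x) *\<^sub>R e) = x) \<and> pairwise orthogonal E"
proof -
  define P where "P E \<longleftrightarrow> pairwise orthogonal E \<and> (\<forall>e\<in>E. norm e = 1 \<and> (\<exists>l. A *v e = l *\<^sub>R e))" for E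
  have ind: "finite E \<and> card E \<le> CARD('n)" if "P E" for E
  proof -
    have "independent E"
      using that by (intro pairwise_orthogonal_independent) (force simp: P_def)+
    then show ?thesis using independent_bound[of E] by simp
  qed
  have "P {}" by (simp add: P_def)
  then obtain E where E: "P E" "\<And>F. P F \<Longrightarrow> card F \<le> card E"
    using ex_has_greatest_nat[of P "{}" card "CARD('n) + 1"] ind by (metis le_imp_less_Suc Suc_eq_plus1)
  have fin: "finite E" using ind[OF E(1)] by simp
  have orth: "pairwise orthogonal E" and unit: "\<And>e. e \<in> E \<Longrightarrow> norm e = 1"
    and eig: "\<And>e. e \<in> E \<Longrightarrow> \<exists>l. A *v e = l *\<^sub>R e"
    using E(1) by (auto simp: P_def)
  define W where "W = {x. \<forall>e\<in>E. orthogonal e x}"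
  have sub: "subspace W" unfolding W_def by (rule subspace_orthogonal_to_vectors)
  have W: "W = {0}"
  proof (rule ccontr)
    assume nz: "W \<noteq> {0}"
    have "A *v x \<in> W" if "x \<in> W" for x
      unfolding W_def
    proof (intro CollectI ballI)
      fix e assume e: "e \<in> E"
      from eig[OF e] obtain l where "A *v e = l *\<^sub>R e" by blast
      then show "orthogonal e (A *v x)"
        using that e by (auto simp: W_def orthogonal_def inner_symmetric_matrix[OF sym])
    qed
    from symmetric_matrix_max_eigenvector[OF sym sub nz this]
    obtain v l where v: "v \<in> W" "norm v = 1" "A *v v = l *\<^sub>R v" by metis
    have "v \<notin> E" using v by (auto simp: W_def orthogonal_self)
    have "P (insert v E)"
      unfolding P_def using v unit eig orth
      by (auto simp: W_def intro!: pairwise_orthogonal_insert intro: orthogonal_commute[THEN iffD1])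
    from E(2)[OF this] show False using \<open>v \<notin> E\<close> fin by simp
  qed
  have exp: "(\<Sum>e\<in>E. (e \<bullet> x) *\<^sub>R e) = x" for x
  proof -
    have "x - (\<Sum>e\<in>E. (e \<bullet> x) *\<^sub>R e) \<in> W"
      unfolding W_def
    proof (intro CollectI ballI)
      fix d assume d: "d \<in> E"
      have "d \<bullet> (\<Sum>e\<in>E. (e \<bullet> x) *\<^sub>R e) = (\<Sum>e\<in>E. (e \<bullet> x) * (d \<bullet> e))"
        by (simp add: inner_sum_right)
      also have "\<dots> = (\<Sum>e\<in>E. if e = d then d \<bullet> x else 0)"
      proof (rule sum.cong[OF refl])
        fix e assume "e \<in> E"
        then show "(e \<bullet> x) * (d \<bullet> e) = (if e = d then d \<bullet> x else 0)"
          using orth d unit[OF d] by (auto simp: pairwise_def orthogonal_def dot_square_norm)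
      qed
      also have "\<dots> = d \<bullet> x" using d fin by simp
      finally show "orthogonal d (x - (\<Sum>e\<in>E. (e \<bullet> x) *\<^sub>R e))"
        by (simp add: orthogonal_def inner_diff_right)
    qed
    then show ?thesis using W by simp
  qed
  from eig obtain l where "\<And>e. e \<in> E \<Longrightarrow> A *v e = l e *\<^sub>R e" by metis
  with fin unit exp orth show ?thesis by blast
qed

lemma matrix_vector_mult_sum_scaleR:
  fixes A :: "real ^ 'n ^ 'm"
  shows "A *v (\<Sum>e\<in>E. c e *\<^sub>R e) = (\<Sum>e\<in>E. c e *\<^sub>R (A *v e))"
  by (simp add: linear_sum[OF matrix_vector_mul_linear] matrix_vector_mult_scaleR)

text \<open>The symmetric square root, with the eigenvectors of \<open>S\<close> and the square
  roots of its eigenvalues. It shows that the choice in \<open>centred_normal\<close> has a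
  solution.\<close>

lemma psd_matrix_root:
  fixes S :: "real ^ 'n ^ 'n"
  assumes sym: "transpose S = S" and psd: "\<And>x. 0 \<le> x \<bullet> (S *v x)"
  shows "\<exists>B :: real ^ 'n ^ 'n. B ** transpose B = S"
proof -
  obtain E l where E: "finite E" "\<And>e. e \<in> E \<Longrightarrow> norm e = 1 \<and> S *v e = l e *\<^sub>R e"
    "\<And>x. (\<Sum>e\<in>E. (e \<bullet> x) *\<^sub>R e) = x" "pairwise orthogonal E"
    using symmetric_matrix_orthonormal_eigenbasis[OF sym] by blast
  have l: "0 \<le> l e" if "e \<in> E" for e
    using psd[of e] E(2)[OF that] by (simp add: dot_square_norm)
  define B :: "real ^ 'n ^ 'n" where "B = (\<chi> i j. \<Sum>e\<in>E. sqrt (l e) * e $ i * e $ j)"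
  have tB: "transpose B = B" by (simp add: B_def transpose_def mult_ac)
  have B: "B *v x = (\<Sum>e\<in>E. (sqrt (l e) * (e \<bullet> x)) *\<^sub>R e)" for x
  proof -
    have "(B *v x) $ i = (\<Sum>j\<in>UNIV. \<Sum>e\<in>E. sqrt (l e) * e $ i * e $ j * x $ j)" for i
      by (simp add: B_def matrix_vector_mult_def sum_distrib_right)
    also have "\<dots> i = (\<Sum>e\<in>E. sqrt (l e) * (e \<bullet> x) * e $ i)" for i
      by (subst sum.swap) (simp add: inner_vec_def sum_distrib_left sum_distrib_right mult_ac)
    finally show ?thesis by (simp add: vec_eq_iff)
  qed
  have Be: "B *v e = sqrt (l e) *\<^sub>R e" if e: "e \<in> E" for e
  proof -
    have "B *v e = (\<Sum>d\<in>E. if d = e then sqrt (l e) *\<^sub>R e else 0)"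
      unfolding B
    proof (rule sum.cong[OF refl])
      fix d assume "d \<in> E"
      then show "(sqrt (l d) * (d \<bullet> e)) *\<^sub>R d = (if d = e then sqrt (l e) *\<^sub>R e else 0)"
        using E(4) e E(2)[OF e] by (auto simp: pairwise_def orthogonal_def dot_square_norm)
    qed
    then show ?thesis using E(1) e by simp
  qed
  have "(B ** transpose B) *v x = S *v x" for x
  proof -
    have "(B ** transpose B) *v x = B *v (B *v x)"
      by (simp add: tB matrix_vector_mul_assoc)
    also have "\<dots> = (\<Sum>e\<in>E. (sqrt (l e) * (e \<bullet> x)) *\<^sub>R (B *v e))"
      by (subst B[of x]) (rule matrix_vector_mult_sum_scaleR)
    also have "\<dots> = (\<Sum>e\<in>E. (e \<bullet> x) *\<^sub>R (S *v e))"
    proof (rule sum.cong[OF refl])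
      fix e assume e: "e \<in> E"
      have "(sqrt (l e) * (e \<bullet> x)) *\<^sub>R (B *v e) = ((e \<bullet> x) * (sqrt (l e) * sqrt (l e))) *\<^sub>R e"
        unfolding Be[OF e] by (simp only: scaleR_scaleR mult_ac)
      then show "(sqrt (l e) * (e \<bullet> x)) *\<^sub>R (B *v e) = (e \<bullet> x) *\<^sub>R (S *v e)"
        using E(2)[OF e] l[OF e] by simp
    qed
    also have "\<dots> = S *v (\<Sum>e\<in>E. (e \<bullet> x) *\<^sub>R e)"
      by (rule matrix_vector_mult_sum_scaleR[symmetric])
    also have "\<dots> = S *v x" by (simp only: E(3))
    finally show ?thesis .
  qed
  then show ?thesis by (intro exI[of _ B] matrix_eq[THEN iffD2] allI)
qed

section \<open>Birkhoff's ergodic theorem\<close>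

lemma stationary_seqD:
  fixes Z :: "nat \<Rightarrow> 'a \<Rightarrow> 'b :: topological_space"
  assumes "stationary_seq M Z"
  shows "Z i \<in> borel_measurable M"
    and "distr M (\<Pi>\<^sub>M i\<in>UNIV. borel) (\<lambda>\<omega> i. Z (i + k) \<omega>) = distr M (\<Pi>\<^sub>M i\<in>UNIV. borel) (\<lambda>\<omega> i. Z i \<omega>)"
  using assms unfolding stationary_seq_def by blast+

lemma stationary_seq_integral_shift:
  fixes Z :: "nat \<Rightarrow> 'a \<Rightarrow> 'b :: topological_space" and F :: "(nat \<Rightarrow> 'b) \<Rightarrow> real"
  assumes Z: "stationary_seq M Z" and [measurable]: "F \<in> borel_measurable (\<Pi>\<^sub>M i\<in>UNIV. borel)"
  shows "(\<integral>\<omega>. F (\<lambda>i. Z (i + k) \<omega>) \<partial>M) = (\<integral>\<omega>. F (\<lambda>i. Z i \<omega>) \<partial>M)"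
    and "integrable M (\<lambda>\<omega>. F (\<lambda>i. Z (i + k) \<omega>)) \<longleftrightarrow> integrable M (\<lambda>\<omega>. F (\<lambda>i. Z i \<omega>))"
proof -
  note [measurable] = stationary_seqD(1)[OF Z]
  have [measurable]: "(\<lambda>\<omega> i. Z (i + k) \<omega>) \<in> M \<rightarrow>\<^sub>M (\<Pi>\<^sub>M i\<in>UNIV. borel)" for k
    by (rule measurable_PiM_single') (auto simp: space_PiM)
  from this[of 0] have [measurable]: "(\<lambda>\<omega> i. Z i \<omega>) \<in> M \<rightarrow>\<^sub>M (\<Pi>\<^sub>M i\<in>UNIV. borel)" by simp
  show "(\<integral>\<omega>. F (\<lambda>i. Z (i + k) \<omega>) \<partial>M) = (\<integral>\<omega>. F (\<lambda>i. Z i \<omega>) \<partial>M)"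
    using integral_distr[of "\<lambda>\<omega> i. Z (i + k) \<omega>" M "\<Pi>\<^sub>M i\<in>UNIV. borel" F]
      integral_distr[of "\<lambda>\<omega> i. Z i \<omega>" M "\<Pi>\<^sub>M i\<in>UNIV. borel" F] stationary_seqD(2)[OF Z, of k]
    by simp
  show "integrable M (\<lambda>\<omega>. F (\<lambda>i. Z (i + k) \<omega>)) \<longleftrightarrow> integrable M (\<lambda>\<omega>. F (\<lambda>i. Z i \<omega>))"
    using integrable_distr_eq[of "\<lambda>\<omega> i. Z (i + k) \<omega>" M "\<Pi>\<^sub>M i\<in>UNIV. borel" F]
      integrable_distr_eq[of "\<lambda>\<omega> i. Z i \<omega>" M "\<Pi>\<^sub>M i\<in>UNIV. borel" F] stationary_seqD(2)[OF Z, of k]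
    by simp
qed

lemma stationary_seq_integral:
  fixes Z :: "nat \<Rightarrow> 'a \<Rightarrow> 'b :: topological_space" and \<phi> :: "'b \<Rightarrow> real"
  assumes Z: "stationary_seq M Z" and [measurable]: "\<phi> \<in> borel_measurable borel"
  shows "(\<integral>\<omega>. \<phi> (Z k \<omega>) \<partial>M) = (\<integral>\<omega>. \<phi> (Z 0 \<omega>) \<partial>M)"
    and "integrable M (\<lambda>\<omega>. \<phi> (Z k \<omega>)) \<longleftrightarrow> integrable M (\<lambda>\<omega>. \<phi> (Z 0 \<omega>))"
proof -
  have "(\<lambda>z. \<phi> (z 0)) \<in> borel_measurable (\<Pi>\<^sub>M i\<in>(UNIV :: nat set). borel)" by measurable
  from stationary_seq_integral_shift[OF Z this, of k]
  show "(\<integral>\<omega>. \<phi> (Z k \<omega>) \<partial>M) = (\<integral>\<omega>. \<phi> (Z 0 \<omega>) \<partial>M)"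
    and "integrable M (\<lambda>\<omega>. \<phi> (Z k \<omega>)) \<longleftrightarrow> integrable M (\<lambda>\<omega>. \<phi> (Z 0 \<omega>))"
    by simp_all
qed

text \<open>\<open>psum_max \<phi> n z\<close> is the maximum over \<open>1 \<le> k \<le> n + 1\<close> of the sum of the first \<open>k\<close> terms.\<close>

fun psum_max :: "('b \<Rightarrow> real) \<Rightarrow> nat \<Rightarrow> (nat \<Rightarrow> 'b) \<Rightarrow> real" where
  "psum_max \<phi> 0 z = \<phi> (z 0)"
| "psum_max \<phi> (Suc n) z = \<phi> (z 0) + max 0 (psum_max \<phi> n (\<lambda>i. z (Suc i)))"

lemma psum_max_mono: "psum_max \<phi> n z \<le> psum_max \<phi> (Suc n) z"
proof (induction n arbitrary: z)
  case (Suc n)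
  have "psum_max \<phi> (Suc n) z = \<phi> (z 0) + max 0 (psum_max \<phi> n (\<lambda>i. z (Suc i)))" by simp
  also have "\<dots> \<le> \<phi> (z 0) + max 0 (psum_max \<phi> (Suc n) (\<lambda>i. z (Suc i)))"
    by (intro add_left_mono max.mono order_refl Suc.IH)
  also have "\<dots> = psum_max \<phi> (Suc (Suc n)) z" by simp
  finally show ?case .
qed simp

lemma psum_max_mono': "m \<le> n \<Longrightarrow> psum_max \<phi> m z \<le> psum_max \<phi> n z"
  by (rule lift_Suc_mono_le[of "\<lambda>n. psum_max \<phi> n z"]) (rule psum_max_mono)

lemma psum_le_psum_max: "(\<Sum>i<Suc n. \<phi> (z i)) \<le> psum_max \<phi> n z"
proof (induction n arbitrary: z)
  case (Suc n)
  have "(\<Sum>i<Suc (Suc n). \<phi> (z i)) = \<phi> (z 0) + (\<Sum>i<Suc n. \<phi> (z (Suc i)))"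
    by (rule sum.lessThan_Suc_shift)
  also have "\<dots> \<le> \<phi> (z 0) + psum_max \<phi> n (\<lambda>i. z (Suc i))"
    using Suc.IH by (intro add_left_mono)
  finally show ?case by (simp add: max_def)
qed simp

lemma psum_max_le_sum_abs: "\<bar>psum_max \<phi> n z\<bar> \<le> (\<Sum>i<Suc n. \<bar>\<phi> (z i)\<bar>)"
proof (induction n arbitrary: z)
  case (Suc n)
  have "\<bar>psum_max \<phi> (Suc n) z\<bar> \<le> \<bar>\<phi> (z 0)\<bar> + \<bar>psum_max \<phi> n (\<lambda>i. z (Suc i))\<bar>" by simp
  also have "\<dots> \<le> \<bar>\<phi> (z 0)\<bar> + (\<Sum>i<Suc n. \<bar>\<phi> (z (Suc i))\<bar>)"
    using Suc.IH by (intro add_left_mono)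
  also have "\<dots> = (\<Sum>i<Suc (Suc n). \<bar>\<phi> (z i)\<bar>)"
    by (rule sum.lessThan_Suc_shift[symmetric])
  finally show ?case .
qed simp

lemma borel_measurable_psum_max [measurable]:
  fixes \<phi> :: "'b :: topological_space \<Rightarrow> real"
  assumes [measurable]: "\<phi> \<in> borel_measurable borel"
  shows "psum_max \<phi> n \<in> borel_measurable (\<Pi>\<^sub>M i\<in>UNIV. borel)"
proof (induction n)
  case 0
  show ?case by simp
next
  case (Suc n)
  have "(\<lambda>z i. z (Suc i)) \<in> (\<Pi>\<^sub>M i\<in>UNIV. borel :: 'b measure) \<rightarrow>\<^sub>M (\<Pi>\<^sub>M i\<in>UNIV. borel)"
    by (rule measurable_PiM_single') (auto simp: space_PiM)
  from measurable_compose[OF this Suc] show ?case by simp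
qed

text \<open>Garsia's argument: on the shift-invariant set where the partial sums are unbounded above, the
  difference of \<open>psum_max \<phi> (n + 1)\<close> and \<open>psum_max \<phi> n \<circ> shift\<close> decreases to \<open>\<phi>\<close>, while its mean is
  nonnegative by stationarity. Ergodicity makes the set null as soon as \<open>\<phi>\<close> has negative mean.\<close>

lemma (in prob_space) AE_psum_bounded_above:
  fixes Z :: "nat \<Rightarrow> 'a \<Rightarrow> 'b :: topological_space" and \<phi> :: "'b \<Rightarrow> real"
  assumes Z: "stationary_seq M Z" "ergodic_seq M Z" and [measurable]: "\<phi> \<in> borel_measurable borel"
    and int: "integrable M (\<lambda>\<omega>. \<phi> (Z 0 \<omega>))" and neg: "(\<integral>\<omega>. \<phi> (Z 0 \<omega>) \<partial>M) < 0"
  shows "AE \<omega> in M. \<exists>B. \<forall>n. (\<Sum>i<n. \<phi> (Z i \<omega>)) \<le> B"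
proof -
  let ?S = "\<Pi>\<^sub>M i\<in>(UNIV :: nat set). (borel :: 'b measure)"
  let ?Z = "\<lambda>\<omega> i. Z i \<omega>"
  have [measurable]: "\<And>i. Z i \<in> borel_measurable M" by (rule stationary_seqD(1)[OF Z(1)])
  have [measurable]: "?Z \<in> M \<rightarrow>\<^sub>M ?S"
    by (rule measurable_PiM_single') (auto simp: space_PiM)
  \<comment> \<open>Thresholds range over the naturals, which makes \<open>A\<close> a countable
    combination of measurable sets.\<close>
  define A where "A = {z. \<forall>B::nat. \<exists>n. psum_max \<phi> n z > real B}"
  have A_sets [measurable]: "A \<in> sets ?S"
  proof -
    have "{z \<in> space ?S. \<forall>B::nat. \<exists>n. psum_max \<phi> n z > real B} \<in> sets ?S" by measurable
    then show ?thesis by (simp add: A_def space_PiM)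
  qed
  \<comment> \<open>Up to truncation at 0, the maximal sums of a sequence and of its shift differ by
    \<open>\<phi> (z 0)\<close>; the ceiling of its absolute value is the margin added to the
    threshold.\<close>
  have inv: "{z. (\<lambda>i. z (Suc i)) \<in> A} = A"
  proof (intro equalityI subsetI)
    fix z assume "z \<in> {z. (\<lambda>i. z (Suc i)) \<in> A}"
    then have *: "\<exists>n. psum_max \<phi> n (\<lambda>i. z (Suc i)) > real B" for B by (simp add: A_def)
    show "z \<in> A" unfolding A_def
    proof (intro CollectI allI)
      fix B :: nat
      from * obtain n where n: "psum_max \<phi> n (\<lambda>i. z (Suc i)) > real (B + nat \<lceil>\<bar>\<phi> (z 0)\<bar>\<rceil>)" by blast
      then have "psum_max \<phi> (Suc n) z > real B" by simp linarith
      then show "\<exists>n. psum_max \<phi> n z > real B" by blast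
    qed
  next
    fix z assume "z \<in> A"
    then have *: "\<exists>n. psum_max \<phi> n z > real B" for B by (simp add: A_def)
    have "(\<lambda>i. z (Suc i)) \<in> A" unfolding A_def
    proof (intro CollectI allI)
      fix B :: nat
      from * obtain n where "psum_max \<phi> n z > real (B + nat \<lceil>\<bar>\<phi> (z 0)\<bar>\<rceil>)" by blast
      then have "psum_max \<phi> (Suc n) z > real (B + nat \<lceil>\<bar>\<phi> (z 0)\<bar>\<rceil>)"
        using psum_max_mono[of \<phi> n z] by linarith
      then have "psum_max \<phi> n (\<lambda>i. z (Suc i)) > real B" by simp linarith
      then show "\<exists>n. psum_max \<phi> n (\<lambda>i. z (Suc i)) > real B" by blast
    qed
    then show "z \<in> {z. (\<lambda>i. z (Suc i)) \<in> A}" by simp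
  qed
  have pA: "prob {\<omega> \<in> space M. ?Z \<omega> \<in> A} \<in> {0, 1}"
    using Z(2) A_sets inv unfolding ergodic_seq_def by blast
  have "prob {\<omega> \<in> space M. ?Z \<omega> \<in> A} \<noteq> 1"
  proof
    assume "prob {\<omega> \<in> space M. ?Z \<omega> \<in> A} = 1"
    then have AE_A: "AE \<omega> in M. ?Z \<omega> \<in> A"
      by (subst (asm) prob_Collect_eq_1) auto
    define d where "d n \<omega> = psum_max \<phi> (Suc n) (?Z \<omega>) - psum_max \<phi> n (\<lambda>i. Z (i + 1) \<omega>)" for n \<omega>
    have d_eq: "d n \<omega> = \<phi> (Z 0 \<omega>) + max 0 (- psum_max \<phi> n (\<lambda>i. Z (i + 1) \<omega>))" for n \<omega>
      by (simp add: d_def max_def)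
    have int_k: "integrable M (\<lambda>\<omega>. \<phi> (Z k \<omega>))" for k
      using int stationary_seq_integral(2)[OF Z(1), of \<phi> k] by simp
    have int_max: "integrable M (\<lambda>\<omega>. psum_max \<phi> n (?Z \<omega>))" for n
    proof (rule Bochner_Integration.integrable_bound[where f = "\<lambda>\<omega>. \<Sum>i<Suc n. \<bar>\<phi> (Z i \<omega>)\<bar>"])
      show "AE \<omega> in M. norm (psum_max \<phi> n (?Z \<omega>)) \<le> norm (\<Sum>i<Suc n. \<bar>\<phi> (Z i \<omega>)\<bar>)"
        using psum_max_le_sum_abs[of \<phi> n] by (intro AE_I2) (auto intro: order_trans)
    qed (use int_k in auto)
    have int_max': "integrable M (\<lambda>\<omega>. psum_max \<phi> n (\<lambda>i. Z (i + 1) \<omega>))" for n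
      using stationary_seq_integral_shift(2)[OF Z(1), of "psum_max \<phi> n" 1] int_max[of n] by simp
    have nonneg: "0 \<le> (\<integral>\<omega>. d n \<omega> \<partial>M)" for n
    proof -
      have "(\<integral>\<omega>. d n \<omega> \<partial>M) = (\<integral>\<omega>. psum_max \<phi> (Suc n) (?Z \<omega>) \<partial>M) - (\<integral>\<omega>. psum_max \<phi> n (\<lambda>i. Z (i + 1) \<omega>) \<partial>M)"
        unfolding d_def by (rule Bochner_Integration.integral_diff[OF int_max int_max'])
      also have "(\<integral>\<omega>. psum_max \<phi> n (\<lambda>i. Z (i + 1) \<omega>) \<partial>M) = (\<integral>\<omega>. psum_max \<phi> n (?Z \<omega>) \<partial>M)"
        by (rule stationary_seq_integral_shift(1)[OF Z(1)]) measurable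
      also have "(\<integral>\<omega>. psum_max \<phi> (Suc n) (?Z \<omega>) \<partial>M) - (\<integral>\<omega>. psum_max \<phi> n (?Z \<omega>) \<partial>M) \<ge> 0"
        using integral_mono[OF int_max[of n] int_max[of "Suc n"] psum_max_mono] by simp
      finally show ?thesis .
    qed
    have "(\<lambda>n. \<integral>\<omega>. d n \<omega> \<partial>M) \<longlonglongrightarrow> (\<integral>\<omega>. \<phi> (Z 0 \<omega>) \<partial>M)"
    proof (rule integral_dominated_convergence[where w = "\<lambda>\<omega>. \<bar>\<phi> (Z 0 \<omega>)\<bar> + \<bar>\<phi> (Z 1 \<omega>)\<bar>"])
      show "integrable M (\<lambda>\<omega>. \<bar>\<phi> (Z 0 \<omega>)\<bar> + \<bar>\<phi> (Z 1 \<omega>)\<bar>)" using int_k by simp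
      show "d n \<in> borel_measurable M" for n
        unfolding d_def using int_max[of "Suc n"] int_max'[of n] by simp
      show "AE \<omega> in M. norm (d n \<omega>) \<le> \<bar>\<phi> (Z 0 \<omega>)\<bar> + \<bar>\<phi> (Z 1 \<omega>)\<bar>" for n
      proof (rule AE_I2)
        fix \<omega>
        \<comment> \<open>The one-term sum bounds the negative part of the maximum by
          \<open>\<bar>\<phi> (Z 1 \<omega>)\<bar>\<close> uniformly in \<open>n\<close>, which
          supplies the dominating function.\<close>
        have "psum_max \<phi> 0 (\<lambda>i. Z (i + 1) \<omega>) \<le> psum_max \<phi> n (\<lambda>i. Z (i + 1) \<omega>)"
          by (rule psum_max_mono') simp
        then show "norm (d n \<omega>) \<le> \<bar>\<phi> (Z 0 \<omega>)\<bar> + \<bar>\<phi> (Z 1 \<omega>)\<bar>"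
          unfolding d_eq by simp
      qed
      show "AE \<omega> in M. (\<lambda>n. d n \<omega>) \<longlonglongrightarrow> \<phi> (Z 0 \<omega>)"
        using AE_A
      proof eventually_elim
        case (elim \<omega>)
        then have "?Z \<omega> \<in> {z. (\<lambda>i. z (Suc i)) \<in> A}" by (subst inv)
        then have "(\<lambda>i. Z (i + 1) \<omega>) \<in> A" by simp
        \<comment> \<open>Once the maximal sum of the shifted sequence is positive it stays so, and
          from then on \<open>d n \<omega>\<close> equals \<open>\<phi> (Z 0 \<omega>)\<close>
          exactly.\<close>
        then obtain m where m: "psum_max \<phi> m (\<lambda>i. Z (i + 1) \<omega>) > real 0" unfolding A_def by blast
        have "d n \<omega> = \<phi> (Z 0 \<omega>)" if "n \<ge> m" for n
          using psum_max_mono'[OF that, of \<phi> "\<lambda>i. Z (i + 1) \<omega>"] m unfolding d_eq by simp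
        then show ?case
          by (intro tendsto_eventually) (auto simp: eventually_sequentially)
      qed
    qed simp
    then have "0 \<le> (\<integral>\<omega>. \<phi> (Z 0 \<omega>) \<partial>M)"
      by (rule LIMSEQ_le_const) (use nonneg in auto)
    with neg show False by simp
  qed
  with pA have "prob {\<omega> \<in> space M. ?Z \<omega> \<in> A} = 0" by auto
  then have "AE \<omega> in M. ?Z \<omega> \<notin> A"
    by (subst (asm) prob_Collect_eq_0) auto
  then show ?thesis
  proof eventually_elim
    case (elim \<omega>)
    then obtain B :: nat where B: "\<And>n. psum_max \<phi> n (?Z \<omega>) \<le> real B"
      unfolding A_def by (auto simp: not_less)
    have "(\<Sum>i<n. \<phi> (Z i \<omega>)) \<le> real B" for n
    proof (cases n)
      case (Suc m)
      then show ?thesis using psum_le_psum_max[where n = m and \<phi> = \<phi> and z = "?Z \<omega>"] B[of m] by simp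
    qed simp
    then show ?case by blast
  qed
qed

text \<open>Subtracting the mean plus \<open>e / 2\<close> leaves a function of mean
  \<open>- e / 2\<close>, whose partial sums are bounded above; the bound disappears after division
  by \<open>n\<close>.\<close>

lemma (in prob_space) AE_eventually_average_le:
  fixes Z :: "nat \<Rightarrow> 'a \<Rightarrow> 'b :: topological_space" and \<phi> :: "'b \<Rightarrow> real"
  assumes Z: "stationary_seq M Z" "ergodic_seq M Z" and [measurable]: "\<phi> \<in> borel_measurable borel"
    and int: "integrable M (\<lambda>\<omega>. \<phi> (Z 0 \<omega>))" and "e > 0"
  shows "AE \<omega> in M. \<forall>\<^sub>F n in sequentially.
    (1 / real n) * (\<Sum>i<n. \<phi> (Z i \<omega>)) < (\<integral>\<omega>. \<phi> (Z 0 \<omega>) \<partial>M) + e"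
proof -
  let ?m = "\<integral>\<omega>. \<phi> (Z 0 \<omega>) \<partial>M"
  have [measurable]: "\<And>i. Z i \<in> borel_measurable M" by (rule stationary_seqD(1)[OF Z(1)])
  have "AE \<omega> in M. \<exists>B. \<forall>n. (\<Sum>i<n. \<phi> (Z i \<omega>) - (?m + e / 2)) \<le> B"
    by (rule AE_psum_bounded_above[OF Z]) (use int \<open>e > 0\<close> in \<open>auto simp: prob_space\<close>)
  then show ?thesis
  proof eventually_elim
    case (elim \<omega>)
    then obtain B where B: "\<And>n. (\<Sum>i<n. \<phi> (Z i \<omega>) - (?m + e / 2)) \<le> B" by blast
    have "\<forall>\<^sub>F n in sequentially. real n > max 0 (2 * B / e)"
      by (rule filterlim_at_top_dense[THEN iffD1, OF filterlim_real_sequentially, rule_format])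
    then show ?case
    proof eventually_elim
      case (elim n)
      then have n: "real n > 0" "B < real n * (e / 2)" using \<open>e > 0\<close> by (auto simp: field_simps)
      have "(\<Sum>i<n. \<phi> (Z i \<omega>)) \<le> B + real n * (?m + e / 2)"
        using B[of n] by (simp add: sum_subtractf)
      also have "\<dots> < real n * (?m + e)" using n by (simp add: algebra_simps)
      finally show ?case using n by (simp add: field_simps)
    qed
  qed
qed

text \<open>\<phi> and its negative give the two one-sided bounds. Tolerances of the form
  \<open>1 / real (Suc k)\<close> leave only countably many exceptional sets.\<close>

theorem (in prob_space) birkhoff_ergodic:
  fixes Z :: "nat \<Rightarrow> 'a \<Rightarrow> 'b :: topological_space" and \<phi> :: "'b \<Rightarrow> real"
  assumes Z: "stationary_seq M Z" "ergodic_seq M Z" and [measurable]: "\<phi> \<in> borel_measurable borel"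
    and int: "integrable M (\<lambda>\<omega>. \<phi> (Z 0 \<omega>))"
  shows "AE \<omega> in M. (\<lambda>n. (1 / real n) * (\<Sum>i<n. \<phi> (Z i \<omega>))) \<longlonglongrightarrow> (\<integral>\<omega>. \<phi> (Z 0 \<omega>) \<partial>M)"
proof -
  let ?m = "\<integral>\<omega>. \<phi> (Z 0 \<omega>) \<partial>M"
  have [measurable]: "\<And>i. Z i \<in> borel_measurable M" by (rule stationary_seqD(1)[OF Z(1)])
  have "AE \<omega> in M. \<forall>k. \<forall>\<^sub>F n in sequentially. (1 / real n) * (\<Sum>i<n. \<phi> (Z i \<omega>)) < ?m + 1 / real (Suc k)"
    by (subst AE_all_countable, intro allI AE_eventually_average_le[OF Z]) (use int in auto)
  moreover have "AE \<omega> in M. \<forall>k. \<forall>\<^sub>F n in sequentially.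
      (1 / real n) * (\<Sum>i<n. - \<phi> (Z i \<omega>)) < (\<integral>\<omega>. - \<phi> (Z 0 \<omega>) \<partial>M) + 1 / real (Suc k)"
    by (subst AE_all_countable, intro allI AE_eventually_average_le[OF Z]) (use int in auto)
  ultimately show ?thesis
  proof eventually_elim
    case (elim \<omega>)
    show ?case
    proof (rule tendstoI)
      fix e :: real assume "e > 0"
      then obtain k where k: "1 / real (Suc k) < e"
        using nat_approx_posE by (metis)
      from elim(1)[rule_format, of k] elim(2)[rule_format, of k]
      show "\<forall>\<^sub>F n in sequentially. dist ((1 / real n) * (\<Sum>i<n. \<phi> (Z i \<omega>))) ?m < e"
      proof eventually_elim
        case (elim n)
        then show ?case using k unfolding dist_real_def abs_less_iff by (simp add: sum_negf)
      qed
    qed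
  qed
qed

section \<open>The regression functional and its truncation\<close>

lemma matrix_inv_mult:
  fixes A :: "real ^ 'n ^ 'n"
  assumes "det A \<noteq> 0"
  shows "A ** matrix_inv A = mat 1" "matrix_inv A ** A = mat 1"
proof -
  have "\<exists>B. A ** B = mat 1 \<and> B ** A = mat 1"
    using assms unfolding invertible_det_nz[symmetric] invertible_def .
  then have "A ** matrix_inv A = mat 1 \<and> matrix_inv A ** A = mat 1"
    unfolding matrix_inv_def by (rule someI_ex)
  then show "A ** matrix_inv A = mat 1" "matrix_inv A ** A = mat 1" by auto
qed

lemma matrix_inv_vector:
  fixes A :: "real ^ 'n ^ 'n"
  assumes "det A \<noteq> 0"
  shows "A *v (matrix_inv A *v b) = b" "matrix_inv A *v (A *v b) = b"
  using matrix_inv_mult[OF assms] by (simp_all add: matrix_vector_mul_assoc)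

lemma matrix_inv_vector_cramer:
  fixes A :: "real ^ 'n ^ 'n"
  assumes "det A \<noteq> 0"
  shows "matrix_inv A *v b = (\<chi> k. det (\<chi> i j. if j = k then b $ i else A $ i $ j) / det A)"
  using cramer[OF assms, of "matrix_inv A *v b" b] matrix_inv_vector(1)[OF assms] by blast

lemma matrix_nth_axis:
  fixes A :: "real ^ 'n ^ 'm"
  shows "A $ i $ j = (A *v axis j 1) $ i"
  by (simp add: matrix_vector_mult_basis column_def)

lemma tendsto_matrixI:
  fixes F :: "'a \<Rightarrow> real ^ 'n ^ 'm"
  shows "(\<And>i j. ((\<lambda>x. F x $ i $ j) \<longlongrightarrow> A $ i $ j) net) \<Longrightarrow> (F \<longlongrightarrow> A) net"
  by (intro vec_tendstoI)

lemma tendsto_det [tendsto_intros]: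
  fixes F :: "'a \<Rightarrow> real ^ 'n ^ 'n"
  assumes "(F \<longlongrightarrow> A) net"
  shows "((\<lambda>x. det (F x)) \<longlongrightarrow> det A) net"
  unfolding det_def by (intro tendsto_intros assms)

lemma tendsto_matrix_mult [tendsto_intros]:
  fixes F :: "'a \<Rightarrow> real ^ 'n ^ 'm" and G :: "'a \<Rightarrow> real ^ 'k ^ 'n"
  assumes "(F \<longlongrightarrow> A) net" "(G \<longlongrightarrow> B) net"
  shows "((\<lambda>x. F x ** G x) \<longlongrightarrow> A ** B) net"
  unfolding matrix_matrix_mult_def by (intro tendsto_intros assms)

lemma tendsto_matrix_vector_mult [tendsto_intros]:
  fixes F :: "'a \<Rightarrow> real ^ 'n ^ 'm" and v :: "'a \<Rightarrow> real ^ 'n"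
  assumes "(F \<longlongrightarrow> A) net" "(v \<longlongrightarrow> w) net"
  shows "((\<lambda>x. F x *v v x) \<longlongrightarrow> A *v w) net"
  unfolding matrix_vector_mult_def by (intro tendsto_intros assms)

lemma tendsto_transpose [tendsto_intros]:
  fixes F :: "'a \<Rightarrow> real ^ 'n ^ 'm"
  assumes "(F \<longlongrightarrow> A) net"
  shows "((\<lambda>x. transpose (F x)) \<longlongrightarrow> transpose A) net"
  unfolding transpose_def by (intro tendsto_intros assms)

text \<open>By Cramer's rule each entry of the inverse is a quotient of determinants, continuous
  where the denominator is nonzero.\<close>

lemma tendsto_matrix_inv:
  fixes F :: "'a \<Rightarrow> real ^ 'n ^ 'n"
  assumes F: "(F \<longlongrightarrow> A) net" and A: "det A \<noteq> 0"
  shows "((\<lambda>x. matrix_inv (F x)) \<longlongrightarrow> matrix_inv A) net"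
proof (rule tendsto_matrixI)
  fix i j :: 'n
  let ?D = "\<lambda>A :: real ^ 'n ^ 'n. det (\<chi> k l. if l = i then axis j 1 $ k else A $ k $ l) / det A"
  have eq: "matrix_inv B $ i $ j = ?D B" if "det B \<noteq> 0" for B :: "real ^ 'n ^ 'n"
    by (simp add: matrix_nth_axis[of "matrix_inv B"] matrix_inv_vector_cramer[OF that])
  have "((\<lambda>x. ?D (F x)) \<longlongrightarrow> ?D A) net"
  proof (intro tendsto_divide tendsto_det tendsto_vec_lambda F A)
    fix k l
    show "((\<lambda>x. if l = i then axis j 1 $ k else F x $ k $ l) \<longlongrightarrow> (if l = i then axis j 1 $ k else A $ k $ l)) net"
      by (cases "l = i") (auto intro!: tendsto_intros F)
  qed
  moreover have "\<forall>\<^sub>F x in net. det (F x) \<noteq> 0"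
    using tendsto_det[OF F] A by (rule tendsto_imp_eventually_ne)
  then have "\<forall>\<^sub>F x in net. ?D (F x) = matrix_inv (F x) $ i $ j"
    by eventually_elim (simp add: eq)
  ultimately show "((\<lambda>x. matrix_inv (F x) $ i $ j) \<longlongrightarrow> matrix_inv A $ i $ j) net"
    unfolding eq[OF A] by (rule Lim_transform_eventually)
qed

lemma borel_measurable_matrix_mult [measurable (raw)]:
  fixes F :: "'a \<Rightarrow> real ^ 'n ^ 'm" and G :: "'a \<Rightarrow> real ^ 'k ^ 'n"
  assumes [measurable]: "F \<in> borel_measurable M" "G \<in> borel_measurable M"
  shows "(\<lambda>x. F x ** G x) \<in> borel_measurable M"
  unfolding matrix_matrix_mult_def by (intro borel_measurable_vec_lambda) measurable

lemma borel_measurable_transpose [measurable (raw)]: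
  fixes F :: "'a \<Rightarrow> real ^ 'n ^ 'm"
  assumes [measurable]: "F \<in> borel_measurable M"
  shows "(\<lambda>x. transpose (F x)) \<in> borel_measurable M"
  unfolding transpose_def by (intro borel_measurable_vec_lambda) measurable

lemma borel_measurable_det [measurable (raw)]:
  fixes F :: "'a \<Rightarrow> real ^ 'n ^ 'n"
  assumes [measurable]: "F \<in> borel_measurable M"
  shows "(\<lambda>x. det (F x)) \<in> borel_measurable M"
  unfolding det_def by measurable

lemma borel_measurable_outer [measurable (raw)]:
  fixes u v :: "'a \<Rightarrow> real ^ 'n"
  assumes [measurable]: "u \<in> borel_measurable M" "v \<in> borel_measurable M"
  shows "(\<lambda>x. outer (u x) (v x)) \<in> borel_measurable M"
  unfolding outer_def by (intro borel_measurable_vec_lambda) measurable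

section \<open>The least-squares functional, its derivative and its truncation\<close>

lemma Sigma_of_simps:
  "Sigma_of (x + y) = Sigma_of x + Sigma_of y" "Sigma_of (x - y) = Sigma_of x - Sigma_of y"
  "Sigma_of (r *\<^sub>R x) = r *\<^sub>R Sigma_of x"
  by (simp_all add: Sigma_of_def vec_eq_iff)

lemma Gamma_of_simps:
  "Gamma_of (x + y) = Gamma_of x + Gamma_of y" "Gamma_of (x - y) = Gamma_of x - Gamma_of y"
  "Gamma_of (r *\<^sub>R x) = r *\<^sub>R Gamma_of x"
  by (simp_all add: Gamma_of_def vec_eq_iff)

lemma tendsto_Sigma_of [tendsto_intros]:
  "(F \<longlongrightarrow> x) net \<Longrightarrow> ((\<lambda>y. Sigma_of (F y)) \<longlongrightarrow> Sigma_of x) net"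
  unfolding Sigma_of_def by (intro tendsto_intros)

lemma tendsto_Gamma_of [tendsto_intros]:
  "(F \<longlongrightarrow> x) net \<Longrightarrow> ((\<lambda>y. Gamma_of (F y)) \<longlongrightarrow> Gamma_of x) net"
  unfolding Gamma_of_def by (intro tendsto_intros)

lemma tendsto_Delta [tendsto_intros]:
  "(F \<longlongrightarrow> x) net \<Longrightarrow> ((\<lambda>y. Delta (F y)) \<longlongrightarrow> Delta x) net"
  unfolding Delta_def by (intro tendsto_intros)

lemma reg_dom_det: "x \<in> reg_dom \<Longrightarrow> det (Sigma_of x) \<noteq> 0"
  by (simp add: reg_dom_def Delta_def)

lemma tendsto_g_reg:
  "(F \<longlongrightarrow> x) net \<Longrightarrow> x \<in> reg_dom \<Longrightarrow> ((\<lambda>y. g_reg (F y)) \<longlongrightarrow> g_reg x) net"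
  unfolding g_reg_def by (intro tendsto_intros tendsto_matrix_inv reg_dom_det)

lemma Sigma_of_g_reg: "x \<in> reg_dom \<Longrightarrow> Sigma_of x *v g_reg x = Gamma_of x"
  unfolding g_reg_def by (rule matrix_inv_vector(1)[OF reg_dom_det])

text \<open>Comes from differentiating the normal equations
  \<open>Sigma_of x *v g_reg x = Gamma_of x\<close> implicitly.\<close>

definition Dg_reg :: "real ^ ('m ltri + 'm) \<Rightarrow> real ^ ('m ltri + 'm) \<Rightarrow> real ^ ('m :: {finite, linorder})" where
  "Dg_reg x h = matrix_inv (Sigma_of x) *v (Gamma_of h - Sigma_of h *v g_reg x)"

lemma linear_Dg_reg: "linear (Dg_reg x)"
  by (rule linearI)
     (simp_all add: Dg_reg_def Sigma_of_simps Gamma_of_simps matrix_vector_mult_add_rdistrib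
       matrix_vector_right_distrib[symmetric] matrix_vector_mult_scaleR[symmetric]
       scaleR_matrix_vector_assoc[symmetric] scaleR_diff_right add_diff_add)

lemma eventually_reg_dom: "x \<in> reg_dom \<Longrightarrow> (F \<longlongrightarrow> x) net \<Longrightarrow> \<forall>\<^sub>F y in net. F y \<in> reg_dom"
  using order_tendstoD(1)[OF tendsto_Delta, of F x net 0] by (simp add: reg_dom_def)

text \<open>Subtracting the normal equations at \<open>x\<close> and \<open>y\<close> gives an exact
  formula for \<open>g_reg y - g_reg x\<close>. The remainder is then bilinear in
  \<open>y - x\<close> and \<open>g_reg y - g_reg x\<close>, so plain continuity of
  \<open>g_reg\<close> makes it o(norm (y - x)).\<close>

lemma g_reg_has_derivative:
  fixes x :: "real ^ ('m ltri + 'm :: {finite, linorder})"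
  assumes x: "x \<in> reg_dom"
  shows "(g_reg has_derivative Dg_reg x) (at x)"
  unfolding has_derivative_iff_norm
proof
  show "bounded_linear (Dg_reg x)"
    by (rule linear_conv_bounded_linear[THEN iffD1, OF linear_Dg_reg])
  let ?h = "\<lambda>d w. matrix_inv (Sigma_of x) *v (Sigma_of d *v w)"
  have "bilinear ?h"
    unfolding bilinear_def
    by (intro conjI allI linearI)
       (simp_all add: Sigma_of_simps matrix_vector_mult_add_rdistrib matrix_vector_right_distrib
         matrix_vector_mult_scaleR scaleR_matrix_vector_assoc[symmetric])
  from bilinear_bounded[OF this] obtain B where B: "\<And>d w. norm (?h d w) \<le> B * norm d * norm w"
    by blast
  have "((\<lambda>y. g_reg y) \<longlongrightarrow> g_reg x) (at x)" by (intro tendsto_g_reg tendsto_ident_at x)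
  then have lim: "((\<lambda>y. B * norm (g_reg y - g_reg x)) \<longlongrightarrow> 0) (at x)"
    by (intro tendsto_eq_intros) (auto simp: LIM_zero_iff)
  show "((\<lambda>y. norm (g_reg y - g_reg x - Dg_reg x (y - x)) / norm (y - x)) \<longlongrightarrow> 0) (at x)"
  proof (rule tendsto_sandwich[OF _ _ tendsto_const lim])
    have "\<forall>\<^sub>F y in at x. y \<in> reg_dom"
      by (rule eventually_reg_dom[OF x tendsto_ident_at])
    then show "\<forall>\<^sub>F y in at x. norm (g_reg y - g_reg x - Dg_reg x (y - x)) / norm (y - x)
        \<le> B * norm (g_reg y - g_reg x)"
    proof eventually_elim
      case (elim y)
      have "g_reg y - g_reg x = matrix_inv (Sigma_of x) *v (Sigma_of x *v (g_reg y - g_reg x))"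
        by (simp add: matrix_inv_vector(2)[OF reg_dom_det[OF x]])
      also have "Sigma_of x *v (g_reg y - g_reg x) = Gamma_of (y - x) - Sigma_of (y - x) *v g_reg y"
        using Sigma_of_g_reg[OF x] Sigma_of_g_reg[OF elim]
        by (simp add: Sigma_of_simps Gamma_of_simps matrix_vector_mult_diff_distrib
          matrix_vector_mult_diff_rdistrib)
      finally have eq: "g_reg y - g_reg x =
          matrix_inv (Sigma_of x) *v (Gamma_of (y - x) - Sigma_of (y - x) *v g_reg y)" .
      have "g_reg y - g_reg x - Dg_reg x (y - x) =
          matrix_inv (Sigma_of x) *v (Gamma_of (y - x) - Sigma_of (y - x) *v g_reg y) - Dg_reg x (y - x)"
        by (simp only: eq)
      also have "\<dots> = - ?h (y - x) (g_reg y - g_reg x)"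
        by (simp add: Dg_reg_def matrix_vector_mult_diff_distrib)
      finally have "norm (g_reg y - g_reg x - Dg_reg x (y - x)) \<le> B * norm (y - x) * norm (g_reg y - g_reg x)"
        using B by simp
      then show ?case
        by (cases "y = x") (simp_all add: divide_le_eq mult_ac)
    qed
  qed auto
qed

lemma jacobian_eqI:
  fixes f :: "real ^ 'n \<Rightarrow> real ^ 'm"
  assumes "(f has_derivative D) (at x)"
  shows "jacobian f (at x) *v h = D h"
proof -
  have "frechet_derivative f (at x) = D" by (rule frechet_derivative_at[OF assms, symmetric])
  then show ?thesis
    unfolding jacobian_def using has_derivative_linear[OF assms] by (simp add: matrix_works)
qed

lemma jacobian_g_reg: "x \<in> reg_dom \<Longrightarrow> jacobian g_reg (at x) *v h = Dg_reg x h"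
  by (rule jacobian_eqI[OF g_reg_has_derivative])

lemma tendsto_jacobian_g_reg:
  assumes F: "(F \<longlongrightarrow> x) net" and x: "x \<in> reg_dom"
  shows "((\<lambda>y. jacobian g_reg (at (F y))) \<longlongrightarrow> jacobian g_reg (at x)) net"
proof (rule tendsto_matrixI)
  fix i j
  have "((\<lambda>y. Dg_reg (F y) (axis j 1) $ i) \<longlongrightarrow> Dg_reg x (axis j 1) $ i) net"
    unfolding Dg_reg_def by (intro tendsto_intros tendsto_matrix_inv tendsto_g_reg reg_dom_det F x)
  moreover have "\<forall>\<^sub>F y in net. Dg_reg (F y) (axis j 1) $ i = jacobian g_reg (at (F y)) $ i $ j"
    using eventually_reg_dom[OF x F]
    by eventually_elim (subst matrix_nth_axis, simp add: jacobian_g_reg)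
  ultimately have "((\<lambda>y. jacobian g_reg (at (F y)) $ i $ j) \<longlongrightarrow> Dg_reg x (axis j 1) $ i) net"
    by (rule Lim_transform_eventually)
  then show "((\<lambda>y. jacobian g_reg (at (F y)) $ i $ j) \<longlongrightarrow> jacobian g_reg (at x) $ i $ j) net"
    by (subst (2) matrix_nth_axis) (simp add: jacobian_g_reg[OF x])
qed

text \<open>When the maximum in the denominator is \<open>Delta x\<close>, the truncated formula is
  Cramer's rule.\<close>

lemma g_trunc_eq_g_reg:
  assumes "c \<le> Delta x" "0 < Delta x"
  shows "g_trunc c x = g_reg x"
proof -
  have d: "det (Sigma_of x) \<noteq> 0" using assms by (simp add: Delta_def)
  show ?thesis
    unfolding g_trunc_def g_reg_def matrix_inv_vector_cramer[OF d] using assms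
    by (simp add: vec_eq_iff cramer_num_def Delta_def)
qed

text \<open>The strict inequalities persist on a neighbourhood, so the truncated and the plain
  functional agree there. Since \<open>c\<close> may be negative, the neighbourhood is cut out by
  \<open>max c 0\<close>.\<close>

lemma g_trunc_has_derivative:
  assumes "c < Delta x" "0 < Delta x"
  shows "(g_trunc c has_derivative Dg_reg x) (at x)"
proof (rule has_derivative_transform_within_open)
  show "(g_reg has_derivative Dg_reg x) (at x)"
    using assms by (intro g_reg_has_derivative) (simp add: reg_dom_def)
  let ?S = "{y :: real ^ ('a ltri + 'a). max c 0 < Delta y}"
  have "continuous_on UNIV (Delta :: real ^ ('a ltri + 'a) \<Rightarrow> real)"
    unfolding continuous_on_def by (intro ballI tendsto_Delta tendsto_ident_at)
  then show "open ?S" by (intro open_Collect_less continuous_intros)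
  show "x \<in> ?S" using assms by simp
  show "g_reg y = g_trunc c y" if "y \<in> ?S" for y
    using that by (intro g_trunc_eq_g_reg[symmetric]) auto
qed

lemma jacobian_g_trunc:
  assumes "c < Delta x" "0 < Delta x"
  shows "g_trunc c differentiable (at x)" "jacobian (g_trunc c) (at x) = jacobian g_reg (at x)"
proof -
  show "g_trunc c differentiable (at x)"
    using g_trunc_has_derivative[OF assms] by (rule differentiableI)
  have "x \<in> reg_dom" using assms by (simp add: reg_dom_def)
  then show "jacobian (g_trunc c) (at x) = jacobian g_reg (at x)"
    by (intro matrix_eq[THEN iffD2] allI)
       (simp add: jacobian_g_reg jacobian_eqI[OF g_trunc_has_derivative[OF assms]])
qed

lemma borel_measurable_g_trunc [measurable (raw)]:
  fixes T :: "'a \<Rightarrow> real ^ ('m ltri + 'm :: {finite, linorder})"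
  assumes [measurable]: "T \<in> borel_measurable M"
  shows "(\<lambda>\<omega>. g_trunc c (T \<omega>)) \<in> borel_measurable M"
proof -
  have [measurable]: "(\<lambda>\<omega>. Sigma_of (T \<omega>)) \<in> borel_measurable M" "(\<lambda>\<omega>. Gamma_of (T \<omega>)) \<in> borel_measurable M"
    unfolding Sigma_of_def Gamma_of_def by (intro borel_measurable_vec_lambda borel_measurable_vec_nth assms)+
  have [measurable]: "(\<lambda>\<omega>. cramer_num (T \<omega>) l) \<in> borel_measurable M" for l
    unfolding cramer_num_def by (intro borel_measurable_det borel_measurable_vec_lambda) measurable
  have "(\<lambda>\<omega>. \<chi> l. cramer_num (T \<omega>) l) \<in> borel_measurable M"
    by (intro borel_measurable_vec_lambda) measurable
  then show ?thesis unfolding g_trunc_def Delta_def by measurable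
qed

section \<open>A conditional central limit theorem\<close>

context prob_space
begin

text \<open>Conditioning on \<open>U\<close> is carried out by Fubini: independence makes the joint
  law of the two sequences a product measure, and for a frozen sequence \<open>u\<close> the inner
  integral factorises over the independent, identically distributed \<open>V i\<close>.\<close>

lemma char_weighted_sum_indep:
  fixes V :: "nat \<Rightarrow> 'a \<Rightarrow> real" and U :: "nat \<Rightarrow> 'a \<Rightarrow> 'b :: topological_space"
  assumes V: "indep_vars (\<lambda>_. borel) V UNIV" and Vd: "\<And>i. distr M borel (V i) = distr M borel (V 0)"
    and U[measurable]: "\<And>i. U i \<in> borel_measurable M"
    and ind: "indep_set
       (sets (vimage_algebra (space M) (\<lambda>\<omega> i. V i \<omega>) (\<Pi>\<^sub>M i\<in>(UNIV :: nat set). borel)))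
       (sets (vimage_algebra (space M) (\<lambda>\<omega> i. U i \<omega>) (\<Pi>\<^sub>M i\<in>(UNIV :: nat set). borel)))"
    and [measurable]: "\<eta> \<in> borel_measurable borel" "a \<in> borel_measurable borel"
  shows "(CLINT \<omega>|M. iexp (\<Sum>i<n. a (U i \<omega>) * \<eta> (V i \<omega>))) =
    (CLINT \<omega>|M. (\<Prod>i<n. char (distr M borel (\<lambda>\<omega>. \<eta> (V 0 \<omega>))) (a (U i \<omega>))))"
proof -
  let ?SV = "\<Pi>\<^sub>M i\<in>(UNIV :: nat set). (borel :: real measure)"
  let ?SU = "\<Pi>\<^sub>M i\<in>(UNIV :: nat set). (borel :: 'b measure)"
  let ?V = "\<lambda>\<omega> i. V i \<omega>" and ?U = "\<lambda>\<omega> i. U i \<omega>"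
  have [measurable]: "V i \<in> borel_measurable M" for i
    using V by (simp add: indep_vars_def)
  have [measurable]: "?V \<in> M \<rightarrow>\<^sub>M ?SV" "?U \<in> M \<rightarrow>\<^sub>M ?SU"
    by (rule measurable_PiM_single', auto simp: space_PiM)+
  interpret PV: prob_space "distr M ?SV ?V" by (rule prob_space_distr) measurable
  interpret PU: prob_space "distr M ?SU ?U" by (rule prob_space_distr) measurable
  interpret P2: pair_prob_space "distr M ?SV ?V" "distr M ?SU ?U" ..
  \<comment> \<open>Agreement on rectangles is the independence of the two generated
    sigma-algebras.\<close>
  have pair: "distr M ?SV ?V \<Otimes>\<^sub>M distr M ?SU ?U = distr M (?SV \<Otimes>\<^sub>M ?SU) (\<lambda>\<omega>. (?V \<omega>, ?U \<omega>))"
  proof (rule pair_measure_eqI)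
    fix A B assume "A \<in> sets (distr M ?SV ?V)" "B \<in> sets (distr M ?SU ?U)"
    then have AB[measurable]: "A \<in> sets ?SV" "B \<in> sets ?SU" by simp_all
    have "prob ((?V -` A \<inter> space M) \<inter> (?U -` B \<inter> space M)) =
        prob (?V -` A \<inter> space M) * prob (?U -` B \<inter> space M)"
      by (rule indep_setD[OF ind]; unfold sets_vimage_algebra; rule sigma_sets.Basic) (use AB in blast)+
    moreover have "(?V -` A \<inter> space M) \<inter> (?U -` B \<inter> space M) = (\<lambda>\<omega>. (?V \<omega>, ?U \<omega>)) -` (A \<times> B) \<inter> space M"
      by auto
    ultimately show "emeasure (distr M ?SV ?V) A * emeasure (distr M ?SU ?U) B =
        emeasure (distr M (?SV \<Otimes>\<^sub>M ?SU) (\<lambda>\<omega>. (?V \<omega>, ?U \<omega>))) (A \<times> B)"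
      by (simp add: emeasure_distr emeasure_eq_measure ennreal_mult'')
  qed (auto intro: PV.sigma_finite_measure_axioms PU.sigma_finite_measure_axioms)
  let ?F = "\<lambda>v u. iexp (\<Sum>i<n. a (u i) * \<eta> (v i))"
  have [measurable]: "(\<lambda>(v, u). ?F v u) \<in> borel_measurable (?SV \<Otimes>\<^sub>M ?SU)"
    by measurable
  have "(CLINT \<omega>|M. iexp (\<Sum>i<n. a (U i \<omega>) * \<eta> (V i \<omega>))) =
      (CLINT x|distr M (?SV \<Otimes>\<^sub>M ?SU) (\<lambda>\<omega>. (?V \<omega>, ?U \<omega>)). (\<lambda>(v, u). ?F v u) x)"
    by (subst integral_distr) auto
  also have "\<dots> = (CLINT x|distr M ?SV ?V \<Otimes>\<^sub>M distr M ?SU ?U. (\<lambda>(v, u). ?F v u) x)"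
    unfolding pair ..
  also have "\<dots> = (CLINT u|distr M ?SU ?U. CLINT v|distr M ?SV ?V. ?F v u)"
    by (rule P2.integral_snd[symmetric], rule P2.P.integrable_const_bound[where B = 1])
       (auto simp: split_beta')
  also have "\<dots> = (CLINT u|distr M ?SU ?U. (\<Prod>i<n. char (distr M borel (\<lambda>\<omega>. \<eta> (V 0 \<omega>))) (a (u i))))"
  proof (rule Bochner_Integration.integral_cong[OF refl])
    fix u :: "nat \<Rightarrow> 'b"
    have "(CLINT v|distr M ?SV ?V. ?F v u) = (CLINT \<omega>|M. ?F (?V \<omega>) u)"
      by (subst integral_distr) auto
    also have "\<dots> = (CLINT \<omega>|M. (\<Prod>i<n. iexp (a (u i) * \<eta> (V i \<omega>))))"
      by (simp add: sum_distrib_left exp_sum)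
    also have "\<dots> = (\<Prod>i<n. CLINT \<omega>|M. iexp (a (u i) * \<eta> (V i \<omega>)))"
    proof (rule indep_vars_lebesgue_integral)
      have "indep_vars (\<lambda>_. borel) V {..<n}" by (rule indep_vars_subset[OF V]) auto
      then show "indep_vars (\<lambda>_. borel) (\<lambda>i \<omega>. iexp (a (u i) * \<eta> (V i \<omega>))) {..<n}"
        by (rule indep_vars_compose2) measurable
    qed (auto intro!: integrable_const_bound[where B = 1])
    also have "\<dots> = (\<Prod>i<n. char (distr M borel (\<lambda>\<omega>. \<eta> (V 0 \<omega>))) (a (u i)))"
    proof (rule prod.cong[OF refl])
      fix i
      have "(CLINT \<omega>|M. iexp (a (u i) * \<eta> (V i \<omega>))) = (CLINT x|distr M borel (V i). iexp (a (u i) * \<eta> x))"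
        by (subst integral_distr) auto
      also have "\<dots> = char (distr M borel (\<lambda>\<omega>. \<eta> (V 0 \<omega>))) (a (u i))"
        unfolding Vd[of i] char_def by (subst (1 2) integral_distr) auto
      finally show "(CLINT \<omega>|M. iexp (a (u i) * \<eta> (V i \<omega>))) = char (distr M borel (\<lambda>\<omega>. \<eta> (V 0 \<omega>))) (a (u i))" .
    qed
    finally show "(CLINT v|distr M ?SV ?V. ?F v u) = (\<Prod>i<n. char (distr M borel (\<lambda>\<omega>. \<eta> (V 0 \<omega>))) (a (u i)))" .
  qed
  also have "\<dots> = (CLINT \<omega>|M. (\<Prod>i<n. char (distr M borel (\<lambda>\<omega>. \<eta> (V 0 \<omega>))) (a (U i \<omega>))))"
  proof (subst integral_distr)
    interpret R: real_distribution "distr M borel (\<lambda>\<omega>. \<eta> (V 0 \<omega>))" by (rule real_distribution_distr) measurable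
    show "(\<lambda>u. \<Prod>i<n. char (distr M borel (\<lambda>\<omega>. \<eta> (V 0 \<omega>))) (a (u i))) \<in> borel_measurable ?SU"
      by measurable
  qed auto
  finally show ?thesis .
qed

end

text \<open>Quadratic for small and linear for large arguments, the same truncated shape as the
  Lindeberg error in the next lemma.\<close>

lemma exp_minus_approx:
  fixes x :: real
  assumes "0 \<le> x"
  shows "\<bar>exp (- x) - (1 - x)\<bar> \<le> x * min 1 x"
proof -
  have 1: "1 - x \<le> exp (- x)" using exp_ge_add_one_self[of "- x"] by simp
  have 2: "exp (- x) \<le> 1" using assms by simp
  have "exp (- x) * (1 + x) \<le> exp (- x) * exp x"
    by (intro mult_left_mono exp_ge_add_one_self) auto
  then have "exp (- x) * (1 + x) \<le> 1" by (simp add: exp_minus)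
  also have "1 \<le> (1 - x + x\<^sup>2) * (1 + x)"
    using assms by (simp add: algebra_simps power2_eq_square)
  finally have 3: "exp (- x) \<le> 1 - x + x\<^sup>2" using assms by (simp add: mult_le_cancel_right)
  show ?thesis
    using 1 2 3 assms by (cases "x \<le> 1") (auto simp: min_def power2_eq_square)
qed

context prob_space
begin

text \<open>Both functions are compared with the polynomial \<open>1 - s\<^sup>2 * v / 2\<close>.
  The factor \<open>min 1 (C * \<bar>s\<bar>)\<close> is small near 0 yet keeps the bound of order
  \<open>s\<^sup>2\<close> for large \<open>s\<close>, so a square integrable random weight can
  later be inserted for \<open>s\<close>.\<close>

lemma char_approx_gaussian:
  fixes \<eta> :: "'a \<Rightarrow> real"
  assumes [measurable]: "\<eta> \<in> borel_measurable M" and C: "\<And>\<omega>. \<bar>\<eta> \<omega>\<bar> \<le> C"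
    and mean: "expectation \<eta> = 0" and v: "expectation (\<lambda>\<omega>. (\<eta> \<omega>)\<^sup>2) = v"
  shows "cmod (char (distr M borel \<eta>) s - exp (- (s\<^sup>2 * v / 2))) \<le> 2 * (s\<^sup>2 * v * min 1 (C * \<bar>s\<bar>))"
proof -
  have C0: "0 \<le> C" using C[of undefined] by linarith
  have sq: "(\<eta> \<omega>)\<^sup>2 \<le> C\<^sup>2" for \<omega>
    using power_mono[OF C[of \<omega>], of 2] by simp
  have int: "integrable M \<eta>" "integrable M (\<lambda>\<omega>. (\<eta> \<omega>)\<^sup>2)"
    using C sq by (auto intro: integrable_const_bound[where B = C] integrable_const_bound[where B = "C\<^sup>2"])
  have v0: "0 \<le> v" unfolding v[symmetric] by simp
  have vC: "v \<le> C\<^sup>2"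
    unfolding v[symmetric] using integral_mono[OF int(2), of "\<lambda>_. C\<^sup>2"] sq by (simp add: prob_space)
  let ?m = "min 1 (C * \<bar>s\<bar>)"
  have m0: "0 \<le> ?m" using C0 by simp
  have "cmod (char (distr M borel \<eta>) s - (1 - s\<^sup>2 * v / 2)) \<le>
      s\<^sup>2 / 6 * expectation (\<lambda>\<omega>. min (6 * (\<eta> \<omega>)\<^sup>2) (\<bar>s\<bar> * \<bar>\<eta> \<omega>\<bar> ^ 3))"
    by (rule char_approx3') (use int mean v in auto)
  also have "\<dots> \<le> s\<^sup>2 / 6 * expectation (\<lambda>\<omega>. (6 * ?m) * (\<eta> \<omega>)\<^sup>2)"
  proof (intro mult_left_mono integral_mono_AE' AE_I2)
    fix \<omega>
    have "\<bar>s\<bar> * \<bar>\<eta> \<omega>\<bar> ^ 3 = (\<bar>s\<bar> * \<bar>\<eta> \<omega>\<bar>) * (\<eta> \<omega>)\<^sup>2"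
      by (simp add: power3_eq_cube power2_eq_square)
    also have "\<dots> \<le> (C * \<bar>s\<bar>) * (\<eta> \<omega>)\<^sup>2"
      using mult_right_mono[OF C[of \<omega>], of "\<bar>s\<bar>"] by (intro mult_right_mono) (auto simp: mult.commute)
    also have "\<dots> \<le> (6 * (C * \<bar>s\<bar>)) * (\<eta> \<omega>)\<^sup>2"
      using C0 by (intro mult_right_mono) auto
    finally show "min (6 * (\<eta> \<omega>)\<^sup>2) (\<bar>s\<bar> * \<bar>\<eta> \<omega>\<bar> ^ 3) \<le> (6 * ?m) * (\<eta> \<omega>)\<^sup>2"
      by (auto simp: min_def)
  qed (use int m0 in auto)
  also have "\<dots> = s\<^sup>2 * v * ?m" using v by simp
  finally have 1: "cmod (char (distr M borel \<eta>) s - (1 - s\<^sup>2 * v / 2)) \<le> s\<^sup>2 * v * ?m" .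
  have x0: "0 \<le> s\<^sup>2 * v / 2" using v0 by simp
  \<comment> \<open>The variance is at most \<open>C\<^sup>2\<close>, and a number in the unit
    interval is at least its own square.\<close>
  have "min 1 (s\<^sup>2 * v / 2) \<le> ?m"
  proof (cases "C * \<bar>s\<bar> \<le> 1")
    case True
    have "s\<^sup>2 * v / 2 \<le> s\<^sup>2 * C\<^sup>2" using mult_left_mono[OF vC, of "s\<^sup>2"] x0 by simp
    also have "\<dots> = (C * \<bar>s\<bar>) * (C * \<bar>s\<bar>)" by (simp add: power2_eq_square)
    also have "\<dots> \<le> (C * \<bar>s\<bar>) * 1" using True C0 by (intro mult_left_mono) auto
    finally show ?thesis using True by simp
  qed simp
  then have "s\<^sup>2 * v / 2 * min 1 (s\<^sup>2 * v / 2) \<le> s\<^sup>2 * v / 2 * ?m"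
    using x0 by (intro mult_left_mono) auto
  also have "\<dots> \<le> s\<^sup>2 * v * ?m" using x0 m0 by (intro mult_right_mono) linarith+
  finally have 2: "\<bar>exp (- (s\<^sup>2 * v / 2)) - (1 - s\<^sup>2 * v / 2)\<bar> \<le> s\<^sup>2 * v * ?m"
    using exp_minus_approx[OF x0] by linarith
  have "cmod (char (distr M borel \<eta>) s - exp (- (s\<^sup>2 * v / 2))) =
      cmod ((char (distr M borel \<eta>) s - (1 - s\<^sup>2 * v / 2)) - complex_of_real (exp (- (s\<^sup>2 * v / 2)) - (1 - s\<^sup>2 * v / 2)))"
    by simp
  also have "\<dots> \<le> cmod (char (distr M borel \<eta>) s - (1 - s\<^sup>2 * v / 2)) + \<bar>exp (- (s\<^sup>2 * v / 2)) - (1 - s\<^sup>2 * v / 2)\<bar>"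
    by (rule order_trans[OF norm_triangle_ineq4]) (simp only: norm_of_real order_refl)
  also have "\<dots> \<le> s\<^sup>2 * v * ?m + s\<^sup>2 * v * ?m" using 1 2 by (rule add_mono)
  finally show ?thesis by (simp only: mult_2)
qed

text \<open>Conditionally on the weights \<open>a (U i)\<close> the sum has independent summands; Birkhoff's theorem makes
  the conditional variance converge, and stationarity reduces the Lindeberg error to a single expectation.\<close>

lemma char_tendsto_weighted_sum:
  fixes V :: "nat \<Rightarrow> 'a \<Rightarrow> real" and U :: "nat \<Rightarrow> 'a \<Rightarrow> 'b :: topological_space"
    and Z :: "nat \<Rightarrow> 'a \<Rightarrow> 'c :: topological_space" and \<eta> :: "nat \<Rightarrow> real \<Rightarrow> real"
  assumes V: "indep_vars (\<lambda>_. borel) V UNIV" and Vd: "\<And>i. distr M borel (V i) = distr M borel (V 0)"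
    and ind: "indep_set
       (sets (vimage_algebra (space M) (\<lambda>\<omega> i. V i \<omega>) (\<Pi>\<^sub>M i\<in>(UNIV :: nat set). borel)))
       (sets (vimage_algebra (space M) (\<lambda>\<omega> i. U i \<omega>) (\<Pi>\<^sub>M i\<in>(UNIV :: nat set). borel)))"
    and Z: "stationary_seq M Z" "ergodic_seq M Z"
    and U: "\<And>i \<omega>. U i \<omega> = u (Z i \<omega>)" and u[measurable]: "u \<in> borel_measurable borel"
    and a[measurable]: "a \<in> borel_measurable borel"
    and int: "integrable M (\<lambda>\<omega>. (a (U 0 \<omega>))\<^sup>2)"
    and \<eta>[measurable]: "\<And>n. \<eta> n \<in> borel_measurable borel" and C: "\<And>n x. \<bar>\<eta> n x\<bar> \<le> C"
    and mean: "\<And>n. expectation (\<lambda>\<omega>. \<eta> n (V 0 \<omega>)) = 0"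
    and \<theta>: "\<theta> \<longlonglongrightarrow> 0"
    and var: "(\<lambda>n. real n * (\<theta> n)\<^sup>2 * expectation (\<lambda>\<omega>. (\<eta> n (V 0 \<omega>))\<^sup>2)) \<longlonglongrightarrow> \<sigma>"
  shows "(\<lambda>n. CLINT \<omega>|M. iexp (\<Sum>i<n. \<theta> n * a (U i \<omega>) * \<eta> n (V i \<omega>)))
    \<longlonglongrightarrow> exp (- (\<sigma> * expectation (\<lambda>\<omega>. (a (U 0 \<omega>))\<^sup>2) / 2))"
proof -
  note [measurable] = stationary_seqD(1)[OF Z(1)]
  have [measurable]: "U i \<in> borel_measurable M" for i unfolding U by measurable
  have [measurable]: "V i \<in> borel_measurable M" for i
    using V by (simp add: indep_vars_def)
  define v where "v n = expectation (\<lambda>\<omega>. (\<eta> n (V 0 \<omega>))\<^sup>2)" for n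
  define \<psi> where "\<psi> n = char (distr M borel (\<lambda>\<omega>. \<eta> n (V 0 \<omega>)))" for n
  interpret R: real_distribution "distr M borel (\<lambda>\<omega>. \<eta> n (V 0 \<omega>))" for n
    by (rule real_distribution_distr) measurable
  have [measurable]: "\<psi> n \<in> borel_measurable borel" for n
    unfolding \<psi>_def by measurable
  have v0: "0 \<le> v n" for n by (simp add: v_def)
  have C0: "0 \<le> C" using C[of 0 0] by linarith
  let ?w = "\<lambda>i \<omega>. a (U i \<omega>)"
  let ?E = "expectation (\<lambda>\<omega>. (a (U 0 \<omega>))\<^sup>2)"
  have int_shift: "integrable M (\<lambda>\<omega>. \<phi> (?w i \<omega>)) \<longleftrightarrow> integrable M (\<lambda>\<omega>. \<phi> (?w 0 \<omega>))"
    "expectation (\<lambda>\<omega>. \<phi> (?w i \<omega>)) = expectation (\<lambda>\<omega>. \<phi> (?w 0 \<omega>))"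
    if [measurable]: "\<phi> \<in> borel_measurable borel" for \<phi> :: "real \<Rightarrow> real" and i
    using stationary_seq_integral[OF Z(1), of "\<lambda>z. \<phi> (a (u z))" i] unfolding U by simp_all
  \<comment> \<open>The Lindeberg remainder of one weight: dominated by \<open>x\<^sup>2\<close> and
    tending to 0 pointwise because \<open>\<theta>\<close> does, so its expectation vanishes under a
    second moment alone.\<close>
  define r where "r n x = x\<^sup>2 * min 1 (C * \<bar>\<theta> n\<bar> * \<bar>x\<bar>)" for n x
  have [measurable]: "r n \<in> borel_measurable borel" for n unfolding r_def by measurable
  have r0: "0 \<le> r n x" and rle: "r n x \<le> x\<^sup>2" for n x
    using C0 by (auto simp: r_def intro!: mult_nonneg_nonneg mult_left_le)
  have int_r: "integrable M (\<lambda>\<omega>. r n (?w i \<omega>))" for n i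
    unfolding int_shift(1)[of "r n" i, simplified]
    by (rule Bochner_Integration.integrable_bound[OF int]) (use r0 rle in auto)
  have "(\<lambda>n. expectation (\<lambda>\<omega>. r n (?w 0 \<omega>))) \<longlonglongrightarrow> expectation (\<lambda>\<omega>. 0)"
  proof (rule integral_dominated_convergence[where w = "\<lambda>\<omega>. (?w 0 \<omega>)\<^sup>2"])
    show "AE \<omega> in M. (\<lambda>n. r n (?w 0 \<omega>)) \<longlonglongrightarrow> 0"
      unfolding r_def by (intro AE_I2) (auto intro!: tendsto_eq_intros \<theta>)
  qed (use r0 rle int in auto)
  then have r_lim: "(\<lambda>n. expectation (\<lambda>\<omega>. r n (?w 0 \<omega>))) \<longlonglongrightarrow> 0" by simp
  let ?P = "\<lambda>n \<omega>. \<Prod>i<n. \<psi> n (\<theta> n * ?w i \<omega>)"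
  \<comment> \<open>The Gaussian product is written through the empirical mean of the squared
    weights, the quantity to which Birkhoff's theorem applies.\<close>
  let ?G = "\<lambda>n \<omega>. exp (- (real n * (\<theta> n)\<^sup>2 * v n * ((1 / real n) * (\<Sum>i<n. (?w i \<omega>)\<^sup>2)) / 2))"
  have \<psi>1: "cmod (\<psi> n s) \<le> 1" for n s
    unfolding \<psi>_def by (rule R.cmod_char_le_1)
  have P1: "cmod (?P n \<omega>) \<le> 1" for n \<omega>
    by (simp add: prod_norm[symmetric] prod_le_1 \<psi>1)
  have G1: "\<bar>?G n \<omega>\<bar> \<le> 1" for n \<omega>
    using v0[of n] by (simp add: sum_nonneg)
  have int_P: "integrable M (?P n)" for n
    by (rule integrable_const_bound[where B = 1]) (use P1 in auto)
  have int_G: "integrable M (?G n)" for n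
    by (rule integrable_const_bound[where B = 1]) (use G1 in auto)
  have PG: "cmod (?P n \<omega> - ?G n \<omega>) \<le> (\<Sum>i<n. 2 * (\<theta> n)\<^sup>2 * v n * r n (?w i \<omega>))" for n \<omega>
  proof -
    have "complex_of_real (?G n \<omega>) = (\<Prod>i<n. complex_of_real (exp (- ((\<theta> n * ?w i \<omega>)\<^sup>2 * v n / 2))))"
    \<comment> \<open>Cancelling \<open>real n\<close> against \<open>1 / real n\<close> requires a
      nonzero \<open>n\<close>; for \<open>n = 0\<close> both sides are 1.\<close>
    proof (cases "n = 0")
      case False
      have "real n * (\<theta> n)\<^sup>2 * v n * ((1 / real n) * (\<Sum>i<n. (?w i \<omega>)\<^sup>2)) / 2 =
          (\<theta> n)\<^sup>2 * v n / 2 * (\<Sum>i<n. (?w i \<omega>)\<^sup>2)"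
        using False by simp
      also have "\<dots> = (\<Sum>i<n. (\<theta> n * ?w i \<omega>)\<^sup>2 * v n / 2)"
        by (simp add: sum_distrib_left power_mult_distrib mult_ac)
      finally have "?G n \<omega> = (\<Prod>i<n. exp (- ((\<theta> n * ?w i \<omega>)\<^sup>2 * v n / 2)))"
        by (simp only: sum_negf[symmetric] exp_sum finite_lessThan)
      then show ?thesis by simp
    qed simp
    \<comment> \<open>Telescoping: a product of factors in the closed unit disc changes by at most
      the sum of the changes of its factors.\<close>
    then have "cmod (?P n \<omega> - ?G n \<omega>) \<le>
        (\<Sum>i<n. cmod (\<psi> n (\<theta> n * ?w i \<omega>) - exp (- ((\<theta> n * ?w i \<omega>)\<^sup>2 * v n / 2))))"
      by (simp only:) (rule norm_prod_diff, use \<psi>1 v0 in auto)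
    also have "\<dots> \<le> (\<Sum>i<n. 2 * (\<theta> n)\<^sup>2 * v n * r n (?w i \<omega>))"
    proof (rule sum_mono)
      fix i
      have "cmod (\<psi> n (\<theta> n * ?w i \<omega>) - exp (- ((\<theta> n * ?w i \<omega>)\<^sup>2 * v n / 2))) \<le>
          2 * ((\<theta> n * ?w i \<omega>)\<^sup>2 * v n * min 1 (C * \<bar>\<theta> n * ?w i \<omega>\<bar>))"
        unfolding \<psi>_def by (rule char_approx_gaussian) (use C mean in \<open>auto simp: v_def\<close>)
      also have "\<dots> = 2 * (\<theta> n)\<^sup>2 * v n * r n (?w i \<omega>)"
        by (simp add: r_def power_mult_distrib abs_mult mult_ac)
      finally show "cmod (\<psi> n (\<theta> n * ?w i \<omega>) - exp (- ((\<theta> n * ?w i \<omega>)\<^sup>2 * v n / 2))) \<le>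
          2 * (\<theta> n)\<^sup>2 * v n * r n (?w i \<omega>)" .
    qed
    finally show ?thesis .
  qed
  have diff: "(\<lambda>n. (CLINT \<omega>|M. ?P n \<omega>) - (CLINT \<omega>|M. complex_of_real (?G n \<omega>))) \<longlonglongrightarrow> 0"
  proof (rule Lim_null_comparison)
    have "(\<lambda>n. 2 * (real n * (\<theta> n)\<^sup>2 * v n) * expectation (\<lambda>\<omega>. r n (?w 0 \<omega>))) \<longlonglongrightarrow> 2 * \<sigma> * 0"
      using var unfolding v_def[symmetric] by (intro tendsto_intros r_lim)
    then show "(\<lambda>n. 2 * (real n * (\<theta> n)\<^sup>2 * v n) * expectation (\<lambda>\<omega>. r n (?w 0 \<omega>))) \<longlonglongrightarrow> 0" by simp
    show "\<forall>\<^sub>F n in sequentially. norm ((CLINT \<omega>|M. ?P n \<omega>) - (CLINT \<omega>|M. complex_of_real (?G n \<omega>)))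
        \<le> 2 * (real n * (\<theta> n)\<^sup>2 * v n) * expectation (\<lambda>\<omega>. r n (?w 0 \<omega>))"
    proof (rule always_eventually, rule allI)
      fix n
      have "norm ((CLINT \<omega>|M. ?P n \<omega>) - (CLINT \<omega>|M. complex_of_real (?G n \<omega>)))
          = norm (CLINT \<omega>|M. ?P n \<omega> - complex_of_real (?G n \<omega>))"
        by (subst Bochner_Integration.integral_diff) (use int_P int_G in auto)
      also have "\<dots> \<le> expectation (\<lambda>\<omega>. cmod (?P n \<omega> - complex_of_real (?G n \<omega>)))"
        by (rule integral_norm_bound)
      also have "\<dots> \<le> expectation (\<lambda>\<omega>. \<Sum>i<n. 2 * (\<theta> n)\<^sup>2 * v n * r n (?w i \<omega>))"
        by (intro integral_mono PG integrable_norm Bochner_Integration.integrable_diff int_P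
          integrable_of_real int_G Bochner_Integration.integrable_sum integrable_mult_right int_r)
      also have "\<dots> = (\<Sum>i<n. 2 * (\<theta> n)\<^sup>2 * v n * expectation (\<lambda>\<omega>. r n (?w i \<omega>)))"
        using int_r by (subst Bochner_Integration.integral_sum) auto
      also have "\<dots> = 2 * (real n * (\<theta> n)\<^sup>2 * v n) * expectation (\<lambda>\<omega>. r n (?w 0 \<omega>))"
        by (subst int_shift(2)) auto
      finally show "norm ((CLINT \<omega>|M. ?P n \<omega>) - (CLINT \<omega>|M. complex_of_real (?G n \<omega>)))
        \<le> 2 * (real n * (\<theta> n)\<^sup>2 * v n) * expectation (\<lambda>\<omega>. r n (?w 0 \<omega>))" .
    qed
  qed
  have "(\<lambda>n. expectation (?G n)) \<longlonglongrightarrow> expectation (\<lambda>\<omega>. exp (- (\<sigma> * ?E / 2)))"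
  proof (rule integral_dominated_convergence[where w = "\<lambda>_. 1"])
    have "AE \<omega> in M. (\<lambda>n. (1 / real n) * (\<Sum>i<n. (a (u (Z i \<omega>)))\<^sup>2)) \<longlonglongrightarrow> (\<integral>\<omega>. (a (u (Z 0 \<omega>)))\<^sup>2 \<partial>M)"
      by (rule birkhoff_ergodic[OF Z]) (use int in \<open>auto simp: U\<close>)
    then show "AE \<omega> in M. (\<lambda>n. ?G n \<omega>) \<longlonglongrightarrow> exp (- (\<sigma> * ?E / 2))"
    proof eventually_elim
      case (elim \<omega>)
      then show ?case
        using var unfolding v_def[symmetric] U[symmetric] by (intro tendsto_intros) auto
    qed
  qed (use G1 in auto)
  then have "(\<lambda>n. CLINT \<omega>|M. complex_of_real (?G n \<omega>)) \<longlonglongrightarrow> exp (- (\<sigma> * ?E / 2))"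
    unfolding integral_complex_of_real by (intro tendsto_of_real) (simp add: prob_space)
  from tendsto_add[OF diff this]
  have "(\<lambda>n. CLINT \<omega>|M. ?P n \<omega>) \<longlonglongrightarrow> exp (- (\<sigma> * ?E / 2))" by simp
  moreover have "(CLINT \<omega>|M. iexp (\<Sum>i<n. \<theta> n * a (U i \<omega>) * \<eta> n (V i \<omega>))) = (CLINT \<omega>|M. ?P n \<omega>)" for n
    unfolding \<psi>_def
    using char_weighted_sum_indep[OF V Vd _ ind \<eta>[of n], where a = "\<lambda>x. \<theta> n * a x" and n = n] by simp
  ultimately show ?thesis by simp
qed

end

section \<open>Limit laws and quantiles\<close>

lemma (in prob_space) cdf_tendsto_of_char:
  fixes Q :: "nat \<Rightarrow> 'a \<Rightarrow> real"
  assumes Q[measurable]: "\<And>n. Q n \<in> borel_measurable M" and \<nu>: "real_distribution \<nu>"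
    and lim: "\<And>t. (\<lambda>n. CLINT \<omega>|M. iexp (t * Q n \<omega>)) \<longlonglongrightarrow> char \<nu> t"
    and "measure \<nu> {x} = 0"
  shows "(\<lambda>n. prob {\<omega> \<in> space M. Q n \<omega> \<le> x}) \<longlonglongrightarrow> cdf \<nu> x"
proof -
  interpret N: real_distribution \<nu> by fact
  have "weak_conv_m (\<lambda>n. distr M borel (Q n)) \<nu>"
  proof (rule levy_continuity)
    show "(\<lambda>n. char (distr M borel (Q n)) t) \<longlonglongrightarrow> char \<nu> t" for t
      using lim[of t] unfolding char_def by (simp add: integral_distr)
  qed (auto intro: \<nu>)
  moreover have "isCont (cdf \<nu>) x" using assms by (simp add: N.isCont_cdf)
  ultimately have "(\<lambda>n. cdf (distr M borel (Q n)) x) \<longlonglongrightarrow> cdf \<nu> x"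
    unfolding weak_conv_m_def weak_conv_def by blast
  moreover have "cdf (distr M borel (Q n)) x = prob {\<omega> \<in> space M. Q n \<omega> \<le> x}" for n
    by (simp add: cdf_def measure_distr vimage_def Int_def conj_commute)
  ultimately show ?thesis by simp
qed

text \<open>Cosine and sine of \<open>t * q\<close> are bounded continuous test functions, so the
  characteristic functions of \<open>q (Z n)\<close> converge. Slutsky's theorem passes from
  \<open>q (Z n)\<close> to \<open>Q n\<close>, and the null level set makes the limiting
  distribution function continuous at \<open>x\<close>.\<close>

lemma (in prob_space) portmanteau_sublevel:
  fixes Z :: "nat \<Rightarrow> 'a \<Rightarrow> real ^ 'n" and Q :: "nat \<Rightarrow> 'a \<Rightarrow> real"
  assumes conv: "conv_in_distr M Z \<nu>"
    and Z[measurable]: "\<And>n. Z n \<in> borel_measurable M" and Q[measurable]: "\<And>n. Q n \<in> borel_measurable M"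
    and \<nu>: "prob_space \<nu>" "sets \<nu> = sets borel"
    and q: "continuous_on UNIV q"
    and diff: "((\<lambda>x. Q (fst x) (snd x) - q (Z (fst x) (snd x))) \<longlongrightarrow> 0) (in_prob M)"
    and null: "measure \<nu> {y. q y = x} = 0"
  shows "(\<lambda>n. prob {\<omega> \<in> space M. Q n \<omega> \<le> x}) \<longlonglongrightarrow> measure \<nu> {y. q y \<le> x}"
proof -
  interpret N: prob_space \<nu> by fact
  note \<nu>(2)[measurable_cong]
  have sp: "space \<nu> = UNIV" using sets_eq_imp_space_eq[OF \<nu>(2)] by simp
  have [measurable]: "q \<in> borel_measurable borel" using q by (rule borel_measurable_continuous_onI)
  have "(\<lambda>n. CLINT \<omega>|M. iexp (t * q (Z n \<omega>))) \<longlonglongrightarrow> (CLINT y|\<nu>. iexp (t * q y))" for t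
  proof -
    have eq: "iexp (t * q y) = complex_of_real (cos (t * q y)) + \<i> * complex_of_real (sin (t * q y))" for y
      by (simp only: exp_Euler cos_of_real sin_of_real)
    have b: "bounded (range (\<lambda>y. cos (t * q y)))" "bounded (range (\<lambda>y. sin (t * q y)))"
      by (auto simp: bounded_iff intro!: exI[of _ 1])
    have c: "continuous_on UNIV (\<lambda>y. cos (t * q y))" "continuous_on UNIV (\<lambda>y. sin (t * q y))"
      by (auto intro!: continuous_intros q)
    have "(\<lambda>n. complex_of_real (\<integral>\<omega>. cos (t * q (Z n \<omega>)) \<partial>M) + \<i> * complex_of_real (\<integral>\<omega>. sin (t * q (Z n \<omega>)) \<partial>M)) \<longlonglongrightarrow>
        complex_of_real (\<integral>y. cos (t * q y) \<partial>\<nu>) + \<i> * complex_of_real (\<integral>y. sin (t * q y) \<partial>\<nu>)"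
      using conv b c unfolding conv_in_distr_def by (intro tendsto_intros) blast+
    moreover have "complex_of_real (\<integral>\<omega>. cos (t * q (Z n \<omega>)) \<partial>M) + \<i> * complex_of_real (\<integral>\<omega>. sin (t * q (Z n \<omega>)) \<partial>M) =
        (CLINT \<omega>|M. iexp (t * q (Z n \<omega>)))" for n
    proof -
      have i: "integrable M (\<lambda>\<omega>. complex_of_real (cos (t * q (Z n \<omega>))))"
        "integrable M (\<lambda>\<omega>. \<i> * complex_of_real (sin (t * q (Z n \<omega>))))"
        by (auto intro!: integrable_const_bound[where B = 1] simp: norm_mult)
      show ?thesis unfolding eq Bochner_Integration.integral_add[OF i] by simp
    qed
    moreover have "complex_of_real (\<integral>y. cos (t * q y) \<partial>\<nu>) + \<i> * complex_of_real (\<integral>y. sin (t * q y) \<partial>\<nu>) =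
        (CLINT y|\<nu>. iexp (t * q y))"
    proof -
      have i: "integrable \<nu> (\<lambda>y. complex_of_real (cos (t * q y)))"
        "integrable \<nu> (\<lambda>y. \<i> * complex_of_real (sin (t * q y)))"
        by (auto intro!: N.integrable_const_bound[where B = 1] simp: norm_mult)
      show ?thesis unfolding eq Bochner_Integration.integral_add[OF i] by simp
    qed
    ultimately show ?thesis by simp
  qed
  then have "(\<lambda>n. CLINT \<omega>|M. iexp (t \<bullet> Q n \<omega>)) \<longlonglongrightarrow> (CLINT y|\<nu>. iexp (t * q y))" for t
    by (intro char_tendsto_cong[OF _ _ _ diff]) simp_all
  moreover have "(CLINT y|\<nu>. iexp (t * q y)) = char (distr \<nu> borel q) t" for t
    unfolding char_def by (subst integral_distr) auto
  moreover have "real_distribution (distr \<nu> borel q)"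
    by (rule N.real_distribution_distr) measurable
  moreover have "measure (distr \<nu> borel q) {x} = 0"
    using null by (simp add: measure_distr sp vimage_def)
  ultimately have "(\<lambda>n. prob {\<omega> \<in> space M. Q n \<omega> \<le> x}) \<longlonglongrightarrow> cdf (distr \<nu> borel q) x"
    by (intro cdf_tendsto_of_char) auto
  also have "cdf (distr \<nu> borel q) x = measure \<nu> {y. q y \<le> x}"
    by (simp add: cdf_def measure_distr sp vimage_def)
  finally show ?thesis .
qed

text \<open>Without atoms the distribution function is continuous. The defining set is then closed
  and contains its infimum, which gives one inequality; the values to the left of the infimum give
  the other in the limit.\<close>

lemma cdf_quantile:
  assumes "real_distribution \<nu>" and atom: "\<And>x. measure \<nu> {x} = 0" and t: "0 < t" "t < 1"
  shows "cdf \<nu> (quantile \<nu> t) = t"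
proof -
  interpret N: real_distribution \<nu> by fact
  let ?S = "{x. t \<le> cdf \<nu> x}"
  have cont: "continuous_on UNIV (cdf \<nu>)"
    using atom by (intro continuous_at_imp_continuous_on) (simp add: N.isCont_cdf)
  have "\<forall>\<^sub>F x in at_top. t < cdf \<nu> x"
    using N.cdf_lim_at_top_prob t by (simp add: order_tendsto_iff)
  then obtain a where "t < cdf \<nu> a" by (auto simp: eventually_at_top_linorder)
  then have ne: "?S \<noteq> {}" by (auto intro: less_imp_le)
  have "\<forall>\<^sub>F x in at_bot. cdf \<nu> x < t"
    using N.cdf_lim_at_bot t by (simp add: order_tendsto_iff)
  then obtain b where b: "\<And>x. x \<le> b \<Longrightarrow> cdf \<nu> x < t" by (auto simp: eventually_at_bot_linorder)
  have bdd: "bdd_below ?S"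
  proof (rule bdd_belowI[of _ b])
    show "b \<le> x" if "x \<in> ?S" for x
      using that b[of x] by (cases "x \<le> b") auto
  qed
  have "closed ?S" using cont by (intro closed_Collect_le continuous_intros)
  then have "quantile \<nu> t \<in> ?S"
    unfolding quantile_def using ne bdd by (rule closed_contains_Inf[rotated 2])
  moreover have "cdf \<nu> (quantile \<nu> t) \<le> t"
  proof (rule tendsto_upperbound)
    show "(cdf \<nu> \<longlongrightarrow> cdf \<nu> (quantile \<nu> t)) (at_left (quantile \<nu> t))"
      using atom N.isCont_cdf by (auto simp: continuous_at intro: filterlim_mono[OF _ order_refl at_le])
    have "cdf \<nu> y \<le> t" if "y < quantile \<nu> t" for y
      using that cInf_lower[OF _ bdd, of y] by (force simp: quantile_def)
    then show "\<forall>\<^sub>F y in at_left (quantile \<nu> t). cdf \<nu> y \<le> t"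
      by (auto simp: eventually_at_left_field intro!: exI[of _ "quantile \<nu> t - 1"])
  qed simp
  ultimately show ?thesis by simp
qed

section \<open>Normal and chi-square laws: atoms, quadratic forms and tails\<close>

lemma real_distribution_std_normal: "real_distribution std_normal"
  unfolding std_normal_def by (rule real_dist_normal_dist)

lemma emeasure_std_normal_finite:
  assumes "finite A"
  shows "emeasure std_normal A = 0"
proof -
  have "A \<in> sets borel" using assms by (simp add: finite_imp_closed borel_closed)
  moreover have "A \<in> null_sets lborel" using assms by (rule finite_imp_null_set_lborel)
  ultimately show ?thesis
    unfolding std_normal_def by (subst emeasure_density) (auto intro!: nn_integral_null_set)
qed

lemma real_distribution_chi_square: "real_distribution (chi_square k)"
  unfolding chi_square_def
  by (rule prob_space.real_distribution_distr[OF prob_space_PiM_std_normal]) measurable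

text \<open>Integrating over the last coordinate first: with the others fixed, the sum of squares
  takes the value \<open>x\<close> for at most two values of that coordinate.\<close>

lemma chi_square_no_atom: "measure (chi_square (Suc k)) {x} = 0"
proof -
  interpret N: prob_space std_normal by (rule prob_space_std_normal)
  interpret product_prob_space "\<lambda>_ :: nat. std_normal" "{..<k}" ..
  let ?P = "\<Pi>\<^sub>M i\<in>{..<Suc k}. std_normal"
  let ?A = "{z \<in> space ?P. (\<Sum>i<Suc k. (z i)\<^sup>2) = x}"
  have A: "?A \<in> sets ?P" by measurable
  have "emeasure (chi_square (Suc k)) {x} = emeasure ?P ?A"
    unfolding chi_square_def by (subst emeasure_distr) (auto simp: vimage_def Int_def conj_commute)
  also have "\<dots> = (\<integral>\<^sup>+z. indicator ?A z \<partial>?P)" using A by simp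
  also have "\<dots> = (\<integral>\<^sup>+z. (\<integral>\<^sup>+y. indicator ?A (z(k := y)) \<partial>std_normal) \<partial>(\<Pi>\<^sub>M i\<in>{..<k}. std_normal))"
    unfolding lessThan_Suc by (rule product_nn_integral_insert) (use A in \<open>auto simp: lessThan_Suc\<close>)
  also have "\<dots> = (\<integral>\<^sup>+z. 0 \<partial>(\<Pi>\<^sub>M i\<in>{..<k}. std_normal))"
  proof (rule nn_integral_cong)
    fix z :: "nat \<Rightarrow> real"
    let ?F = "{sqrt (x - (\<Sum>i<k. (z i)\<^sup>2)), - sqrt (x - (\<Sum>i<k. (z i)\<^sup>2))}"
    have "(\<integral>\<^sup>+y. indicator ?A (z(k := y)) \<partial>std_normal) \<le> (\<integral>\<^sup>+y. indicator ?F y \<partial>std_normal)"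
    proof (rule nn_integral_mono)
      fix y :: real
      have "y \<in> ?F" if "z(k := y) \<in> ?A"
      proof -
        have "(\<Sum>i<k. ((z(k := y)) i)\<^sup>2) = (\<Sum>i<k. (z i)\<^sup>2)"
          by (rule sum.cong) auto
        with that have "y\<^sup>2 = x - (\<Sum>i<k. (z i)\<^sup>2)" by simp
        then have "\<bar>y\<bar> = sqrt (x - (\<Sum>i<k. (z i)\<^sup>2))" by (metis real_sqrt_abs)
        then show ?thesis by auto
      qed
      then show "indicator ?A (z(k := y)) \<le> (indicator ?F y :: ennreal)"
        by (auto simp: indicator_def)
    qed
    also have "\<dots> = 0"
      by (subst nn_integral_indicator) (auto simp: emeasure_std_normal_finite)
    finally show "(\<integral>\<^sup>+y. indicator ?A (z(k := y)) \<partial>std_normal) = 0" by simp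
  qed
  finally show ?thesis by (simp add: measure_def)
qed

text \<open>The components of the vector are indexed by a type, those of \<open>chi_square\<close>
  by an initial segment; a bijection reindexes the product measure and preserves the sum.\<close>

lemma distr_std_normal_vec_norm_sq:
  "distr (std_normal_vec :: (real ^ 'n) measure) borel (\<lambda>z. z \<bullet> z) = chi_square CARD('n)"
proof -
  obtain f :: "'n \<Rightarrow> nat" where f: "bij_betw f UNIV {..<CARD('n)}"
    using ex_bij_betw_finite_nat[of "UNIV :: 'n set"] by (auto simp: atLeast0LessThan)
  let ?K = "\<Pi>\<^sub>M i\<in>{..<CARD('n)}. std_normal" and ?I = "\<Pi>\<^sub>M i\<in>(UNIV :: 'n set). std_normal"
  have "distr ?K ?I (\<lambda>\<omega>. \<lambda>i\<in>UNIV. \<omega> (f i)) = ?I"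
    by (rule distr_PiM_reindex) (use f in \<open>auto simp: bij_betw_def prob_space_std_normal\<close>)
  then have re: "distr ?K ?I (\<lambda>\<omega> i. \<omega> (f i)) = ?I" by (simp add: restrict_UNIV)
  have fK: "f i < CARD('n)" for i using f by (auto simp: bij_betw_def)
  have [measurable]: "(\<lambda>\<omega> i. \<omega> (f i)) \<in> ?K \<rightarrow>\<^sub>M ?I"
    by (rule measurable_PiM_single') (auto simp: space_PiM intro!: measurable_component_singleton fK)
  have "distr std_normal_vec borel (\<lambda>z :: real ^ 'n. z \<bullet> z) = distr ?I borel (\<lambda>z. (\<chi> i. z i) \<bullet> ((\<chi> i. z i) :: real ^ 'n))"
    unfolding std_normal_vec_def by (subst distr_distr) (auto simp: comp_def)
  also have "\<dots> = distr ?K borel (\<lambda>\<omega>. (\<chi> i. \<omega> (f i)) \<bullet> ((\<chi> i. \<omega> (f i)) :: real ^ 'n))"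
    by (subst re[symmetric], subst distr_distr) (auto simp: comp_def)
  also have "\<dots> = distr ?K borel (\<lambda>\<omega>. \<Sum>i<CARD('n). (\<omega> i)\<^sup>2)"
  proof (rule distr_cong)
    fix \<omega> :: "nat \<Rightarrow> real"
    have "(\<chi> i. \<omega> (f i)) \<bullet> ((\<chi> i. \<omega> (f i)) :: real ^ 'n) = (\<Sum>i\<in>UNIV. (\<omega> (f i))\<^sup>2)"
      by (simp add: inner_vec_def power2_eq_square)
    also have "\<dots> = (\<Sum>i<CARD('n). (\<omega> i)\<^sup>2)"
      by (rule sum.reindex_bij_betw[OF f])
    finally show "(\<chi> i. \<omega> (f i)) \<bullet> ((\<chi> i. \<omega> (f i)) :: real ^ 'n) = (\<Sum>i<CARD('n). (\<omega> i)\<^sup>2)" .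
  qed auto
  finally show ?thesis by (simp add: chi_square_def)
qed

lemma pd_invertible:
  fixes S :: "real ^ 'n ^ 'n"
  assumes "\<And>x. x \<noteq> 0 \<Longrightarrow> 0 < x \<bullet> (S *v x)"
  shows "det S \<noteq> 0"
proof -
  have "inj ((*v) S)"
  proof (rule injI)
    fix x y assume "S *v x = S *v y"
    then have "(x - y) \<bullet> (S *v (x - y)) = 0" by (simp add: matrix_vector_mult_diff_distrib)
    with assms[of "x - y"] show "x = y" by fastforce
  qed
  then show ?thesis by (metis invertible_det_nz invertible_left_inverse matrix_left_invertible_injective)
qed

text \<open>Under the substitution of \<open>B *v z\<close> for \<open>y\<close>, with
  \<open>B\<close> the chosen root of \<open>S\<close>, the form of the inverse covariance becomes
  \<open>z \<bullet> z\<close>.\<close>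

lemma distr_centred_normal_quadratic_form:
  fixes S :: "real ^ 'n ^ 'n"
  assumes sym: "transpose S = S" and pd: "\<And>x. x \<noteq> 0 \<Longrightarrow> 0 < x \<bullet> (S *v x)"
  shows "distr (centred_normal S) borel (\<lambda>y. y \<bullet> (matrix_inv S *v y)) = chi_square CARD('n)"
proof -
  define B :: "real ^ 'n ^ 'n" where "B = (SOME B. B ** transpose B = S)"
  have "0 \<le> x \<bullet> (S *v x)" for x by (cases "x = 0") (auto intro: less_imp_le pd)
  from psd_matrix_root[OF sym this] have B: "B ** transpose B = S"
    unfolding B_def by (rule someI_ex)
  have S: "det S \<noteq> 0" using pd by (rule pd_invertible)
  then have dB: "det B \<noteq> 0" "det (transpose B) \<noteq> 0" unfolding B[symmetric] det_mul by auto
  have eq: "(B *v z) \<bullet> (matrix_inv S *v (B *v z)) = z \<bullet> z" for z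
  proof -
    \<comment> \<open>Since \<open>B\<close> is invertible, cancelling it in
      \<open>B *v (transpose B *v u) = B *v z\<close> identifies \<open>transpose B *v u\<close>
      with \<open>z\<close>, without computing the inverse of \<open>S\<close> from that of
      \<open>B\<close>.\<close>
    define u where "u = matrix_inv S *v (B *v z)"
    have "B *v (transpose B *v u) = S *v u" by (simp only: matrix_vector_mul_assoc B)
    also have "\<dots> = B *v z" unfolding u_def by (rule matrix_inv_vector(1)[OF S])
    finally have "B *v (transpose B *v u) = B *v z" .
    then have "transpose B *v u = z" using matrix_inv_vector(2)[OF dB(1)] by metis
    then show ?thesis
      unfolding u_def[symmetric]
      by (metis dot_lmul_matrix inner_commute vector_transpose_matrix)
  qed
  show ?thesis
    unfolding centred_normal_def B_def[symmetric]
    by (subst distr_distr) (auto simp: comp_def eq distr_std_normal_vec_norm_sq)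
qed

text \<open>A coordinate is the linear functional given by \<open>axis j\<close>; division by its
  standard deviation normalises the exponent, and the characteristic function determines the
  law.\<close>

lemma distr_centred_normal_component:
  fixes S B :: "real ^ 'n ^ 'n"
  assumes "B ** transpose B = S" and S: "0 < S $ j $ j"
  shows "distr (centred_normal S) borel (\<lambda>y. y $ j / sqrt (S $ j $ j)) = std_normal"
proof (rule Levy_uniqueness)
  interpret N: prob_space "centred_normal S" by (rule prob_space_centred_normal)
  show "real_distribution (distr (centred_normal S) borel (\<lambda>y. y $ j / sqrt (S $ j $ j)))"
    by (rule N.real_distribution_distr) measurable
  show "char (distr (centred_normal S) borel (\<lambda>y. y $ j / sqrt (S $ j $ j))) = char std_normal"
  proof
    fix t
    have "char (distr (centred_normal S) borel (\<lambda>y. y $ j / sqrt (S $ j $ j))) t =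
        (CLINT y|centred_normal S. iexp (axis j (t / sqrt (S $ j $ j)) \<bullet> y))"
      unfolding char_def by (subst integral_distr) (auto simp: inner_axis')
    also have "\<dots> = exp (- (t\<^sup>2 / 2))"
    proof -
      have "axis j (t / sqrt (S $ j $ j)) = (t / sqrt (S $ j $ j)) *\<^sub>R axis j 1"
        by (simp add: axis_def vec_eq_iff)
      then have "axis j (t / sqrt (S $ j $ j)) \<bullet> (S *v axis j (t / sqrt (S $ j $ j))) = t\<^sup>2"
        using S by (simp add: matrix_vector_mult_scaleR matrix_vector_mult_basis inner_axis' column_def
          power2_eq_square)
      then show ?thesis unfolding char_centred_normal[OF assms(1)] by simp
    qed
    finally show "char (distr (centred_normal S) borel (\<lambda>y. y $ j / sqrt (S $ j $ j))) t = char std_normal t"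
      unfolding char_def[of std_normal] char_std_normal by simp
  qed
qed (rule real_distribution_std_normal)

lemma std_normal_symmetric: "distr std_normal borel uminus = std_normal"
proof (rule Levy_uniqueness)
  interpret N: real_distribution std_normal by (rule real_distribution_std_normal)
  show "real_distribution (distr std_normal borel uminus)"
    by (rule N.real_distribution_distr) measurable
  show "char (distr std_normal borel uminus) = char std_normal"
  proof
    fix t
    have "char (distr std_normal borel uminus) t = (CLINT x|std_normal. iexp ((- t) * x))"
      unfolding char_def by (subst integral_distr) auto
    then show "char (distr std_normal borel uminus) t = char std_normal t"
      unfolding char_std_normal char_def by simp
  qed
qed (rule real_distribution_std_normal)

text \<open>Symmetry gives each tail mass \<open>\<alpha> / 2\<close> and puts the median at 0,
  which makes the quantile positive. Positivity later identifies the boundary of the interval with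
  the two points at plus and minus the quantile.\<close>

lemma std_normal_two_sided:
  assumes "\<alpha> \<in> {0<..<1}"
  shows "0 < quantile std_normal (1 - \<alpha> / 2)"
    and "measure std_normal {x. \<bar>x\<bar> \<le> quantile std_normal (1 - \<alpha> / 2)} = 1 - \<alpha>"
proof -
  interpret N: real_distribution std_normal by (rule real_distribution_std_normal)
  let ?z = "quantile std_normal (1 - \<alpha> / 2)"
  have atom: "N.prob {x} = 0" for x
    using emeasure_std_normal_finite[of "{x}"] by (simp add: measure_def)
  have sym: "N.prob {..- x} = 1 - cdf std_normal x" for x
  proof -
    have "N.prob {..- x} = measure (distr std_normal borel uminus) {..- x}"
      by (simp add: std_normal_symmetric)
    also have "\<dots> = N.prob {x..}"
      by (subst measure_distr) (auto simp: vimage_def intro!: arg_cong[where f = N.prob])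
    also have "\<dots> = N.prob ({x<..} \<union> {x})" by (rule arg_cong[where f = N.prob]) auto
    also have "\<dots> = N.prob {x<..}"
      by (subst N.finite_measure_Union) (auto simp: atom)
    also have "{x<..} = space std_normal - {..x}" by auto
    also have "N.prob (space std_normal - {..x}) = 1 - cdf std_normal x"
      by (subst N.prob_compl) (auto simp: cdf_def)
    finally show ?thesis .
  qed
  have z: "cdf std_normal ?z = 1 - \<alpha> / 2"
    by (rule cdf_quantile) (use atom assms real_distribution_std_normal in auto)
  have half: "cdf std_normal 0 = 1 / 2" using sym[of 0] by (simp add: cdf_def)
  show pos: "0 < ?z"
  proof (rule ccontr)
    assume "\<not> 0 < ?z"
    then have "cdf std_normal ?z \<le> cdf std_normal 0" by (intro N.cdf_nondecreasing) auto
    then show False using z half assms by simp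
  qed
  have "{x. \<bar>x\<bar> \<le> ?z} = {- ?z<..?z} \<union> {- ?z}" using pos by auto
  then have "N.prob {x. \<bar>x\<bar> \<le> ?z} = N.prob {- ?z<..?z}"
    by (simp only:) (subst N.finite_measure_Union, auto simp: atom)
  also have "\<dots> = cdf std_normal ?z - cdf std_normal (- ?z)"
    using pos by (subst N.cdf_diff_eq) auto
  also have "\<dots> = 1 - \<alpha>" using sym[of ?z] z by (simp add: cdf_def)
  finally show "N.prob {x. \<bar>x\<bar> \<le> ?z} = 1 - \<alpha>" .
qed

section \<open>Confidence sets from asymptotic normality\<close>

context prob_space
begin

text \<open>Each term of the double sum is an o_P(1) matrix entry times two tight
  coordinates.\<close>

lemma quadratic_form_perturbation:
  fixes Z :: "nat \<Rightarrow> 'a \<Rightarrow> real ^ 'n" and D :: "nat \<Rightarrow> 'a \<Rightarrow> real ^ 'n ^ 'n"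
  assumes Z: "bounded_in_prob Z" and D: "((\<lambda>x. D (fst x) (snd x)) \<longlongrightarrow> A) (in_prob M)"
  shows "((\<lambda>x. Z (fst x) (snd x) \<bullet> (D (fst x) (snd x) *v Z (fst x) (snd x)) -
    Z (fst x) (snd x) \<bullet> (A *v Z (fst x) (snd x))) \<longlongrightarrow> 0) (in_prob M)"
proof -
  let ?Z = "\<lambda>x. Z (fst x) (snd x)" and ?D = "\<lambda>x. D (fst x) (snd x)"
  have entry: "((\<lambda>x. ?Z x $ i * ((?D x $ i $ j - A $ i $ j) * ?Z x $ j)) \<longlongrightarrow> 0) (in_prob M)" for i j
  proof (rule Lim_null_comparison)
    have "((\<lambda>x. \<bar>?D x $ i $ j - A $ i $ j\<bar>) \<longlongrightarrow> \<bar>A $ i $ j - A $ i $ j\<bar>) (in_prob M)"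
      by (intro tendsto_intros D)
    then have "((\<lambda>x. \<bar>?D x $ i $ j - A $ i $ j\<bar>) \<longlongrightarrow> 0) (in_prob M)" by simp
    from bounded_in_prob_tendsto_0[OF bounded_in_prob_tendsto_0[OF this Z] Z]
    show "((\<lambda>x. \<bar>?D x $ i $ j - A $ i $ j\<bar> * norm (?Z x) * norm (?Z x)) \<longlongrightarrow> 0) (in_prob M)" .
    show "\<forall>\<^sub>F x in in_prob M. norm (?Z x $ i * ((?D x $ i $ j - A $ i $ j) * ?Z x $ j))
        \<le> \<bar>?D x $ i $ j - A $ i $ j\<bar> * norm (?Z x) * norm (?Z x)"
    proof (rule always_eventually, rule allI)
      fix x
      have "\<bar>?D x $ i $ j - A $ i $ j\<bar> * \<bar>?Z x $ i\<bar> * \<bar>?Z x $ j\<bar> \<le> \<bar>?D x $ i $ j - A $ i $ j\<bar> * norm (?Z x) * norm (?Z x)"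
        by (intro mult_mono mult_left_mono component_le_norm_cart) auto
      then show "norm (?Z x $ i * ((?D x $ i $ j - A $ i $ j) * ?Z x $ j))
        \<le> \<bar>?D x $ i $ j - A $ i $ j\<bar> * norm (?Z x) * norm (?Z x)"
        by (simp add: abs_mult mult_ac)
    qed
  qed
  have "((\<lambda>x. \<Sum>i\<in>UNIV. \<Sum>j\<in>UNIV. ?Z x $ i * ((?D x $ i $ j - A $ i $ j) * ?Z x $ j)) \<longlongrightarrow> 0) (in_prob M)"
    by (intro tendsto_null_sum entry)
  moreover have "(\<Sum>i\<in>UNIV. \<Sum>j\<in>UNIV. z $ i * ((B $ i $ j - A $ i $ j) * z $ j)) =
      z \<bullet> (B *v z) - z \<bullet> (A *v z)" for z and B :: "real ^ 'n ^ 'n"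
    by (simp add: inner_vec_def matrix_vector_mult_def sum_distrib_left left_diff_distrib
      right_diff_distrib sum_subtractf)
  ultimately show ?thesis by simp
qed

text \<open>Region and intervals take separate covariance estimates: the bias-corrected region
  inverts \<open>Sig_T\<close>, whereas the accompanying intervals use \<open>Sig_hat\<close>. The
  scale \<open>k n\<close> will be \<open>real n * h n\<close>.\<close>

lemma asymptotic_normal_inference:
  fixes b :: "nat \<Rightarrow> 'a \<Rightarrow> real ^ 'n" and S :: "real ^ 'n ^ 'n"
    and Si Sh :: "nat \<Rightarrow> 'a \<Rightarrow> real ^ 'n ^ 'n" and k :: "nat \<Rightarrow> real"
  assumes b[measurable]: "\<And>n. b n \<in> borel_measurable M"
    and Si[measurable]: "\<And>n. Si n \<in> borel_measurable M" and Sh[measurable]: "\<And>n. Sh n \<in> borel_measurable M"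
    and k: "\<forall>\<^sub>F n in sequentially. 0 < k n"
    and char: "\<And>t. (\<lambda>n. CLINT \<omega>|M. iexp (t \<bullet> (sqrt (k n) *\<^sub>R (b n \<omega> - \<theta>))))
      \<longlonglongrightarrow> exp (- (t \<bullet> (S *v t)) / 2)"
    and sym: "transpose S = S" and pd: "\<And>x. x \<noteq> 0 \<Longrightarrow> 0 < x \<bullet> (S *v x)"
    and Si_lim: "((\<lambda>x. Si (fst x) (snd x)) \<longlongrightarrow> matrix_inv S) (in_prob M)"
    and Sh_lim: "((\<lambda>x. Sh (fst x) (snd x)) \<longlongrightarrow> S) (in_prob M)"
    and \<alpha>: "\<alpha> \<in> {0<..<1}"
  shows "conv_in_distr M (\<lambda>n \<omega>. sqrt (k n) *\<^sub>R (b n \<omega> - \<theta>)) (centred_normal S)" (is ?A)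
    and "asymp_confidence_set M (1 - \<alpha>)
      (\<lambda>n \<omega>. {c. k n * ((b n \<omega> - c) \<bullet> (Si n \<omega> *v (b n \<omega> - c))) \<le> quantile (chi_square CARD('n)) (1 - \<alpha>)}) \<theta>" (is ?B)
    and "asymp_confidence_set M (1 - \<alpha>)
      (\<lambda>n \<omega>. let r = quantile std_normal (1 - \<alpha> / 2) * sqrt (Sh n \<omega> $ j $ j / k n)
        in {b n \<omega> $ j - r .. b n \<omega> $ j + r}) (\<theta> $ j)" (is ?C)
proof -
  let ?N = "centred_normal S"
  interpret N: prob_space ?N by (rule prob_space_centred_normal)
  have sN: "space ?N = UNIV" using sets_eq_imp_space_eq[OF sets_centred_normal, of S] by simp
  define Z where "Z n \<omega> = sqrt (k n) *\<^sub>R (b n \<omega> - \<theta>)" for n \<omega>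
  have [measurable]: "Z n \<in> borel_measurable M" for n unfolding Z_def by measurable
  have "0 \<le> x \<bullet> (S *v x)" for x by (cases "x = 0") (auto intro: less_imp_le pd)
  from psd_matrix_root[OF sym this] obtain B :: "real ^ 'n ^ 'n" where B: "B ** transpose B = S" by blast
  have lim: "(\<lambda>n. CLINT \<omega>|M. iexp (t \<bullet> Z n \<omega>)) \<longlonglongrightarrow> (CLINT x|?N. iexp (t \<bullet> x))" for t
    unfolding char_centred_normal[OF B] Z_def by (rule char)
  have conv: "conv_in_distr M Z ?N"
    by (rule conv_in_distr_of_char_tendsto[OF _ prob_space_centred_normal _ lim]) auto
  then show ?A by (simp add: Z_def[abs_def])
  have "isCont (\<lambda>t :: real ^ 'n. complex_of_real (exp (- (t \<bullet> (S *v t)) / 2))) 0"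
    by (intro continuous_intros isCont_exp linear_continuous_at matrix_vector_mul_bounded_linear) auto
  from bounded_in_prob_of_char_tendsto[OF _ _ this, of Z] char
  have bdd: "bounded_in_prob Z" by (simp add: Z_def)

  define q where "q y = y \<bullet> (matrix_inv S *v y)" for y
  have "continuous_on UNIV q"
    unfolding q_def by (intro continuous_intros linear_continuous_on matrix_vector_mul_bounded_linear)
  let ?x = "quantile (chi_square CARD('n)) (1 - \<alpha>)"
  interpret C: real_distribution "chi_square CARD('n)" by (rule real_distribution_chi_square)
  have [measurable]: "q \<in> borel_measurable borel" unfolding q_def by measurable
  have d: "distr ?N borel q = chi_square CARD('n)"
    unfolding q_def by (rule distr_centred_normal_quadratic_form[OF sym pd])
  have law: "measure ?N (q -` A) = measure (chi_square CARD('n)) A" if "A \<in> sets borel" for A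
    using measure_distr[of q ?N borel A] that d by (simp add: sN)
  obtain m where m: "CARD('n) = Suc m" by (metis zero_less_card_finite gr0_implies_Suc)
  have atom: "measure (chi_square CARD('n)) {x} = 0" for x
    unfolding m by (rule chi_square_no_atom)
  have "(\<lambda>n. prob {\<omega> \<in> space M. Z n \<omega> \<bullet> (Si n \<omega> *v Z n \<omega>) \<le> ?x}) \<longlonglongrightarrow> measure ?N {y. q y \<le> ?x}"
  proof (rule portmanteau_sublevel[OF conv])
    show "((\<lambda>x. Z (fst x) (snd x) \<bullet> (Si (fst x) (snd x) *v Z (fst x) (snd x)) - q (Z (fst x) (snd x))) \<longlongrightarrow> 0) (in_prob M)"
      unfolding q_def by (rule quadratic_form_perturbation[OF bdd Si_lim])
    show "measure ?N {y. q y = ?x} = 0"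
      using law[of "{?x}"] atom by (simp add: vimage_def)
  qed (use \<open>continuous_on UNIV q\<close> prob_space_centred_normal in auto)
  also have "measure ?N {y. q y \<le> ?x} = cdf (chi_square CARD('n)) ?x"
    using law[of "{..?x}"] by (simp add: vimage_def cdf_def)
  also have "\<dots> = 1 - \<alpha>"
    by (rule cdf_quantile) (use atom \<alpha> real_distribution_chi_square in auto)
  finally have B1: "(\<lambda>n. prob {\<omega> \<in> space M. Z n \<omega> \<bullet> (Si n \<omega> *v Z n \<omega>) \<le> ?x}) \<longlonglongrightarrow> 1 - \<alpha>" .
  show ?B
    unfolding asymp_confidence_set_def
  proof (rule Lim_transform_eventually[OF B1])
    show "\<forall>\<^sub>F n in sequentially. prob {\<omega> \<in> space M. Z n \<omega> \<bullet> (Si n \<omega> *v Z n \<omega>) \<le> ?x} =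
      prob {\<omega> \<in> space M. \<theta> \<in> {c. k n * ((b n \<omega> - c) \<bullet> (Si n \<omega> *v (b n \<omega> - c))) \<le> ?x}}"
      using k
    proof eventually_elim
      case (elim n)
      then have "Z n \<omega> \<bullet> (Si n \<omega> *v Z n \<omega>) = k n * ((b n \<omega> - \<theta>) \<bullet> (Si n \<omega> *v (b n \<omega> - \<theta>)))" for \<omega>
        by (simp add: Z_def matrix_vector_mult_scaleR mult.assoc[symmetric])
      then show ?case by simp
    qed
  qed

  let ?z = "quantile std_normal (1 - \<alpha> / 2)"
  have Sj: "0 < S $ j $ j"
    using pd[of "axis j 1"] by (simp add: inner_axis' matrix_vector_mult_basis column_def axis_eq_0_iff)
  \<comment> \<open>The coverage event is written additively: replacing the estimated standard error
    by its limit is then an additive error tending to 0, with no division by a random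
    quantity.\<close>
  define p where "p y = \<bar>y $ j\<bar> - ?z * sqrt (S $ j $ j)" for y :: "real ^ 'n"
  have [measurable]: "p \<in> borel_measurable borel" unfolding p_def by measurable
  have lawj: "measure ?N {y. y $ j / sqrt (S $ j $ j) \<in> A} = measure std_normal A" if "A \<in> sets borel" for A
    using measure_distr[of "\<lambda>y. y $ j / sqrt (S $ j $ j)" ?N borel A] that
      distr_centred_normal_component[OF B Sj] by (simp add: sN vimage_def)
  have "(\<lambda>n. prob {\<omega> \<in> space M. \<bar>Z n \<omega> $ j\<bar> - ?z * sqrt (Sh n \<omega> $ j $ j) \<le> 0}) \<longlonglongrightarrow> measure ?N {y. p y \<le> 0}"
  proof (rule portmanteau_sublevel[OF conv])
    have "((\<lambda>x. ?z * sqrt (S $ j $ j) - ?z * sqrt (Sh (fst x) (snd x) $ j $ j)) \<longlongrightarrow>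
        ?z * sqrt (S $ j $ j) - ?z * sqrt (S $ j $ j)) (in_prob M)"
      by (intro tendsto_intros Sh_lim)
    then show "((\<lambda>x. \<bar>Z (fst x) (snd x) $ j\<bar> - ?z * sqrt (Sh (fst x) (snd x) $ j $ j) - p (Z (fst x) (snd x))) \<longlongrightarrow> 0) (in_prob M)"
      by (simp add: p_def)
    have "(\<bar>y\<bar> - z * s = 0) = (y / s \<in> {z, - z})" if "0 < z" "0 < s" for y z s :: real
    proof -
      have "(\<bar>y\<bar> - z * s = 0) = (\<bar>y / s\<bar> = z)" using that(2) by (auto simp: abs_divide field_simps)
      then show ?thesis using that(1) by (auto simp: abs_if)
    qed
    then have "{y. p y = 0} = {y :: real ^ 'n. y $ j / sqrt (S $ j $ j) \<in> {?z, - ?z}}"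
      using Sj std_normal_two_sided(1)[OF \<alpha>] unfolding p_def by simp
    then show "measure ?N {y. p y = 0} = 0"
      using lawj[of "{?z, - ?z}"] emeasure_std_normal_finite[of "{?z, - ?z}"] by (simp add: measure_def)
  qed (auto simp: p_def[abs_def] intro!: continuous_intros prob_space_centred_normal)
  also have "{y. p y \<le> 0} = {y :: real ^ 'n. y $ j / sqrt (S $ j $ j) \<in> {x. \<bar>x\<bar> \<le> ?z}}"
    using Sj unfolding p_def by (auto simp: field_simps abs_if split: if_splits)
  also have "measure ?N \<dots> = 1 - \<alpha>"
    unfolding std_normal_two_sided(2)[OF \<alpha>, symmetric]
    by (rule lawj) measurable
  finally have C1: "(\<lambda>n. prob {\<omega> \<in> space M. \<bar>Z n \<omega> $ j\<bar> - ?z * sqrt (Sh n \<omega> $ j $ j) \<le> 0}) \<longlonglongrightarrow> 1 - \<alpha>" .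
  show ?C
    unfolding asymp_confidence_set_def
  proof (rule Lim_transform_eventually[OF C1])
    show "\<forall>\<^sub>F n in sequentially. prob {\<omega> \<in> space M. \<bar>Z n \<omega> $ j\<bar> - ?z * sqrt (Sh n \<omega> $ j $ j) \<le> 0} =
      prob {\<omega> \<in> space M. \<theta> $ j \<in> (let r = ?z * sqrt (Sh n \<omega> $ j $ j / k n) in {b n \<omega> $ j - r..b n \<omega> $ j + r})}"
      using k
    proof eventually_elim
      case (elim n)
      have "(\<bar>Z n \<omega> $ j\<bar> - ?z * sqrt (Sh n \<omega> $ j $ j) \<le> 0) =
          (\<theta> $ j \<in> (let r = ?z * sqrt (Sh n \<omega> $ j $ j / k n) in {b n \<omega> $ j - r..b n \<omega> $ j + r}))" for \<omega>
      proof -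
        have "sqrt (k n) > 0" using elim by simp
        then have "(\<bar>Z n \<omega> $ j\<bar> \<le> ?z * sqrt (Sh n \<omega> $ j $ j)) =
            (\<bar>b n \<omega> $ j - \<theta> $ j\<bar> \<le> ?z * sqrt (Sh n \<omega> $ j $ j) / sqrt (k n))"
          by (simp add: Z_def abs_mult pos_le_divide_eq mult.commute)
        then show ?thesis
          by (auto simp: Let_def real_sqrt_divide abs_le_iff)
      qed
      then show ?case by simp
    qed
  qed
qed

end

section \<open>Second moments and kernel asymptotics\<close>

lemma bounded_linear_axis: "bounded_linear (axis i :: 'b :: euclidean_space \<Rightarrow> 'b ^ 'n)"
  by (rule linear_conv_bounded_linear[THEN iffD1], rule linearI) (auto simp: axis_def vec_eq_iff)

lemma integrable_vec_lambda:
  fixes f :: "'n :: finite \<Rightarrow> 'a \<Rightarrow> 'b :: euclidean_space"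
  assumes "\<And>i. integrable M (f i)"
  shows "integrable M (\<lambda>x. \<chi> i. f i x)"
proof -
  have "(\<lambda>x. \<chi> i. f i x) = (\<lambda>x. \<Sum>i\<in>UNIV. axis i (f i x))"
    by (simp add: fun_eq_iff vec_eq_iff axis_def if_distrib cong: if_cong)
  then show ?thesis
    using assms by (simp only:) (intro Bochner_Integration.integrable_sum integrable_bounded_linear[OF bounded_linear_axis])
qed

lemma integral_vec_nth:
  fixes f :: "'a \<Rightarrow> 'b :: euclidean_space ^ 'n"
  assumes "integrable M f"
  shows "(\<integral>x. f x \<partial>M) $ i = (\<integral>x. f x $ i \<partial>M)"
  by (rule integral_bounded_linear[OF bounded_linear_vec_nth assms, symmetric])

lemma integrable_vec_nth:
  fixes f :: "'a \<Rightarrow> 'b :: euclidean_space ^ 'n"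
  shows "integrable M f \<Longrightarrow> integrable M (\<lambda>x. f x $ i)"
  by (rule integrable_bounded_linear[OF bounded_linear_vec_nth])

lemma outer_vector: "outer u u *v x = (x \<bullet> u) *\<^sub>R u"
  by (simp add: outer_def matrix_vector_mult_def vec_eq_iff inner_vec_def sum_distrib_left
    sum_distrib_right mult_ac)

lemma inner_outer: "x \<bullet> (outer u u *v x) = (x \<bullet> u)\<^sup>2"
  by (simp add: outer_vector power2_eq_square)

lemma transpose_outer: "transpose (outer u u) = outer u u"
  by (simp add: outer_def transpose_def mult.commute)

lemma bounded_linear_quadratic_form: "bounded_linear (\<lambda>A :: real ^ 'n ^ 'n. x \<bullet> (A *v x))"
  by (rule linear_conv_bounded_linear[THEN iffD1], rule linearI)
     (simp_all add: matrix_vector_mult_add_rdistrib inner_add_right scaleR_matrix_vector_assoc[symmetric])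

lemma bounded_linear_transpose: "bounded_linear (transpose :: real ^ 'n ^ 'm \<Rightarrow> _)"
  by (rule linear_conv_bounded_linear[THEN iffD1], rule linearI) (simp_all add: transpose_def vec_eq_iff)

context prob_space
begin

lemma second_moment_integrable:
  fixes W :: "'a \<Rightarrow> real ^ 'n"
  assumes [measurable]: "W \<in> borel_measurable M" and sq: "integrable M (\<lambda>\<omega>. (norm (W \<omega>))\<^sup>2)"
  shows "integrable M W" "integrable M (\<lambda>\<omega>. W \<omega> $ i * W \<omega> $ j)" "integrable M (\<lambda>\<omega>. outer (W \<omega>) (W \<omega>))"
    "integrable M (\<lambda>\<omega>. (t \<bullet> W \<omega>)\<^sup>2)"
proof -
  show ij: "integrable M (\<lambda>\<omega>. W \<omega> $ i * W \<omega> $ j)" for i j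
  proof (rule Bochner_Integration.integrable_bound[OF sq])
    have "\<bar>W \<omega> $ i\<bar> * \<bar>W \<omega> $ j\<bar> \<le> norm (W \<omega>) * norm (W \<omega>)" for \<omega>
      by (intro mult_mono component_le_norm_cart) auto
    then show "AE \<omega> in M. norm (W \<omega> $ i * W \<omega> $ j) \<le> norm ((norm (W \<omega>))\<^sup>2)"
      by (simp add: abs_mult power2_eq_square)
  qed (measurable)
  show "integrable M (\<lambda>\<omega>. outer (W \<omega>) (W \<omega>))"
    unfolding outer_def by (intro integrable_vec_lambda ij)
  show "integrable M W"
  proof (rule Bochner_Integration.integrable_bound)
    show "integrable M (\<lambda>\<omega>. 1 + (norm (W \<omega>))\<^sup>2)" using sq by simp
    have "norm (W \<omega>) \<le> 1 + (norm (W \<omega>))\<^sup>2" for \<omega>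
    proof (cases "norm (W \<omega>) \<le> 1")
      case False
      then show ?thesis using self_le_power[of "norm (W \<omega>)" 2] by simp
    qed (auto intro: order_trans[OF _ le_add_same_cancel1[THEN iffD2]])
    then show "AE \<omega> in M. norm (W \<omega>) \<le> norm (1 + (norm (W \<omega>))\<^sup>2)" by simp
  qed (measurable)
  show "integrable M (\<lambda>\<omega>. (t \<bullet> W \<omega>)\<^sup>2)"
  proof (rule Bochner_Integration.integrable_bound)
    show "integrable M (\<lambda>\<omega>. (norm t)\<^sup>2 * (norm (W \<omega>))\<^sup>2)" using sq by simp
    have "(t \<bullet> W \<omega>)\<^sup>2 \<le> (norm t)\<^sup>2 * (norm (W \<omega>))\<^sup>2" for \<omega>
      using power_mono[OF Cauchy_Schwarz_ineq2[of t "W \<omega>"], of 2] by (simp add: power_mult_distrib)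
    then show "AE \<omega> in M. norm ((t \<bullet> W \<omega>)\<^sup>2) \<le> norm ((norm t)\<^sup>2 * (norm (W \<omega>))\<^sup>2)"
      by simp
  qed (measurable)
qed

lemma second_moment_matrix:
  fixes W :: "'a \<Rightarrow> real ^ 'n"
  assumes W: "W \<in> borel_measurable M" "integrable M (\<lambda>\<omega>. (norm (W \<omega>))\<^sup>2)"
  shows "t \<bullet> ((\<integral>\<omega>. outer (W \<omega>) (W \<omega>) \<partial>M) *v t) = (\<integral>\<omega>. (t \<bullet> W \<omega>)\<^sup>2 \<partial>M)"
    and "transpose (\<integral>\<omega>. outer (W \<omega>) (W \<omega>) \<partial>M) = (\<integral>\<omega>. outer (W \<omega>) (W \<omega>) \<partial>M)"
  using integral_bounded_linear[OF bounded_linear_quadratic_form second_moment_integrable(3)[OF W], of t]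
    integral_bounded_linear[OF bounded_linear_transpose second_moment_integrable(3)[OF W]]
  by (simp_all add: inner_outer transpose_outer)

text \<open>A coordinate variance is the quadratic form of the covariance matrix at a unit
  coordinate vector.\<close>

lemma variance_le_lambda_max:
  fixes W :: "'a \<Rightarrow> real ^ 'n"
  assumes W[measurable]: "W \<in> borel_measurable M" and sq: "integrable M (\<lambda>\<omega>. (norm (W \<omega>))\<^sup>2)"
  shows "integrable M (\<lambda>\<omega>. (W \<omega> $ j - expectation W $ j)\<^sup>2)"
    "expectation (\<lambda>\<omega>. (W \<omega> $ j - expectation W $ j)\<^sup>2) \<le> lambda_max (cov_matrix M W)"
proof -
  define D where "D \<omega> = W \<omega> - expectation W" for \<omega>
  have [measurable]: "D \<in> borel_measurable M" unfolding D_def by measurable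
  have D2: "integrable M (\<lambda>\<omega>. (norm (D \<omega>))\<^sup>2)"
  proof (rule Bochner_Integration.integrable_bound)
    show "integrable M (\<lambda>\<omega>. 2 * (norm (W \<omega>))\<^sup>2 + 2 * (norm (expectation W))\<^sup>2)" using sq by simp
    have "(norm (D \<omega>))\<^sup>2 \<le> 2 * (norm (W \<omega>))\<^sup>2 + 2 * (norm (expectation W))\<^sup>2" for \<omega>
    proof -
      have "(norm (D \<omega>))\<^sup>2 \<le> (norm (W \<omega>) + norm (expectation W))\<^sup>2"
        unfolding D_def by (intro power_mono norm_triangle_ineq4) auto
      also have "\<dots> \<le> 2 * (norm (W \<omega>))\<^sup>2 + 2 * (norm (expectation W))\<^sup>2"
        using zero_le_power2[of "norm (W \<omega>) - norm (expectation W)"] by (simp add: power2_eq_square algebra_simps)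
      finally show ?thesis .
    qed
    then show "AE \<omega> in M. norm ((norm (D \<omega>))\<^sup>2) \<le> norm (2 * (norm (W \<omega>))\<^sup>2 + 2 * (norm (expectation W))\<^sup>2)"
      by simp
  qed (measurable)
  have cov: "cov_matrix M W = (\<integral>\<omega>. outer (D \<omega>) (D \<omega>) \<partial>M)"
    by (simp add: cov_matrix_def D_def[abs_def] Let_def)
  have Dj: "axis j 1 \<bullet> D \<omega> = W \<omega> $ j - expectation W $ j" for \<omega>
    by (simp add: inner_axis' D_def)
  show "integrable M (\<lambda>\<omega>. (W \<omega> $ j - expectation W $ j)\<^sup>2)"
    using second_moment_integrable(4)[OF _ D2, of "axis j 1"] by (simp add: Dj)
  have "expectation (\<lambda>\<omega>. (W \<omega> $ j - expectation W $ j)\<^sup>2) = axis j 1 \<bullet> (cov_matrix M W *v axis j 1)"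
    unfolding cov second_moment_matrix(1)[OF _ D2, of "axis j 1", simplified] by (simp add: Dj)
  also have "\<dots> \<le> lambda_max (cov_matrix M W) * (axis j 1 \<bullet> (axis j 1 :: real ^ 'n))"
    unfolding cov by (intro rayleigh_le_lambda_max second_moment_matrix(2)[OF _ D2]) measurable
  finally show "expectation (\<lambda>\<omega>. (W \<omega> $ j - expectation W $ j)\<^sup>2) \<le> lambda_max (cov_matrix M W)"
    by (simp add: inner_axis_axis)
qed

text \<open>Chebyshev's inequality in each coordinate. This is where the hypothesis on the largest
  eigenvalue is spent.\<close>

lemma scaled_deviation_tendsto_0:
  fixes W :: "nat \<Rightarrow> 'a \<Rightarrow> real ^ 'n" and k :: "nat \<Rightarrow> real"
  assumes W[measurable]: "\<And>n. W n \<in> borel_measurable M" and sq: "\<And>n. integrable M (\<lambda>\<omega>. (norm (W n \<omega>))\<^sup>2)"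
    and k: "\<forall>\<^sub>F n in sequentially. 0 < k n"
    and lim: "(\<lambda>n. k n * lambda_max (cov_matrix M (W n))) \<longlonglongrightarrow> 0"
  shows "((\<lambda>x. sqrt (k (fst x)) *\<^sub>R (W (fst x) (snd x) - expectation (W (fst x)))) \<longlongrightarrow> 0) (in_prob M)"
proof (rule vec_tendstoI, rule tendsto_in_probI, goal_cases)
  case (2 j e)
  have upper: "(\<lambda>n. (k n * lambda_max (cov_matrix M (W n))) / e\<^sup>2) \<longlonglongrightarrow> 0"
    using tendsto_divide[OF lim tendsto_const, of "e\<^sup>2"] 2 by simp
  have "\<forall>\<^sub>F n in sequentially. prob {\<omega> \<in> space M. e \<le> dist ((sqrt (k n) *\<^sub>R (W n \<omega> - expectation (W n))) $ j) (0 $ j)}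
      \<le> (k n * lambda_max (cov_matrix M (W n))) / e\<^sup>2"
    using k
  proof eventually_elim
    case (elim n)
    let ?D = "\<lambda>\<omega>. W n \<omega> $ j - expectation (W n) $ j"
    note v = variance_le_lambda_max[OF W sq, of n j]
    have i: "integrable M (\<lambda>\<omega>. k n * (?D \<omega>)\<^sup>2)" using v(1) by simp
    have "prob {\<omega> \<in> space M. e \<le> dist ((sqrt (k n) *\<^sub>R (W n \<omega> - expectation (W n))) $ j) (0 $ j)} \<le>
        prob {\<omega> \<in> space M. e\<^sup>2 \<le> k n * (?D \<omega>)\<^sup>2}"
    proof (rule finite_measure_mono)
      have "e\<^sup>2 \<le> k n * (?D \<omega>)\<^sup>2" if "e \<le> sqrt (k n) * \<bar>?D \<omega>\<bar>" for \<omega>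
        using power_mono[OF that, of 2] 2 elim by (simp add: power_mult_distrib)
      then show "{\<omega> \<in> space M. e \<le> dist ((sqrt (k n) *\<^sub>R (W n \<omega> - expectation (W n))) $ j) (0 $ j)} \<subseteq>
          {\<omega> \<in> space M. e\<^sup>2 \<le> k n * (?D \<omega>)\<^sup>2}"
        using elim by (auto simp: abs_mult)
    qed (measurable)
    also have "\<dots> \<le> expectation (\<lambda>\<omega>. k n * (?D \<omega>)\<^sup>2) / e\<^sup>2"
      by (rule integral_Markov_inequality_measure[OF i, where A = "{}"]) (use elim 2 in auto)
    also have "\<dots> \<le> (k n * lambda_max (cov_matrix M (W n))) / e\<^sup>2"
      using v(2) elim by (intro divide_right_mono) auto
    finally show ?case .
  qed
  from tendsto_sandwich[OF _ this tendsto_const upper] show ?case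
    by (simp only: measure_nonneg eventually_True)
qed (measurable)

lemma distributed_identical:
  assumes "distributed M lborel X f" "distributed M lborel Y f"
  shows "distr M borel X = distr M borel Y"
proof -
  have "distr M lborel X = distr M lborel Y" using assms by (simp add: distributed_distr_eq_density)
  moreover have "distr M borel Z = distr M lborel Z" for Z :: "'a \<Rightarrow> 'b"
    by (rule distr_cong) auto
  ultimately show ?thesis by simp
qed

section \<open>Kernel integrals against a density: limits and second-order bias\<close>

lemma expectation_scaled_density:
  fixes X :: "'a \<Rightarrow> real" and \<phi> :: "real \<Rightarrow> real"
  assumes X: "distributed M lborel X (\<lambda>x. ennreal (f x))" and f: "\<And>x. 0 \<le> f x"
    and [measurable]: "\<phi> \<in> borel_measurable borel" and s: "0 < s"
  shows "expectation (\<lambda>\<omega>. \<phi> (X \<omega> / s)) = s * (\<integral>u. \<phi> u * f (s * u) \<partial>lborel)"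
proof -
  have "expectation (\<lambda>\<omega>. \<phi> (X \<omega> / s)) = (\<integral>x. f x * \<phi> (x / s) \<partial>lborel)"
    by (rule distributed_integral[OF X, symmetric]) (use f in auto)
  also have "\<dots> = \<bar>s\<bar> *\<^sub>R (\<integral>u. f (0 + s * u) * \<phi> ((0 + s * u) / s) \<partial>lborel)"
    by (rule lborel_integral_real_affine) (use s in auto)
  finally show ?thesis using s by (simp add: mult.commute)
qed

lemma distributed_density_measurable:
  assumes X: "distributed M lborel X (\<lambda>x. ennreal (f x))" and f: "\<And>x. 0 \<le> f x"
  shows "f \<in> borel_measurable borel"
  using distributed_real_measurable[OF _ X] f by auto

end

text \<open>Boundedness of \<open>f\<close> dominates and continuity at 0 gives the pointwise limit.
  It serves for both the kernel and its square.\<close>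

lemma approximate_identity:
  fixes f \<phi> :: "real \<Rightarrow> real" and s :: "nat \<Rightarrow> real"
  assumes [measurable]: "f \<in> borel_measurable borel" and f: "bounded (range f)" "isCont f 0"
    and \<phi>: "integrable lborel \<phi>" and s: "s \<longlonglongrightarrow> 0"
  shows "(\<lambda>n. \<integral>u. \<phi> u * f (s n * u) \<partial>lborel) \<longlonglongrightarrow> f 0 * (\<integral>u. \<phi> u \<partial>lborel)"
proof -
  from f(1) obtain B where B: "\<And>x. \<bar>f x\<bar> \<le> B" by (auto simp: bounded_iff)
  note [measurable] = borel_measurable_integrable[OF \<phi>]
  have "(\<lambda>n. \<integral>u. \<phi> u * f (s n * u) \<partial>lborel) \<longlonglongrightarrow> (\<integral>u. \<phi> u * f 0 \<partial>lborel)"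
  proof (rule integral_dominated_convergence[where w = "\<lambda>u. B * \<bar>\<phi> u\<bar>"])
    show "integrable lborel (\<lambda>u. B * \<bar>\<phi> u\<bar>)" using \<phi> by simp
    show "AE u in lborel. (\<lambda>n. \<phi> u * f (s n * u)) \<longlonglongrightarrow> \<phi> u * f 0"
    proof (intro AE_I2 tendsto_mult tendsto_const)
      fix u :: real
      have "(\<lambda>n. s n * u) \<longlonglongrightarrow> 0" using tendsto_mult[OF s tendsto_const] by simp
      then show "(\<lambda>n. f (s n * u)) \<longlonglongrightarrow> f 0" by (rule isCont_tendsto_compose[OF f(2)])
    qed
    show "AE u in lborel. norm (\<phi> u * f (s n * u)) \<le> B * \<bar>\<phi> u\<bar>" for n
      using B by (intro AE_I2) (simp add: abs_mult mult.commute[of B] mult_left_mono)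
  qed (measurable)
  then show ?thesis by (simp add: mult.commute)
qed

text \<open>Two controls of the Taylor remainder: the exact second-order limit at 0, and a global
  quadratic bound. The global one dominates in an integral over a kernel of possibly unbounded
  support; away from 0 it rests on boundedness of \<open>f\<close>, as smoothness is only
  local.\<close>

lemma taylor_second_order:
  fixes f :: "real \<Rightarrow> real"
  assumes d: "d > 0" and diff: "\<And>x. x \<in> {-d<..<d} \<Longrightarrow> f differentiable (at x) \<and> deriv f differentiable (at x)"
    and bd: "bounded (deriv (deriv f) ` {-d<..<d})" and cont: "isCont (deriv (deriv f)) 0"
    and f: "bounded (range f)"
  defines "R y \<equiv> f y - f 0 - deriv f 0 * y"
  shows "((\<lambda>y. R y / y\<^sup>2) \<longlongrightarrow> deriv (deriv f) 0 / 2) (at 0)" and "\<exists>C. \<forall>y. \<bar>R y\<bar> \<le> C * y\<^sup>2"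
proof -
  let ?f2 = "deriv (deriv f)"
  have ex: "\<exists>t. \<bar>t\<bar> \<le> \<bar>y\<bar> \<and> R y = ?f2 t / 2 * y\<^sup>2" if y: "\<bar>y\<bar> < d" for y
  proof -
    let ?diff = "\<lambda>m :: nat. if m = 0 then f else if m = 1 then deriv f else ?f2"
    have "\<exists>t. \<bar>t\<bar> \<le> \<bar>y\<bar> \<and> f y = (\<Sum>m<2. ?diff m 0 / fact m * y ^ m) + ?diff 2 t / fact 2 * y ^ 2"
    proof (rule Maclaurin_bi_le)
      show "\<forall>m t. m < 2 \<and> \<bar>t\<bar> \<le> \<bar>y\<bar> \<longrightarrow> DERIV (?diff m) t :> ?diff (Suc m) t"
      proof (intro allI impI, elim conjE)
        fix m :: nat and t assume "m < 2" "\<bar>t\<bar> \<le> \<bar>y\<bar>"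
        then have "t \<in> {-d<..<d}" using y by auto
        from diff[OF this] have "DERIV f t :> deriv f t" "DERIV (deriv f) t :> ?f2 t"
          by (auto simp: DERIV_deriv_iff_real_differentiable)
        with \<open>m < 2\<close> show "DERIV (?diff m) t :> ?diff (Suc m) t"
          by (cases m) (auto simp: less_Suc_eq)
      qed
    qed simp
    then show ?thesis by (auto simp: R_def numeral_2_eq_2)
  qed
  show "((\<lambda>y. R y / y\<^sup>2) \<longlongrightarrow> ?f2 0 / 2) (at 0)"
  proof (rule tendstoI)
    fix e :: real assume "e > 0"
    from cont \<open>e > 0\<close> obtain r where r: "r > 0" "\<And>t. \<bar>t\<bar> < r \<Longrightarrow> \<bar>?f2 t - ?f2 0\<bar> < e"
      unfolding continuous_at_eps_delta by (auto simp: dist_real_def)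
    have "dist (R y / y\<^sup>2) (?f2 0 / 2) < e" if "y \<noteq> 0" "\<bar>y\<bar> < min d r" for y
    proof -
      from ex[of y] that obtain t where t: "\<bar>t\<bar> \<le> \<bar>y\<bar>" "R y = ?f2 t / 2 * y\<^sup>2" by auto
      have "\<bar>?f2 t - ?f2 0\<bar> < e" using t(1) r(2)[of t] that by auto
      moreover have "R y / y\<^sup>2 = ?f2 t / 2" using t(2) that by simp
      ultimately show ?thesis using \<open>e > 0\<close> unfolding dist_real_def by linarith
    qed
    then show "\<forall>\<^sub>F y in at 0. dist (R y / y\<^sup>2) (?f2 0 / 2) < e"
      using d r(1) unfolding eventually_at
      by (intro exI[of _ "min d r"]) (auto simp: dist_real_def)
  qed
  from bd obtain B where "\<forall>x\<in>{-d<..<d}. \<bar>?f2 x\<bar> \<le> B" by (auto simp: bounded_iff)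
  then have B: "\<And>x. x \<in> {-d<..<d} \<Longrightarrow> \<bar>?f2 x\<bar> \<le> B" by blast
  from f obtain F where F: "\<And>x. \<bar>f x\<bar> \<le> F" by (auto simp: bounded_iff)
  have F0: "0 \<le> F" using F[of 0] by linarith
  show "\<exists>C. \<forall>y. \<bar>R y\<bar> \<le> C * y\<^sup>2"
  proof (intro exI allI)
    fix y
    \<comment> \<open>The first summand covers \<open>\<bar>y\<bar> < d\<close> through the bound on
      the second derivative. The others cover \<open>d \<le> \<bar>y\<bar>\<close>, where 1 is at
      most \<open>y\<^sup>2 / d\<^sup>2\<close> and \<open>\<bar>y\<bar>\<close> at most
      \<open>y\<^sup>2 / d\<close>.\<close>
    let ?C = "\<bar>B\<bar> / 2 + (2 * F / d\<^sup>2 + \<bar>deriv f 0\<bar> / d)"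
    show "\<bar>R y\<bar> \<le> ?C * y\<^sup>2"
    proof (cases "\<bar>y\<bar> < d")
      case True
      with ex obtain t where t: "\<bar>t\<bar> \<le> \<bar>y\<bar>" "R y = ?f2 t / 2 * y\<^sup>2" by blast
      have "\<bar>?f2 t\<bar> \<le> B" using t True by (intro B) auto
      then have "\<bar>R y\<bar> \<le> \<bar>B\<bar> / 2 * y\<^sup>2" unfolding t(2) abs_mult by (intro mult_mono) auto
      also have "\<dots> \<le> ?C * y\<^sup>2" using F0 d by (intro mult_right_mono) auto
      finally show ?thesis .
    next
      case False
      then have yd: "d \<le> \<bar>y\<bar>" by simp
      have "2 * F * d\<^sup>2 \<le> 2 * F * y\<^sup>2"
        using F0 power_mono[OF yd, of 2] d by (intro mult_left_mono) auto
      then have 1: "2 * F \<le> 2 * F / d\<^sup>2 * y\<^sup>2" using d by (simp add: field_simps)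
      have "\<bar>y\<bar> * d \<le> \<bar>y\<bar> * \<bar>y\<bar>" using yd by (intro mult_left_mono) auto
      then have "\<bar>deriv f 0\<bar> * (\<bar>y\<bar> * d) \<le> \<bar>deriv f 0\<bar> * y\<^sup>2"
        by (intro mult_left_mono) (auto simp: power2_eq_square)
      then have 2: "\<bar>deriv f 0\<bar> * \<bar>y\<bar> \<le> \<bar>deriv f 0\<bar> / d * y\<^sup>2" using d by (simp add: field_simps)
      have "\<bar>R y\<bar> \<le> \<bar>f y\<bar> + \<bar>f 0\<bar> + \<bar>deriv f 0\<bar> * \<bar>y\<bar>"
        unfolding R_def abs_mult[symmetric] by linarith
      also have "\<dots> \<le> 2 * F + \<bar>deriv f 0\<bar> * \<bar>y\<bar>" using F[of y] F[of 0] by simp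
      also have "\<dots> \<le> 2 * F / d\<^sup>2 * y\<^sup>2 + \<bar>deriv f 0\<bar> / d * y\<^sup>2" using 1 2 by linarith
      also have "\<dots> \<le> ?C * y\<^sup>2" by (simp add: distrib_right)
      finally show ?thesis .
    qed
  qed
qed

text \<open>Unit mass of \<open>K\<close> cancels \<open>f 0\<close> and evenness cancels the linear
  term, so the scaled Taylor remainder alone survives and dominated convergence applies to
  it.\<close>

lemma kernel_bias_second_order:
  fixes f K :: "real \<Rightarrow> real" and s :: "nat \<Rightarrow> real"
  assumes [measurable]: "f \<in> borel_measurable borel" "K \<in> borel_measurable borel"
    and f: "bounded (range f)"
    and d: "d > 0" "\<And>x. x \<in> {-d<..<d} \<Longrightarrow> f differentiable (at x) \<and> deriv f differentiable (at x)"
      "bounded (deriv (deriv f) ` {-d<..<d})" "isCont (deriv (deriv f)) 0"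
    and K: "\<And>u. 0 \<le> K u" "\<And>u. K (- u) = K u" "has_bochner_integral lborel K 1"
      "integrable lborel (\<lambda>u. u\<^sup>2 * K u)"
    and s: "s \<longlonglongrightarrow> 0" "\<And>n. n \<ge> 1 \<Longrightarrow> s n > 0"
  shows "(\<lambda>n. ((\<integral>u. K u * f (s n * u) \<partial>lborel) - f 0) / (s n)\<^sup>2) \<longlonglongrightarrow>
    deriv (deriv f) 0 / 2 * (\<integral>u. u\<^sup>2 * K u \<partial>lborel)"
proof -
  define R where "R y = f y - f 0 - deriv f 0 * y" for y
  note taylor = taylor_second_order[OF d(1,2,3,4) f, folded R_def]
  from taylor(2) obtain C where C: "\<And>y. \<bar>R y\<bar> \<le> C * y\<^sup>2" by blast
  have [measurable]: "R \<in> borel_measurable borel" unfolding R_def by measurable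
  have K1: "integrable lborel K" "(\<integral>u. K u \<partial>lborel) = 1"
    using K(3) by (auto simp: has_bochner_integral_iff)
  have Ku: "integrable lborel (\<lambda>u. K u * u)"
  proof (rule Bochner_Integration.integrable_bound)
    show "integrable lborel (\<lambda>u. K u + u\<^sup>2 * K u)" using K1 K(4) by simp
    have "\<bar>u\<bar> \<le> 1 + u\<^sup>2" for u :: real
      using zero_le_power2[of "\<bar>u\<bar> - 1"] abs_ge_zero[of u] by (simp add: power2_eq_square algebra_simps)
    then have le: "K u * \<bar>u\<bar> \<le> K u * (1 + u\<^sup>2)" for u using K(1) by (intro mult_left_mono) auto
    show "AE u in lborel. norm (K u * u) \<le> norm (K u + u\<^sup>2 * K u)"
    proof (rule AE_I2)
      fix u
      have "norm (K u * u) = K u * \<bar>u\<bar>" using K(1)[of u] by (simp add: abs_mult)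
      also have "\<dots> \<le> K u * (1 + u\<^sup>2)" by (rule le)
      also have "\<dots> = K u + u\<^sup>2 * K u" by (simp only: distrib_left mult_1_right mult.commute)
      also have "\<dots> \<le> norm (K u + u\<^sup>2 * K u)" by simp
      finally show "norm (K u * u) \<le> norm (K u + u\<^sup>2 * K u)" .
    qed
  qed (measurable)
  have odd: "(\<integral>u. K u * u \<partial>lborel) = 0"
  proof -
    have "(\<integral>u. K u * u \<partial>lborel) = \<bar>-1\<bar> *\<^sub>R (\<integral>u. K (0 + (-1) * u) * (0 + (-1) * u) \<partial>lborel)"
      by (rule lborel_integral_real_affine) simp
    then show ?thesis by (simp add: K(2))
  qed
  from f obtain F where F: "\<And>x. \<bar>f x\<bar> \<le> F" by (auto simp: bounded_iff)
  have Kf: "integrable lborel (\<lambda>u. K u * f (s n * u))" for n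
  proof (rule Bochner_Integration.integrable_bound)
    show "integrable lborel (\<lambda>u. F * K u)" using K1 by simp
    show "AE u in lborel. norm (K u * f (s n * u)) \<le> norm (F * K u)"
      using F K(1) order_trans[OF abs_ge_zero F]
      by (intro AE_I2) (simp add: abs_mult mult.commute[of F] mult_left_mono)
  qed (measurable)
  have eq: "((\<integral>u. K u * f (s n * u) \<partial>lborel) - f 0) / (s n)\<^sup>2 = (\<integral>u. K u * (R (s n * u) / (s n)\<^sup>2) \<partial>lborel)" for n
  proof -
    have "(\<integral>u. K u * R (s n * u) \<partial>lborel) =
        (\<integral>u. K u * f (s n * u) - f 0 * K u - deriv f 0 * s n * (K u * u) \<partial>lborel)"
      by (rule Bochner_Integration.integral_cong) (auto simp: R_def algebra_simps)
    also have "\<dots> = (\<integral>u. K u * f (s n * u) \<partial>lborel) - f 0"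
      using Kf Ku K1 by (simp add: odd)
    finally have "(\<integral>u. K u * f (s n * u) \<partial>lborel) - f 0 = (\<integral>u. K u * R (s n * u) \<partial>lborel)" ..
    then show ?thesis by simp
  qed
  have "(\<lambda>n. \<integral>u. K u * (R (s n * u) / (s n)\<^sup>2) \<partial>lborel) \<longlonglongrightarrow> (\<integral>u. deriv (deriv f) 0 / 2 * (u\<^sup>2 * K u) \<partial>lborel)"
  proof (rule integral_dominated_convergence[where w = "\<lambda>u. \<bar>C\<bar> * (u\<^sup>2 * K u)"])
    show "integrable lborel (\<lambda>u. \<bar>C\<bar> * (u\<^sup>2 * K u))" using K(4) by simp
    show "AE u in lborel. (\<lambda>n. K u * (R (s n * u) / (s n)\<^sup>2)) \<longlonglongrightarrow> deriv (deriv f) 0 / 2 * (u\<^sup>2 * K u)"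
    proof (rule AE_I2)
      fix u :: real
      show "(\<lambda>n. K u * (R (s n * u) / (s n)\<^sup>2)) \<longlonglongrightarrow> deriv (deriv f) 0 / 2 * (u\<^sup>2 * K u)"
      \<comment> \<open>The Taylor limit is over a punctured neighbourhood, which
        \<open>s n * u\<close> enters only for nonzero \<open>u\<close>; for \<open>u = 0\<close>
        both sides are 0.\<close>
      proof (cases "u = 0")
        case False
        have "(\<lambda>n. s n * u) \<longlonglongrightarrow> 0" using tendsto_mult[OF s(1) tendsto_const] by simp
        moreover have "\<forall>\<^sub>F n in sequentially. s n * u \<noteq> 0"
          using eventually_ge_at_top[of 1] by eventually_elim (use s(2) False in force)
        ultimately have "filterlim (\<lambda>n. s n * u) (at 0) sequentially"
          by (simp add: filterlim_at)
        from filterlim_compose[OF taylor(1) this]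
        have "(\<lambda>n. (K u * u\<^sup>2) * (R (s n * u) / (s n * u)\<^sup>2)) \<longlonglongrightarrow> (K u * u\<^sup>2) * (deriv (deriv f) 0 / 2)"
          by (intro tendsto_mult tendsto_const)
        moreover have "(K u * u\<^sup>2) * (R (s n * u) / (s n * u)\<^sup>2) = K u * (R (s n * u) / (s n)\<^sup>2)" for n
          using False by (simp add: power_mult_distrib)
        ultimately show ?thesis by (simp add: mult_ac)
      qed (simp add: R_def)
    qed
    show "AE u in lborel. norm (K u * (R (s n * u) / (s n)\<^sup>2)) \<le> \<bar>C\<bar> * (u\<^sup>2 * K u)" for n
    proof (rule AE_I2)
      fix u
      have "\<bar>R (s n * u)\<bar> \<le> \<bar>C\<bar> * (s n * u)\<^sup>2"
        by (rule order_trans[OF C mult_right_mono]) auto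
      then have "\<bar>R (s n * u) / (s n)\<^sup>2\<bar> \<le> \<bar>C\<bar> * u\<^sup>2"
        by (cases "s n = 0") (simp_all add: power_mult_distrib divide_le_eq mult_ac)
      then have "K u * \<bar>R (s n * u) / (s n)\<^sup>2\<bar> \<le> K u * (\<bar>C\<bar> * u\<^sup>2)"
        using K(1) by (intro mult_left_mono)
      then show "norm (K u * (R (s n * u) / (s n)\<^sup>2)) \<le> \<bar>C\<bar> * (u\<^sup>2 * K u)"
        using K(1) by (simp add: abs_mult mult_ac)
    qed
  qed (measurable)
  then show ?thesis unfolding eq by simp
qed

context prob_space
begin

text \<open>Evenness of \<open>K\<close> removes the sign in \<open>0 - V i\<close>; the
  substitution factor \<open>l * h n\<close> then cancels the normalisation.\<close>

lemma dens_hat_mean: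
  fixes V :: "nat \<Rightarrow> 'a \<Rightarrow> real"
  assumes V: "\<And>i. distributed M lborel (V i) (\<lambda>x. ennreal (f x))" and f: "\<And>x. 0 \<le> f x"
    and K[measurable]: "K \<in> borel_measurable borel" and Kb: "bounded (range K)" and Ks: "\<And>u. K (- u) = K u"
    and "n \<ge> 1" "0 < l" "0 < h n"
  shows "expectation (\<lambda>\<omega>. dens_hat K V h l n 0 \<omega>) = (\<integral>u. K u * f (l * h n * u) \<partial>lborel)"
proof -
  have V_m[measurable]: "V i \<in> borel_measurable M" for i
    using distributed_measurable[OF V[of i]] by simp
  have s: "0 < l * h n" using assms by simp
  from Kb obtain B where B: "\<And>u. \<bar>K u\<bar> \<le> B" by (auto simp: bounded_iff)
  have int: "integrable M (\<lambda>\<omega>. K (V i \<omega> / (l * h n)))" for i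
    by (rule integrable_const_bound[where B = B]) (use B in auto)
  have "expectation (\<lambda>\<omega>. dens_hat K V h l n 0 \<omega>) =
      1 / (real n * l * h n) * expectation (\<lambda>\<omega>. \<Sum>i<n. K (V i \<omega> / (l * h n)))"
    by (simp add: dens_hat_def Ks)
  also have "expectation (\<lambda>\<omega>. \<Sum>i<n. K (V i \<omega> / (l * h n))) = (\<Sum>i<n. expectation (\<lambda>\<omega>. K (V i \<omega> / (l * h n))))"
    by (rule Bochner_Integration.integral_sum) (rule int)
  also have "\<dots> = (\<Sum>i<n. l * h n * (\<integral>u. K u * f (l * h n * u) \<partial>lborel))"
    by (intro sum.cong refl expectation_scaled_density V f K s)
  also have "1 / (real n * l * h n) * \<dots> = (\<integral>u. K u * f (l * h n * u) \<partial>lborel)"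
    using assms by simp
  finally show ?thesis .
qed

text \<open>Makes the scaling matrix \<open>A n\<close> tend to the identity.\<close>

lemma dens_hat_mean_tendsto:
  fixes V :: "nat \<Rightarrow> 'a \<Rightarrow> real"
  assumes V: "\<And>i. distributed M lborel (V i) (\<lambda>x. ennreal (f x))"
    and f: "\<And>x. 0 \<le> f x" "bounded (range f)" "isCont f 0" "f 0 > 0"
    and K: "K \<in> borel_measurable borel" "bounded (range K)" "\<And>u. K (- u) = K u" "has_bochner_integral lborel K 1"
    and h: "h \<longlonglongrightarrow> 0" "\<And>n. n \<ge> 1 \<Longrightarrow> h n > 0" and l: "0 < l"
  shows "(\<lambda>n. expectation (\<lambda>\<omega>. dens_hat K V h l n 0 \<omega>) / f 0) \<longlonglongrightarrow> 1"
proof -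
  have K1: "integrable lborel K" "(\<integral>u. K u \<partial>lborel) = 1"
    using K(4) by (auto simp: has_bochner_integral_iff)
  have "(\<lambda>n. l * h n) \<longlonglongrightarrow> 0" using tendsto_mult[OF tendsto_const h(1), of l] by simp
  from approximate_identity[OF distributed_density_measurable[OF V f(1)] f(2,3) K1(1) this]
  have "(\<lambda>n. (\<integral>u. K u * f (l * h n * u) \<partial>lborel) / f 0) \<longlonglongrightarrow> f 0 * 1 / f 0"
    using f(4) by (intro tendsto_divide tendsto_const) (auto simp: K1)
  then have "(\<lambda>n. (\<integral>u. K u * f (l * h n * u) \<partial>lborel) / f 0) \<longlonglongrightarrow> 1" using f(4) by simp
  then show ?thesis
  proof (rule Lim_transform_eventually)
    show "\<forall>\<^sub>F n in sequentially. (\<integral>u. K u * f (l * h n * u) \<partial>lborel) / f 0 =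
        expectation (\<lambda>\<omega>. dens_hat K V h l n 0 \<omega>) / f 0"
      using eventually_ge_at_top[of 1]
      by eventually_elim (subst dens_hat_mean[OF V f(1) K(1,2,3)], use l h(2) in auto)
  qed
qed

text \<open>The origin of \<kappa> and \<Lambda>: the bias at bandwidth \<open>l * h n\<close> is
  quadratic in that bandwidth, and normalising by \<open>(h n)\<^sup>2\<close> leaves the factor
  \<open>l\<^sup>2\<close>.\<close>

lemma dens_hat_bias_tendsto:
  fixes V :: "nat \<Rightarrow> 'a \<Rightarrow> real"
  assumes V: "\<And>i. distributed M lborel (V i) (\<lambda>x. ennreal (f x))"
    and f: "\<And>x. 0 \<le> f x" "bounded (range f)" "f 0 > 0"
    and d: "d > 0" "\<And>x. x \<in> {-d<..<d} \<Longrightarrow> f differentiable (at x) \<and> deriv f differentiable (at x)"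
      "bounded (deriv (deriv f) ` {-d<..<d})" "isCont (deriv (deriv f)) 0"
    and K: "K \<in> borel_measurable borel" "bounded (range K)" "\<And>u. 0 \<le> K u" "\<And>u. K (- u) = K u"
      "has_bochner_integral lborel K 1" "integrable lborel (\<lambda>u. u\<^sup>2 * K u)"
    and h: "h \<longlonglongrightarrow> 0" "\<And>n. n \<ge> 1 \<Longrightarrow> h n > 0" and l: "0 < l"
  shows "(\<lambda>n. (expectation (\<lambda>\<omega>. dens_hat K V h l n 0 \<omega>) / f 0 - 1) / (h n)\<^sup>2) \<longlonglongrightarrow>
    deriv (deriv f) 0 * (\<integral>u. u\<^sup>2 * K u \<partial>lborel) / (2 * f 0) * l\<^sup>2"
proof -
  let ?s = "\<lambda>n. l * h n"
  have s: "?s \<longlonglongrightarrow> 0" using tendsto_mult[OF tendsto_const h(1), of l] by simp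
  have s': "0 < ?s n" if "n \<ge> 1" for n using h(2)[OF that] l by simp
  have "(\<lambda>n. ((\<integral>u. K u * f (?s n * u) \<partial>lborel) - f 0) / (?s n)\<^sup>2) \<longlonglongrightarrow>
      deriv (deriv f) 0 / 2 * (\<integral>u. u\<^sup>2 * K u \<partial>lborel)"
    by (rule kernel_bias_second_order[OF distributed_density_measurable[OF V f(1)] K(1) f(2) d K(3,4,5,6) s s'])
  then have "(\<lambda>n. l\<^sup>2 / f 0 * (((\<integral>u. K u * f (?s n * u) \<partial>lborel) - f 0) / (?s n)\<^sup>2)) \<longlonglongrightarrow>
      l\<^sup>2 / f 0 * (deriv (deriv f) 0 / 2 * (\<integral>u. u\<^sup>2 * K u \<partial>lborel))"
    by (intro tendsto_mult tendsto_const)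
  then have "(\<lambda>n. l\<^sup>2 / f 0 * (((\<integral>u. K u * f (?s n * u) \<partial>lborel) - f 0) / (?s n)\<^sup>2)) \<longlonglongrightarrow>
      deriv (deriv f) 0 * (\<integral>u. u\<^sup>2 * K u \<partial>lborel) / (2 * f 0) * l\<^sup>2"
    by (simp add: field_simps)
  then show ?thesis
  proof (rule Lim_transform_eventually)
    show "\<forall>\<^sub>F n in sequentially. l\<^sup>2 / f 0 * (((\<integral>u. K u * f (?s n * u) \<partial>lborel) - f 0) / (?s n)\<^sup>2) =
        (expectation (\<lambda>\<omega>. dens_hat K V h l n 0 \<omega>) / f 0 - 1) / (h n)\<^sup>2"
      using eventually_ge_at_top[of 1]
    proof eventually_elim
      case (elim n)
      have "0 < h n" using elim h(2) by simp
      have "expectation (\<lambda>\<omega>. dens_hat K V h l n 0 \<omega>) = (\<integral>u. K u * f (?s n * u) \<partial>lborel)"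
        by (rule dens_hat_mean[OF V f(1) K(1,2,4)]) (use l elim h(2) in auto)
      then show ?case using l f(3) \<open>0 < h n\<close> by (simp add: power_mult_distrib field_simps)
    qed
  qed
qed

text \<open>The kernel weight is split as \<open>m n\<close> plus \<open>\<eta> n\<close>. The
  constant part reproduces the plain average of \<open>U\<close>, controlled by
  \<open>scaled_deviation_tendsto_0\<close>; the centred part is the weighted sum treated by
  \<open>char_tendsto_weighted_sum\<close>.\<close>

lemma mean_hat_char_tendsto:
  fixes V :: "nat \<Rightarrow> 'a \<Rightarrow> real" and U :: "nat \<Rightarrow> 'a \<Rightarrow> real ^ 'n"
    and Z :: "nat \<Rightarrow> 'a \<Rightarrow> 'c :: topological_space"
  assumes V: "indep_vars (\<lambda>_. borel) V UNIV" "\<And>i. distributed M lborel (V i) (\<lambda>x. ennreal (f x))"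
    and ind: "indep_set
       (sets (vimage_algebra (space M) (\<lambda>\<omega> i. V i \<omega>) (\<Pi>\<^sub>M i\<in>(UNIV :: nat set). borel)))
       (sets (vimage_algebra (space M) (\<lambda>\<omega> i. U i \<omega>) (\<Pi>\<^sub>M i\<in>(UNIV :: nat set). borel)))"
    and f: "\<And>x. 0 \<le> f x" "bounded (range f)" "isCont f 0" "f 0 > 0"
    and K: "K \<in> borel_measurable borel" "\<And>u. 0 \<le> K u" "bounded (range K)"
      "has_bochner_integral lborel K 1" "integrable lborel (\<lambda>u. (K u)\<^sup>2)"
    and h: "\<And>n. n \<ge> 1 \<Longrightarrow> h n > 0" "h \<longlonglongrightarrow> 0" "filterlim (\<lambda>n. real n * h n) at_top sequentially"
    and Z: "stationary_seq M Z" "ergodic_seq M Z"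
    and U: "\<And>i \<omega>. U i \<omega> = u (Z i \<omega>)" and u[measurable]: "u \<in> borel_measurable borel"
    and sq: "integrable M (\<lambda>\<omega>. (norm (U 0 \<omega>))\<^sup>2)"
    and lam: "(\<lambda>n. real n * h n *
       lambda_max (cov_matrix M (\<lambda>\<omega>. (1 / real n) *\<^sub>R (\<Sum>i<n. U i \<omega>)))) \<longlonglongrightarrow> 0"
  shows "(\<lambda>n. CLINT \<omega>|M. iexp (t \<bullet> (sqrt (real n * h n) *\<^sub>R (mean_hat M K V h U n \<omega> - expectation (U 0)))))
    \<longlonglongrightarrow> exp (- (((\<integral>u. (K u)\<^sup>2 \<partial>lborel) / f 0) * (t \<bullet> (expectation (\<lambda>\<omega>. outer (U 0 \<omega>) (U 0 \<omega>)) *v t))) / 2)"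
proof -
  note [measurable] = stationary_seqD(1)[OF Z(1)] K(1)
  have U_m[measurable]: "U i \<in> borel_measurable M" for i unfolding U by measurable
  have V_m[measurable]: "V i \<in> borel_measurable M" for i
    using V(1) by (simp add: indep_vars_def)
  have f_m: "f \<in> borel_measurable borel" by (rule distributed_density_measurable[OF V(2) f(1)])
  let ?c2 = "\<integral>u. (K u)\<^sup>2 \<partial>lborel"
  have K1: "integrable lborel K" "(\<integral>u. K u \<partial>lborel) = 1"
    using K(4) by (auto simp: has_bochner_integral_iff)
  from K(3) obtain B where B: "\<And>u. \<bar>K u\<bar> \<le> B" by (auto simp: bounded_iff)
  have B0: "0 \<le> B" using B[of 0] by linarith
  define m where "m n = expectation (\<lambda>\<omega>. K (V 0 \<omega> / h n))" for n
  define q where "q n = expectation (\<lambda>\<omega>. (K (V 0 \<omega> / h n))\<^sup>2)" for n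
  have m_eq: "m n / h n = (\<integral>u. K u * f (h n * u) \<partial>lborel)" if "n \<ge> 1" for n
    unfolding m_def expectation_scaled_density[OF V(2) f(1) K(1) h(1)[OF that]] using h(1)[OF that] by simp
  have K2_m: "(\<lambda>u. (K u)\<^sup>2) \<in> borel_measurable borel" by measurable
  have q_eq: "q n / h n = (\<integral>u. (K u)\<^sup>2 * f (h n * u) \<partial>lborel)" if "n \<ge> 1" for n
    unfolding q_def expectation_scaled_density[OF V(2) f(1) K2_m h(1)[OF that]] using h(1)[OF that] by simp
  have m_lim: "(\<lambda>n. m n / h n) \<longlonglongrightarrow> f 0"
  proof (rule Lim_transform_eventually)
    show "(\<lambda>n. \<integral>u. K u * f (h n * u) \<partial>lborel) \<longlonglongrightarrow> f 0"
      using approximate_identity[OF f_m f(2,3) K1(1) h(2)] by (simp add: K1)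
    show "\<forall>\<^sub>F n in sequentially. (\<integral>u. K u * f (h n * u) \<partial>lborel) = m n / h n"
      using eventually_ge_at_top[of 1] by eventually_elim (simp add: m_eq)
  qed
  have q_lim: "(\<lambda>n. q n / h n) \<longlonglongrightarrow> f 0 * ?c2"
  proof (rule Lim_transform_eventually)
    show "(\<lambda>n. \<integral>u. (K u)\<^sup>2 * f (h n * u) \<partial>lborel) \<longlonglongrightarrow> f 0 * ?c2"
      by (rule approximate_identity[OF f_m f(2,3) K(5) h(2)])
    show "\<forall>\<^sub>F n in sequentially. (\<integral>u. (K u)\<^sup>2 * f (h n * u) \<partial>lborel) = q n / h n"
      using eventually_ge_at_top[of 1] by eventually_elim (simp add: q_eq)
  qed
  have m_pos: "\<forall>\<^sub>F n in sequentially. 0 < m n / h n"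
    using order_tendstoD(1)[OF m_lim f(4)] .
  have nh_pos: "\<forall>\<^sub>F n in sequentially. 0 < real n * h n"
    using h(3) by (simp add: filterlim_at_top_dense)
  define \<eta> where "\<eta> n x = K (x / h n) - m n" for n x
  \<comment> \<open>The normalisation of the centred sum. As \<open>m n\<close> is of order
    \<open>h n\<close>, it is of order 1 / sqrt(n h) and tends to 0.\<close>
  define \<theta> where "\<theta> n = sqrt (real n * h n) / (real n * m n)" for n
  have int_K: "integrable M (\<lambda>\<omega>. K (V 0 \<omega> / h n))" for n
    by (rule integrable_const_bound[where B = B]) (use B in auto)
  have B2: "(K x)\<^sup>2 \<le> B\<^sup>2" for x using power_mono[OF B[of x], of 2] by simp
  have int_K2: "integrable M (\<lambda>\<omega>. (K (V 0 \<omega> / h n))\<^sup>2)" for n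
    by (rule integrable_const_bound[where B = "B\<^sup>2"]) (use B2 in auto)
  have m_le: "\<bar>m n\<bar> \<le> B" for n
  proof -
    have "\<bar>m n\<bar> \<le> expectation (\<lambda>\<omega>. \<bar>K (V 0 \<omega> / h n)\<bar>)" unfolding m_def by (rule integral_abs_bound)
    also have "\<dots> \<le> expectation (\<lambda>\<omega>. B)" using int_K B by (intro integral_mono integrable_abs) auto
    finally show ?thesis by (simp add: prob_space)
  qed
  have \<eta>_var: "expectation (\<lambda>\<omega>. (\<eta> n (V 0 \<omega>))\<^sup>2) = q n - (m n)\<^sup>2" for n
  proof -
    have "(\<lambda>\<omega>. (\<eta> n (V 0 \<omega>))\<^sup>2) = (\<lambda>\<omega>. (K (V 0 \<omega> / h n))\<^sup>2 - 2 * m n * K (V 0 \<omega> / h n) + (m n)\<^sup>2)"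
      by (simp add: \<eta>_def fun_eq_iff power2_diff mult_ac)
    moreover have "expectation (\<lambda>\<omega>. (K (V 0 \<omega> / h n))\<^sup>2 - 2 * m n * K (V 0 \<omega> / h n) + (m n)\<^sup>2) =
        q n - 2 * m n * m n + (m n)\<^sup>2"
      using int_K[of n] int_K2[of n] by (simp add: q_def[symmetric] m_def[symmetric] prob_space)
    ultimately show ?thesis by (simp add: power2_eq_square)
  qed
  have \<theta>_lim: "\<theta> \<longlonglongrightarrow> 0"
  proof (rule Lim_transform_eventually)
    have "filterlim (\<lambda>n. sqrt (real n * h n)) at_top sequentially"
      by (rule filterlim_compose[OF sqrt_at_top h(3)])
    then have "(\<lambda>n. inverse (sqrt (real n * h n))) \<longlonglongrightarrow> 0"
      by (rule tendsto_inverse_0_at_top)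
    then have "(\<lambda>n. inverse (sqrt (real n * h n)) / (m n / h n)) \<longlonglongrightarrow> 0 / f 0"
      using m_lim f(4) by (intro tendsto_divide) auto
    then show "(\<lambda>n. inverse (sqrt (real n * h n)) / (m n / h n)) \<longlonglongrightarrow> 0" by simp
    show "\<forall>\<^sub>F n in sequentially. inverse (sqrt (real n * h n)) / (m n / h n) = \<theta> n"
      using nh_pos eventually_ge_at_top[of 1]
    proof eventually_elim
      case (elim n)
      have inv_sq: "s / (s * s) = inverse s" if "s \<noteq> 0" for s :: real
        using that by (simp add: field_simps)
      have "sqrt (real n * h n) / (real n * h n) = sqrt (real n * h n) / (sqrt (real n * h n) * sqrt (real n * h n))"
        using elim(1) by (simp only: real_sqrt_mult_self abs_of_pos)
      also have "\<dots> = inverse (sqrt (real n * h n))"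
        by (rule inv_sq) (use elim(1) in \<open>auto simp: zero_less_mult_iff\<close>)
      finally have "inverse (sqrt (real n * h n)) = sqrt (real n * h n) / (real n * h n)" ..
      then show ?case using elim h(1)[of n] by (simp add: \<theta>_def)
    qed
  qed
  \<comment> \<open>The squared mean is smaller than the second moment by a factor of order
    \<open>h n\<close>, so the limit is f(0) c_2 / f(0)^2, the source of the constant c_2 /
    f(0).\<close>
  have var_lim: "(\<lambda>n. real n * (\<theta> n)\<^sup>2 * expectation (\<lambda>\<omega>. (\<eta> n (V 0 \<omega>))\<^sup>2)) \<longlonglongrightarrow> ?c2 / f 0"
  proof (rule Lim_transform_eventually)
    have "(\<lambda>n. (q n / h n - h n * (m n / h n)\<^sup>2) / (m n / h n)\<^sup>2) \<longlonglongrightarrow> (f 0 * ?c2 - 0 * (f 0)\<^sup>2) / (f 0)\<^sup>2"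
      using f(4) by (intro tendsto_intros q_lim m_lim h(2)) auto
    then show "(\<lambda>n. (q n / h n - h n * (m n / h n)\<^sup>2) / (m n / h n)\<^sup>2) \<longlonglongrightarrow> ?c2 / f 0"
      using f(4) by (simp add: power2_eq_square)
    show "\<forall>\<^sub>F n in sequentially. (q n / h n - h n * (m n / h n)\<^sup>2) / (m n / h n)\<^sup>2 =
        real n * (\<theta> n)\<^sup>2 * expectation (\<lambda>\<omega>. (\<eta> n (V 0 \<omega>))\<^sup>2)"
      using nh_pos eventually_ge_at_top[of 1] m_pos
    proof eventually_elim
      case (elim n)
      have hn: "0 < h n" "0 < real n" using elim h(1)[of n] by auto
      then have mn: "0 < m n" using elim by (simp add: zero_less_divide_iff)
      have "(\<theta> n)\<^sup>2 = real n * h n / (real n * m n)\<^sup>2"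
        using elim by (simp add: \<theta>_def power_divide)
      then show ?case using hn mn unfolding \<eta>_var
        by (simp add: field_simps power2_eq_square)
    qed
  qed
  let ?E = "expectation (U 0)"
  define N where "N n \<omega> = (\<Sum>i<n. (\<theta> n * \<eta> n (V i \<omega>)) *\<^sub>R U i \<omega>)" for n \<omega>
  have [measurable]: "\<eta> n \<in> borel_measurable borel" for n unfolding \<eta>_def by measurable
  have [measurable]: "N n \<in> borel_measurable M" for n unfolding N_def by measurable
  have N_char: "(\<lambda>n. CLINT \<omega>|M. iexp (t \<bullet> N n \<omega>)) \<longlonglongrightarrow>
      exp (- ((?c2 / f 0) * (t \<bullet> (expectation (\<lambda>\<omega>. outer (U 0 \<omega>) (U 0 \<omega>)) *v t))) / 2)"
  proof -
    have "(\<lambda>n. CLINT \<omega>|M. iexp (\<Sum>i<n. \<theta> n * (\<lambda>x. t \<bullet> x) (U i \<omega>) * \<eta> n (V i \<omega>))) \<longlonglongrightarrow>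
        exp (- (?c2 / f 0 * expectation (\<lambda>\<omega>. ((\<lambda>x. t \<bullet> x) (U 0 \<omega>))\<^sup>2) / 2))"
    proof (rule char_tendsto_weighted_sum[OF V(1) distributed_identical[OF V(2) V(2)] ind Z U u _ _ _ _ _ \<theta>_lim var_lim])
      show "integrable M (\<lambda>\<omega>. (t \<bullet> U 0 \<omega>)\<^sup>2)" by (rule second_moment_integrable(4)[OF U_m sq])
      show "\<bar>\<eta> n x\<bar> \<le> B + B" for n x
        using B[of "x / h n"] m_le[of n] unfolding \<eta>_def by linarith
      show "expectation (\<lambda>\<omega>. \<eta> n (V 0 \<omega>)) = 0" for n
        using int_K[of n] by (simp add: \<eta>_def m_def[symmetric] prob_space)
    qed measurable
    moreover have "t \<bullet> N n \<omega> = (\<Sum>i<n. \<theta> n * (t \<bullet> U i \<omega>) * \<eta> n (V i \<omega>))" for n \<omega>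
      by (simp add: N_def inner_sum_right mult_ac)
    ultimately show ?thesis
      unfolding second_moment_matrix(1)[OF U_m sq] by simp
  qed
  have int_U: "integrable M (U i)" and int_Usq: "integrable M (\<lambda>\<omega>. (norm (U i \<omega>))\<^sup>2)"
    and exp_U: "expectation (U i) = ?E" for i
  proof -
    show 1: "integrable M (\<lambda>\<omega>. (norm (U i \<omega>))\<^sup>2)" for i
      using stationary_seq_integral(2)[OF Z(1), of "\<lambda>z. (norm (u z))\<^sup>2" i] sq unfolding U by simp
    show 2: "integrable M (U i)" for i by (rule second_moment_integrable(1)[OF U_m 1])
    show "expectation (U i) = ?E"
    proof (rule vec_eq_iff[THEN iffD2], rule allI)
      fix k
      show "expectation (U i) $ k = ?E $ k"
        using stationary_seq_integral(1)[OF Z(1), of "\<lambda>z. u z $ k" i]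
        unfolding integral_vec_nth[OF 2] U by simp
    qed
  qed
  define W where "W n \<omega> = (1 / real n) *\<^sub>R (\<Sum>i<n. U i \<omega>)" for n \<omega>
  have W_m[measurable]: "W n \<in> borel_measurable M" for n unfolding W_def by measurable
  have exp_W: "expectation (W n) = ?E" if "n \<ge> 1" for n
  proof -
    have "expectation (W n) = (1 / real n) *\<^sub>R (\<Sum>i<n. expectation (U i))"
      using int_U by (simp add: W_def[abs_def])
    also have "(\<Sum>i<n. expectation (U i)) = (\<Sum>i<n. ?E)" by (rule sum.cong[OF refl exp_U])
    also have "(1 / real n) *\<^sub>R \<dots> = ?E" using that by (simp add: sum_constant_scaleR del: sum_constant)
    finally show ?thesis .
  qed
  have sq_W: "integrable M (\<lambda>\<omega>. (norm (W n \<omega>))\<^sup>2)" for n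
  proof (rule Bochner_Integration.integrable_bound)
    show "integrable M (\<lambda>\<omega>. (1 / real n)\<^sup>2 * (real n * (\<Sum>i<n. (norm (U i \<omega>))\<^sup>2)))"
      using int_Usq by simp
    have "(norm (W n \<omega>))\<^sup>2 \<le> (1 / real n)\<^sup>2 * (real n * (\<Sum>i<n. (norm (U i \<omega>))\<^sup>2))" for \<omega>
    proof -
      have "(norm (\<Sum>i<n. U i \<omega>))\<^sup>2 \<le> (\<Sum>i<n. norm (U i \<omega>))\<^sup>2"
        by (intro power_mono norm_sum) auto
      also have "\<dots> \<le> real n * (\<Sum>i<n. (norm (U i \<omega>))\<^sup>2)"
        using sum_squared_le_sum_of_squares[of "\<lambda>i. norm (U i \<omega>)" "{..<n}"] by (simp add: mult.commute)
      finally show ?thesis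
        unfolding W_def norm_scaleR power_mult_distrib by (simp add: power_divide divide_right_mono)
    qed
    then show "AE \<omega> in M. norm ((norm (W n \<omega>))\<^sup>2) \<le> norm ((1 / real n)\<^sup>2 * (real n * (\<Sum>i<n. (norm (U i \<omega>))\<^sup>2)))"
      by (intro AE_I2) (auto simp: sum_nonneg)
  qed (measurable)
  have dev: "((\<lambda>x. sqrt (real (fst x) * h (fst x)) *\<^sub>R (W (fst x) (snd x) - expectation (W (fst x)))) \<longlongrightarrow> 0) (in_prob M)"
    by (rule scaled_deviation_tendsto_0[OF W_m sq_W nh_pos]) (use lam in \<open>simp add: W_def[abs_def]\<close>)
  have mh_m[measurable]: "mean_hat M K V h U n \<in> borel_measurable M" for n
    unfolding mean_hat_def by measurable
  show ?thesis
  proof (rule char_tendsto_cong[OF _ _ N_char])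
    \<comment> \<open>An exact identity at every sample point, valid once \<open>m n\<close> is
      positive; the error to be discarded is precisely the scaled deviation of the plain
      average.\<close>
    have "\<forall>\<^sub>F n in sequentially. \<forall>\<omega>. sqrt (real n * h n) *\<^sub>R (W n \<omega> - expectation (W n)) =
        sqrt (real n * h n) *\<^sub>R (mean_hat M K V h U n \<omega> - ?E) - N n \<omega>"
      using eventually_ge_at_top[of 1] m_pos
    proof eventually_elim
      case (elim n)
      have mn: "0 < m n" "0 < real n" using elim h(1)[of n] by (auto simp: zero_less_divide_iff)
      have "mean_hat M K V h U n \<omega> = W n \<omega> + (1 / (real n * m n)) *\<^sub>R (\<Sum>i<n. \<eta> n (V i \<omega>) *\<^sub>R U i \<omega>)" for \<omega>
      proof -
        have "(\<Sum>i<n. K (V i \<omega> / h n) *\<^sub>R U i \<omega>) = m n *\<^sub>R (\<Sum>i<n. U i \<omega>) + (\<Sum>i<n. \<eta> n (V i \<omega>) *\<^sub>R U i \<omega>)"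
          by (simp add: \<eta>_def scaleR_sum_right sum.distrib[symmetric] scaleR_left_diff_distrib)
        then show ?thesis
          using mn unfolding mean_hat_def W_def m_def[symmetric] by (simp add: scaleR_right_distrib)
      qed
      moreover have "N n \<omega> = sqrt (real n * h n) *\<^sub>R ((1 / (real n * m n)) *\<^sub>R (\<Sum>i<n. \<eta> n (V i \<omega>) *\<^sub>R U i \<omega>))" for \<omega>
        by (simp add: N_def \<theta>_def scaleR_sum_right)
      ultimately show ?case using exp_W[OF elim(1)] by (simp add: scaleR_right_distrib scaleR_right_diff_distrib)
    qed
    from eventually_in_prob_fst[OF this]
    have "\<forall>\<^sub>F x in in_prob M. sqrt (real (fst x) * h (fst x)) *\<^sub>R (W (fst x) (snd x) - expectation (W (fst x))) =
        sqrt (real (fst x) * h (fst x)) *\<^sub>R (mean_hat M K V h U (fst x) (snd x) - ?E) - N (fst x) (snd x)"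
      by eventually_elim blast
    then show "((\<lambda>x. sqrt (real (fst x) * h (fst x)) *\<^sub>R (mean_hat M K V h U (fst x) (snd x) - ?E) - N (fst x) (snd x)) \<longlongrightarrow> 0) (in_prob M)"
      by (rule Lim_transform_eventually[OF dev])
  qed (measurable)
qed

end

section \<open>The regression model and the delta method\<close>

lemma borel_measurable_join_vec [measurable (raw)]:
  fixes v :: "'a \<Rightarrow> real ^ 'm" and w :: "'a \<Rightarrow> real ^ 'n"
  assumes [measurable]: "v \<in> borel_measurable M" "w \<in> borel_measurable M"
  shows "(\<lambda>x. join_vec (v x) (w x)) \<in> borel_measurable M"
  unfolding join_vec_def
proof (rule borel_measurable_vec_lambda)
  fix k :: "'m + 'n"
  show "(\<lambda>x. case k of Inl i \<Rightarrow> v x $ i | Inr j \<Rightarrow> w x $ j) \<in> borel_measurable M"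
    by (cases k) simp_all
qed

lemma borel_measurable_vech [measurable (raw)]:
  assumes [measurable]: "S \<in> borel_measurable M"
  shows "(\<lambda>x. vech (S x)) \<in> borel_measurable M"
  unfolding vech_def by (intro borel_measurable_vec_lambda) measurable

lemma borel_measurable_with_intercept [measurable (raw)]:
  assumes [measurable]: "v \<in> borel_measurable M"
  shows "(\<lambda>x. with_intercept (v x)) \<in> borel_measurable M"
  unfolding with_intercept_def
proof (rule borel_measurable_vec_lambda)
  fix k :: "'b option"
  show "(\<lambda>x. case k of None \<Rightarrow> 1 | Some k \<Rightarrow> v x $ k) \<in> borel_measurable M"
    by (cases k) simp_all
qed

lemma inner_with_intercept: "b \<bullet> with_intercept x = b $ None + (\<Sum>k\<in>UNIV. b $ Some k * x $ k)"
  by (simp add: inner_vec_def UNIV_option_conv with_intercept_def sum.reindex)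

lemma bounded_linear_Sigma_of: "bounded_linear (Sigma_of :: real ^ ('m ltri + 'm :: {finite, linorder}) \<Rightarrow> _)"
  by (rule linear_conv_bounded_linear[THEN iffD1], rule linearI) (simp_all add: Sigma_of_simps)

lemma bounded_linear_Gamma_of: "bounded_linear (Gamma_of :: real ^ ('m ltri + 'm :: {finite, linorder}) \<Rightarrow> _)"
  by (rule linear_conv_bounded_linear[THEN iffD1], rule linearI) (simp_all add: Gamma_of_simps)

lemma bounded_linear_matrix_vector_left: "bounded_linear (\<lambda>A :: real ^ 'n ^ 'm. A *v b)"
  by (rule linear_conv_bounded_linear[THEN iffD1], rule linearI)
     (simp_all add: matrix_vector_mult_add_rdistrib scaleR_matrix_vector_assoc[symmetric])

lemma sandwich_quadratic_form:
  fixes J :: "real ^ 'n ^ 'm" and E :: "real ^ 'n ^ 'n"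
  shows "t \<bullet> ((c *\<^sub>R (J ** E ** transpose J)) *v t) = c * ((transpose J *v t) \<bullet> (E *v (transpose J *v t)))"
proof -
  have "t \<bullet> (J *v y) = (transpose J *v t) \<bullet> y" for y
    by (metis dot_lmul_matrix vector_transpose_matrix transpose_transpose)
  then show ?thesis
    by (simp add: scaleR_matrix_vector_assoc[symmetric] matrix_vector_mul_assoc[symmetric])
qed

lemma matrix_mult_scaleR:
  fixes A :: "real ^ 'n ^ 'm" and B :: "real ^ 'k ^ 'n"
  shows "A ** (c *\<^sub>R B) = c *\<^sub>R (A ** B)" "(c *\<^sub>R A) ** B = c *\<^sub>R (A ** B)"
  by (simp_all add: matrix_matrix_mult_def vec_eq_iff sum_distrib_left mult_ac)

lemma transpose_scaleR: "transpose (c *\<^sub>R A) = c *\<^sub>R transpose (A :: real ^ 'n ^ 'm)"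
  by (simp add: transpose_def vec_eq_iff)

context prob_space
begin

text \<open>Decoding the matrix and the vector from \<open>U\<close> is linear, hence commutes with
  expectation.\<close>

lemma expectation_join_vec_outer:
  fixes Xt :: "'a \<Rightarrow> real ^ ('m :: {finite, linorder})" and U :: "'a \<Rightarrow> real ^ ('m ltri + 'm)"
  assumes int: "integrable M U" and Y: "\<And>\<omega>. U \<omega> = join_vec (vech (outer (Xt \<omega>) (Xt \<omega>))) (Y \<omega> *\<^sub>R Xt \<omega>)"
  shows "Sigma_of (U \<omega>) = outer (Xt \<omega>) (Xt \<omega>)" "Gamma_of (U \<omega>) = Y \<omega> *\<^sub>R Xt \<omega>"
    and "expectation U = join_vec (vech (\<integral>\<omega>. outer (Xt \<omega>) (Xt \<omega>) \<partial>M)) (\<integral>\<omega>. Y \<omega> *\<^sub>R Xt \<omega> \<partial>M)"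
proof -
  show S: "Sigma_of (U \<omega>) = outer (Xt \<omega>) (Xt \<omega>)" and G: "Gamma_of (U \<omega>) = Y \<omega> *\<^sub>R Xt \<omega>" for \<omega>
    unfolding Y by (simp_all add: Sigma_of_join_vec_vech transpose_outer Gamma_of_join_vec)
  show "expectation U = join_vec (vech (\<integral>\<omega>. outer (Xt \<omega>) (Xt \<omega>) \<partial>M)) (\<integral>\<omega>. Y \<omega> *\<^sub>R Xt \<omega> \<partial>M)"
    unfolding S[symmetric] G[symmetric] integral_bounded_linear[OF bounded_linear_Sigma_of int]
      integral_bounded_linear[OF bounded_linear_Gamma_of int] join_vec_vech_Sigma_of ..
qed

text \<open>The map \<open>l\<close> sends \<open>U\<close> to the error times the regressors, so
  its mean vanishes by conditioning and the normal equations hold. For positivity, a vanishing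
  second moment would force the error times \<open>w \<bullet> Xt\<close> to be 0 almost surely; as
  the conditional error variance is positive, \<open>w \<bullet> Xt\<close> is then 0, so
  \<open>w\<close> lies in the kernel of the invertible second-moment matrix.\<close>

lemma regression_moments:
  fixes X :: "'a \<Rightarrow> real ^ 'n" and Xt :: "'a \<Rightarrow> real ^ ('m :: {finite, linorder})"
    and e :: "'a \<Rightarrow> real" and U :: "'a \<Rightarrow> real ^ ('m ltri + 'm)"
  assumes X[measurable]: "X \<in> borel_measurable M" and e[measurable]: "e \<in> borel_measurable M"
    and Xt: "\<And>\<omega>. Xt \<omega> = \<phi> (X \<omega>)" and \<phi>[measurable]: "\<phi> \<in> borel_measurable borel"
    and U: "\<And>\<omega>. U \<omega> = join_vec (vech (outer (Xt \<omega>) (Xt \<omega>))) ((\<beta> \<bullet> Xt \<omega> + e \<omega>) *\<^sub>R Xt \<omega>)"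
    and sq: "integrable M (\<lambda>\<omega>. (norm (U \<omega>))\<^sup>2)"
    and ce: "AE \<omega> in M. real_cond_exp M (vimage_algebra (space M) X borel) e \<omega> = 0"
    and var: "AE \<omega> in M. 0 < nn_cond_exp M (vimage_algebra (space M) X borel) (\<lambda>\<omega>. ennreal ((e \<omega>)\<^sup>2)) \<omega>"
    and \<mu>: "expectation U \<in> reg_dom"
  shows "g_reg (expectation U) = \<beta>"
    and "v \<noteq> 0 \<Longrightarrow> 0 < expectation (\<lambda>\<omega>. (v \<bullet> Dg_reg (expectation U) (U \<omega>))\<^sup>2)"
proof -
  let ?F = "vimage_algebra (space M) X borel" and ?\<mu> = "expectation U"
  have Xt_m[measurable]: "Xt \<in> borel_measurable M" unfolding Xt[abs_def] by measurable
  have U_m[measurable]: "U \<in> borel_measurable M" unfolding U[abs_def] by measurable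
  have int: "integrable M U" by (rule second_moment_integrable(1)[OF U_m sq])
  note SG = expectation_join_vec_outer(1,2)[OF int U]
  have F: "X \<in> ?F \<rightarrow>\<^sub>M borel" by (rule measurable_vimage_algebra1) simp
  have "subalgebra M ?F"
    unfolding subalgebra_def using sets_image_in_sets[of M "space M" X borel] by simp
  then interpret F: finite_measure_subalgebra M ?F
    by unfold_locales
  define l where "l x = Gamma_of x - Sigma_of x *v \<beta>" for x :: "real ^ ('m ltri + 'm)"
  have l_lin: "bounded_linear l"
    unfolding l_def
    by (intro bounded_linear_sub bounded_linear_Gamma_of
      bounded_linear_compose[OF bounded_linear_matrix_vector_left bounded_linear_Sigma_of])
  have lU: "l (U \<omega>) = e \<omega> *\<^sub>R Xt \<omega>" for \<omega>
    unfolding l_def SG outer_vector by (simp add: scaleR_left_distrib)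
  have int_l: "integrable M (\<lambda>\<omega>. l (U \<omega>))" by (rule integrable_bounded_linear[OF l_lin int])
  have "l ?\<mu> $ j = 0" for j
  proof -
    have int_j: "integrable M (\<lambda>\<omega>. Xt \<omega> $ j * e \<omega>)"
      using integrable_vec_nth[OF int_l, of j] by (simp add: lU mult.commute)
    have m: "(\<lambda>\<omega>. Xt \<omega> $ j) \<in> borel_measurable ?F"
      unfolding Xt by (rule measurable_compose[OF F]) measurable
    have "l ?\<mu> $ j = (\<integral>\<omega>. l (U \<omega>) \<partial>M) $ j"
      by (simp add: integral_bounded_linear[OF l_lin int])
    also have "\<dots> = (\<integral>\<omega>. Xt \<omega> $ j * e \<omega> \<partial>M)"
      by (simp add: integral_vec_nth[OF int_l[unfolded lU]] lU mult.commute)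
    also have "\<dots> = (\<integral>\<omega>. Xt \<omega> $ j * real_cond_exp M ?F e \<omega> \<partial>M)"
      by (rule F.real_cond_exp_intg(2)[OF int_j m e, symmetric])
    also have "\<dots> = (\<integral>\<omega>. 0 \<partial>M)"
    proof (rule integral_cong_AE)
      show "AE \<omega> in M. Xt \<omega> $ j * real_cond_exp M ?F e \<omega> = 0"
        using ce by eventually_elim simp
      show "(\<lambda>\<omega>. Xt \<omega> $ j * real_cond_exp M ?F e \<omega>) \<in> borel_measurable M" by measurable
    qed simp
    finally show ?thesis by simp
  qed
  then have l\<mu>: "l ?\<mu> = 0" by (simp add: vec_eq_iff)
  have det: "det (Sigma_of ?\<mu>) \<noteq> 0" by (rule reg_dom_det[OF \<mu>])
  have "Gamma_of ?\<mu> = Sigma_of ?\<mu> *v \<beta>" using l\<mu> by (simp add: l_def)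
  then show g: "g_reg ?\<mu> = \<beta>" unfolding g_reg_def by (simp add: matrix_inv_vector(2)[OF det])
  show "0 < expectation (\<lambda>\<omega>. (v \<bullet> Dg_reg ?\<mu> (U \<omega>))\<^sup>2)" if v: "v \<noteq> 0"
  proof (rule ccontr)
    let ?Si = "matrix_inv (Sigma_of ?\<mu>)"
    \<comment> \<open>Moving the inverse matrix onto the test vector turns
      \<open>v \<bullet> Dg_reg ?\<mu> (U \<omega>)\<close> into the error times a linear form in
      the regressors.\<close>
    define w where "w = transpose ?Si *v v"
    have w: "v \<bullet> (?Si *v y) = w \<bullet> y" for y
      unfolding w_def by (metis dot_lmul_matrix vector_transpose_matrix transpose_transpose)
    have D: "v \<bullet> Dg_reg ?\<mu> (U \<omega>) = e \<omega> * (w \<bullet> Xt \<omega>)" for \<omega>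
      unfolding Dg_reg_def g l_def[symmetric] lU w by simp
    obtain t where t: "\<And>x. v \<bullet> Dg_reg ?\<mu> x = t \<bullet> x"
    proof
      fix x
      show "v \<bullet> Dg_reg ?\<mu> x = adjoint (Dg_reg ?\<mu>) v \<bullet> x"
        using adjoint_works[OF linear_Dg_reg, of x ?\<mu> v] by (simp add: inner_commute)
    qed
    have int2: "integrable M (\<lambda>\<omega>. (e \<omega> * (w \<bullet> Xt \<omega>))\<^sup>2)"
      using second_moment_integrable(4)[OF U_m sq, of t] by (simp add: t[symmetric] D)
    assume "\<not> 0 < expectation (\<lambda>\<omega>. (v \<bullet> Dg_reg ?\<mu> (U \<omega>))\<^sup>2)"
    moreover have "0 \<le> expectation (\<lambda>\<omega>. (e \<omega> * (w \<bullet> Xt \<omega>))\<^sup>2)" by simp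
    ultimately have "expectation (\<lambda>\<omega>. (e \<omega> * (w \<bullet> Xt \<omega>))\<^sup>2) = 0" by (simp add: D)
    then have AE0: "AE \<omega> in M. (e \<omega> * (w \<bullet> Xt \<omega>))\<^sup>2 = 0"
      by (subst (asm) integral_nonneg_eq_0_iff_AE[OF int2]) auto
    \<comment> \<open>The event that the linear form is nonzero depends on \<open>X\<close> only, so
      its indicator may be taken through the conditional expectation; values in
      \<open>ennreal\<close> keep this free of integrability questions.\<close>
    let ?I = "\<lambda>\<omega>. indicator {x. w \<bullet> \<phi> x \<noteq> 0} (X \<omega>) :: ennreal"
    have I_m: "?I \<in> borel_measurable ?F"
      by (rule measurable_compose[OF F]) measurable
    have I_m'[measurable]: "?I \<in> borel_measurable M" by measurable
    have "(\<integral>\<^sup>+\<omega>. ?I \<omega> * nn_cond_exp M ?F (\<lambda>\<omega>. ennreal ((e \<omega>)\<^sup>2)) \<omega> \<partial>M) = (\<integral>\<^sup>+\<omega>. ?I \<omega> * ennreal ((e \<omega>)\<^sup>2) \<partial>M)"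
      by (rule F.nn_cond_exp_intg[OF I_m]) measurable
    also have "\<dots> = 0"
    proof (subst nn_integral_0_iff_AE)
      show "AE \<omega> in M. ?I \<omega> * ennreal ((e \<omega>)\<^sup>2) = 0"
        using AE0 by eventually_elim (auto simp: indicator_def Xt)
    qed measurable
    finally have "AE \<omega> in M. ?I \<omega> * nn_cond_exp M ?F (\<lambda>\<omega>. ennreal ((e \<omega>)\<^sup>2)) \<omega> = 0"
      by (subst (asm) nn_integral_0_iff_AE) auto
    with var have AEw: "AE \<omega> in M. w \<bullet> Xt \<omega> = 0"
      by eventually_elim (auto simp: indicator_def Xt split: if_splits)
    have "Sigma_of ?\<mu> *v w = (\<integral>\<omega>. Sigma_of (U \<omega>) *v w \<partial>M)"
      by (rule integral_bounded_linear[OF bounded_linear_compose[OF bounded_linear_matrix_vector_left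
        bounded_linear_Sigma_of] int, symmetric])
    also have "\<dots> = (\<integral>\<omega>. 0 \<partial>M)"
    proof (rule integral_cong_AE)
      show "AE \<omega> in M. Sigma_of (U \<omega>) *v w = 0"
        using AEw by eventually_elim (simp add: SG outer_vector)
      show "(\<lambda>\<omega>. Sigma_of (U \<omega>) *v w) \<in> borel_measurable M"
        unfolding SG by measurable
    qed simp
    finally have "Sigma_of ?\<mu> *v w = 0" by simp
    then have "w = 0" using matrix_inv_vector(2)[OF det, of w] by simp
    \<comment> \<open>Testing at \<open>Sigma_of ?\<mu> *v v\<close> undoes the inverse and yields
      \<open>v \<bullet> v = 0\<close>.\<close>
    then have "v \<bullet> (?Si *v (Sigma_of ?\<mu> *v v)) = 0" unfolding w by simp
    then show False using v by (simp add: matrix_inv_vector(2)[OF det])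
  qed
qed

text \<open>The linearisation error is the difference quotient \<open>\<rho>\<close> at
  \<open>T\<close> times the tight scaled deviation, and \<open>\<rho>\<close> tends to 0 by
  consistency.\<close>

lemma delta_method_in_prob:
  fixes g :: "real ^ 'n \<Rightarrow> real ^ 'm" and T :: "nat \<Rightarrow> 'a \<Rightarrow> real ^ 'n"
  assumes g: "(g has_derivative D) (at \<mu>)"
    and T: "((\<lambda>x. T (fst x) (snd x)) \<longlongrightarrow> \<mu>) (in_prob M)"
    and bdd: "bounded_in_prob (\<lambda>n \<omega>. r n *\<^sub>R (T n \<omega> - \<mu>))"
  shows "((\<lambda>x. r (fst x) *\<^sub>R (g (T (fst x) (snd x)) - g \<mu>) - D (r (fst x) *\<^sub>R (T (fst x) (snd x) - \<mu>))) \<longlongrightarrow> 0) (in_prob M)"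
proof -
  define \<rho> where "\<rho> y = norm (g y - g \<mu> - D (y - \<mu>)) / norm (y - \<mu>)" for y
  have D: "bounded_linear D" and lim: "(\<rho> \<longlongrightarrow> 0) (at \<mu>)"
    using g unfolding has_derivative_iff_norm \<rho>_def by auto
  interpret D: bounded_linear D by (rule D)
  \<comment> \<open>Division by zero gives \<open>\<rho>\<close> the right value at
    \<open>\<mu>\<close>, so the limit extends from the punctured to the full neighbourhood;
    \<open>T\<close> may hit \<open>\<mu>\<close> with positive probability.\<close>
  have "\<rho> \<mu> = 0" by (simp add: \<rho>_def)
  with lim have "(\<rho> \<longlongrightarrow> \<rho> \<mu>) (at \<mu>)" by simp
  then have "(\<rho> \<longlongrightarrow> \<rho> \<mu>) (nhds \<mu>)" by (rule tendsto_at_iff_tendsto_nhds[THEN iffD1])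
  from filterlim_compose[OF this T] have "((\<lambda>x. \<rho> (T (fst x) (snd x))) \<longlongrightarrow> 0) (in_prob M)"
    using \<open>\<rho> \<mu> = 0\<close> by simp
  from bounded_in_prob_tendsto_0[OF this bdd]
  have "((\<lambda>x. \<rho> (T (fst x) (snd x)) * norm (r (fst x) *\<^sub>R (T (fst x) (snd x) - \<mu>))) \<longlongrightarrow> 0) (in_prob M)" .
  then show ?thesis
  proof (rule Lim_null_comparison[rotated])
    have "norm (s *\<^sub>R (g y - g \<mu>) - D (s *\<^sub>R (y - \<mu>))) \<le> \<rho> y * norm (s *\<^sub>R (y - \<mu>))" for s y
    proof (cases "y = \<mu>")
      case False
      have "s *\<^sub>R (g y - g \<mu>) - D (s *\<^sub>R (y - \<mu>)) = s *\<^sub>R (g y - g \<mu> - D (y - \<mu>))"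
        by (simp only: D.scaleR) (simp only: scaleR_right_diff_distrib)
      then show ?thesis using False by (simp add: \<rho>_def)
    qed (simp add: D.zero)
    then show "\<forall>\<^sub>F x in in_prob M. norm (r (fst x) *\<^sub>R (g (T (fst x) (snd x)) - g \<mu>) -
        D (r (fst x) *\<^sub>R (T (fst x) (snd x) - \<mu>))) \<le> \<rho> (T (fst x) (snd x)) * norm (r (fst x) *\<^sub>R (T (fst x) (snd x) - \<mu>))"
      by (intro always_eventually allI)
  qed
qed

lemma bounded_in_prob_bounded_scaleR:
  fixes Z :: "nat \<Rightarrow> 'a \<Rightarrow> 'b :: real_normed_vector"
  assumes s: "\<forall>\<^sub>F n in sequentially. \<bar>s n\<bar> \<le> B" and Z: "bounded_in_prob Z"
  shows "bounded_in_prob (\<lambda>n \<omega>. s n *\<^sub>R Z n \<omega>)"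
  unfolding bounded_in_prob_def
proof (intro allI impI)
  fix e :: real assume "e > 0"
  with Z obtain C where C: "\<forall>\<^sub>F n in sequentially. \<exists>E\<in>events. prob (space M - E) < e \<and> (\<forall>\<omega>\<in>E. norm (Z n \<omega>) \<le> C)"
    unfolding bounded_in_prob_def by blast
  from C s have "\<forall>\<^sub>F n in sequentially. \<exists>E\<in>events. prob (space M - E) < e \<and> (\<forall>\<omega>\<in>E. norm (s n *\<^sub>R Z n \<omega>) \<le> B * C)"
  proof eventually_elim
    case (elim n)
    then obtain E where E: "E \<in> events" "prob (space M - E) < e" "\<forall>\<omega>\<in>E. norm (Z n \<omega>) \<le> C" by blast
    have "norm (s n *\<^sub>R Z n \<omega>) \<le> B * C" if "\<omega> \<in> E" for \<omega>
      using E(3) that elim(2) unfolding norm_scaleR by (intro mult_mono) (auto intro: order_trans[OF abs_ge_zero])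
    with E show ?case by blast
  qed
  then show "\<exists>B. \<forall>\<^sub>F n in sequentially. \<exists>E\<in>events. prob (space M - E) < e \<and> (\<forall>\<omega>\<in>E. norm (s n *\<^sub>R Z n \<omega>) \<le> B)" by blast
qed

text \<open>Arbitrary values outside the domain of the formula are confined to events of vanishing
  probability and so invisible to the filter.\<close>

lemma plug_in_eventually:
  assumes "\<And>n. plug_in M (S n) (F n) (T n) (Z n)"
    and "\<forall>\<^sub>F x in in_prob M. T (fst x) (snd x) \<in> S (fst x)"
  shows "\<forall>\<^sub>F x in in_prob M. Z (fst x) (snd x) = F (fst x) (T (fst x) (snd x))"
  using assms(2) eventually_in_prob_space
  by eventually_elim (use assms(1) in \<open>auto simp: plug_in_def\<close>)

lemma plug_in_inverse_tendsto:
  fixes S :: "real ^ 'n ^ 'n" and Sh Si :: "nat \<Rightarrow> 'a \<Rightarrow> real ^ 'n ^ 'n"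
  assumes "\<And>n. plug_in M {S. invertible S} matrix_inv (Sh n) (Si n)"
    and lim: "((\<lambda>x. Sh (fst x) (snd x)) \<longlongrightarrow> S) (in_prob M)" and S: "det S \<noteq> 0"
  shows "((\<lambda>x. Si (fst x) (snd x)) \<longlongrightarrow> matrix_inv S) (in_prob M)"
proof (rule Lim_transform_eventually[OF tendsto_matrix_inv[OF lim S]])
  have "\<forall>\<^sub>F x in in_prob M. det (Sh (fst x) (snd x)) \<noteq> 0"
    using tendsto_det[OF lim] S by (rule tendsto_imp_eventually_ne)
  then have "\<forall>\<^sub>F x in in_prob M. Sh (fst x) (snd x) \<in> {S. invertible S}"
    by (simp add: invertible_det_nz)
  from plug_in_eventually[OF assms(1) this]
  show "\<forall>\<^sub>F x in in_prob M. matrix_inv (Sh (fst x) (snd x)) = Si (fst x) (snd x)"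
    by eventually_elim simp
qed

lemma second_moment_average_tendsto:
  fixes U :: "nat \<Rightarrow> 'a \<Rightarrow> real ^ 'n" and Z :: "nat \<Rightarrow> 'a \<Rightarrow> 'c :: topological_space"
  assumes Z: "stationary_seq M Z" "ergodic_seq M Z"
    and U: "\<And>i \<omega>. U i \<omega> = u (Z i \<omega>)" and u[measurable]: "u \<in> borel_measurable borel"
    and sq: "integrable M (\<lambda>\<omega>. (norm (U 0 \<omega>))\<^sup>2)"
  shows "((\<lambda>x. (1 / real (fst x)) *\<^sub>R (\<Sum>i<fst x. outer (U i (snd x)) (U i (snd x)))) \<longlongrightarrow>
    expectation (\<lambda>\<omega>. outer (U 0 \<omega>) (U 0 \<omega>))) (in_prob M)"
proof (rule tendsto_matrixI)
  fix k l
  note [measurable] = stationary_seqD(1)[OF Z(1)]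
  have U_m[measurable]: "U i \<in> borel_measurable M" for i unfolding U by measurable
  note int = second_moment_integrable(2,3)[OF U_m sq]
  have "AE \<omega> in M. (\<lambda>n. (1 / real n) * (\<Sum>i<n. u (Z i \<omega>) $ k * u (Z i \<omega>) $ l)) \<longlonglongrightarrow> (\<integral>\<omega>. u (Z 0 \<omega>) $ k * u (Z 0 \<omega>) $ l \<partial>M)"
    by (rule birkhoff_ergodic[OF Z]) (use int(1)[of k l] in \<open>auto simp: U\<close>)
  from tendsto_in_prob_AE[OF _ this]
  have "((\<lambda>x. (1 / real (fst x)) * (\<Sum>i<fst x. U i (snd x) $ k * U i (snd x) $ l)) \<longlongrightarrow> expectation (\<lambda>\<omega>. U 0 \<omega> $ k * U 0 \<omega> $ l)) (in_prob M)"
    unfolding U[symmetric] by simp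
  moreover have "expectation (\<lambda>\<omega>. outer (U 0 \<omega>) (U 0 \<omega>)) $ k $ l = expectation (\<lambda>\<omega>. U 0 \<omega> $ k * U 0 \<omega> $ l)"
    by (simp add: integral_vec_nth[OF int(2)] integral_vec_nth[OF integrable_vec_nth[OF int(2)]])
       (simp add: outer_def)
  ultimately show "((\<lambda>x. ((1 / real (fst x)) *\<^sub>R (\<Sum>i<fst x. outer (U i (snd x)) (U i (snd x)))) $ k $ l) \<longlongrightarrow>
      expectation (\<lambda>\<omega>. outer (U 0 \<omega>) (U 0 \<omega>)) $ k $ l) (in_prob M)"
    by (simp add: sum_component outer_def)
qed

end

lemma tendsto_block_diag [tendsto_intros]:
  "(a \<longlongrightarrow> p) F \<Longrightarrow> (b \<longlongrightarrow> q) F \<Longrightarrow> ((\<lambda>x. block_diag (a x) (b x)) \<longlongrightarrow> block_diag p q) F"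
  unfolding block_diag_def by (intro tendsto_vec_lambda) (auto split: sum.split)

lemma block_diag_1: "block_diag 1 1 = mat 1"
  by (auto simp: block_diag_def mat_def vec_eq_iff split: sum.split)

lemma block_diag_diff_scaleR: "c *\<^sub>R (block_diag a b - mat 1) = block_diag (c * (a - 1)) (c * (b - 1))"
  by (auto simp: block_diag_def mat_def vec_eq_iff split: sum.split)

lemma block_diag_scaleR: "c *\<^sub>R block_diag a b = block_diag (c * a) (c * b)"
  by (auto simp: block_diag_def vec_eq_iff split: sum.split)

theorem corollary4p2:
  fixes M :: "'a measure"
    and X :: "nat \<Rightarrow> 'a \<Rightarrow> real ^ ('p :: {finite, linorder})"
    and eps Y V :: "nat \<Rightarrow> 'a \<Rightarrow> real"
    and Xt :: "nat \<Rightarrow> 'a \<Rightarrow> real ^ ('p option)"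
    and \<beta> :: "real ^ ('p option)"
    and U :: "nat \<Rightarrow> 'a \<Rightarrow> real ^ ('p option ltri + 'p option)"
    and \<mu> :: "real ^ ('p option ltri + 'p option)"
    and f K :: "real \<Rightarrow> real"
    and h L c a_S a_G :: "nat \<Rightarrow> real"
    and lam_S lam_G \<alpha> c2 :: real
    and A :: "nat \<Rightarrow> real ^ ('p option ltri + 'p option) ^ ('p option ltri + 'p option)"
    and mu_hat mu_til :: "nat \<Rightarrow> 'a \<Rightarrow> real ^ ('p option ltri + 'p option)"
    and Sig_mu_hat ::
      "nat \<Rightarrow> 'a \<Rightarrow> real ^ ('p option ltri + 'p option) ^ ('p option ltri + 'p option)"
    and beta_til beta_T D_T :: "nat \<Rightarrow> 'a \<Rightarrow> real ^ ('p option)"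
    and J_hat J_T :: "nat \<Rightarrow> 'a \<Rightarrow> real ^ ('p option ltri + 'p option) ^ ('p option)"
    and Sig_hat Sig_hat_inv Sig_T Sig_T_inv :: "nat \<Rightarrow> 'a \<Rightarrow> real ^ ('p option) ^ ('p option)"
    and Sigma_beta :: "real ^ ('p option) ^ ('p option)"
  assumes "prob_space M"
    \<comment> \<open>regression model\<close>
    and "stationary_seq M (\<lambda>i \<omega>. (X i \<omega>, eps i \<omega>))"
    and "integrable M (eps 0)"
    and "AE \<omega> in M. real_cond_exp M (vimage_algebra (space M) (X 0) borel) (eps 0) \<omega> = 0"
    and "integrable M (\<lambda>\<omega>. (norm (X 0 \<omega>))\<^sup>2)"
    and Y: "Y = (\<lambda>i \<omega>. \<beta> $ None + (\<Sum>k\<in>UNIV. \<beta> $ Some k * X i \<omega> $ k) + eps i \<omega>)"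
    and Xt: "Xt = (\<lambda>i \<omega>. with_intercept (X i \<omega>))"
    and \<mu>: "\<mu> = join_vec (vech (\<integral>\<omega>. outer (Xt 0 \<omega>) (Xt 0 \<omega>) \<partial>M)) (\<integral>\<omega>. Y 0 \<omega> *\<^sub>R Xt 0 \<omega> \<partial>M)"
    and U: "U = (\<lambda>i \<omega>. join_vec (vech (outer (Xt i \<omega>) (Xt i \<omega>))) (Y i \<omega> *\<^sub>R Xt i \<omega>))"
    \<comment> \<open>smoothing variables, kernel and bandwidths\<close>
    and "prob_space.indep_vars M (\<lambda>_. borel) V UNIV"
    and "\<And>i. distributed M lborel (V i) (\<lambda>x. ennreal (f x))"
    and "prob_space.indep_set M
           (sets (vimage_algebra (space M) (\<lambda>\<omega> i. V i \<omega>) (\<Pi>\<^sub>M i\<in>UNIV. borel)))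
           (sets (vimage_algebra (space M) (\<lambda>\<omega> i. U i \<omega>) (\<Pi>\<^sub>M i\<in>UNIV. borel)))"
    and "\<And>x. 0 \<le> f x" and "bounded (range f)" and "isCont f 0" and "f 0 > 0"
    and "K \<in> borel_measurable borel" and "\<And>u. 0 \<le> K u" and "bounded (range K)"
    and "\<And>u. K (- u) = K u" and "has_bochner_integral lborel K 1"
    and "\<And>n. n \<ge> 1 \<Longrightarrow> h n > 0"
    \<comment> \<open>estimators\<close>
    and c2: "c2 = (\<integral>u. (K u)\<^sup>2 \<partial>lborel)"
    and mu_hat: "mu_hat = mean_hat M K V h U"
    and Sig_mu_hat:
      "Sig_mu_hat = (\<lambda>n \<omega>. (c2 / f 0) *\<^sub>R ((1 / real n) *\<^sub>R (\<Sum>i<n. outer (U i \<omega>) (U i \<omega>))))"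
    and J_hat: "\<And>n. plug_in M reg_dom (\<lambda>x. jacobian g_reg (at x)) (mu_hat n) (J_hat n)"
    and Sig_hat: "Sig_hat = (\<lambda>n \<omega>. J_hat n \<omega> ** Sig_mu_hat n \<omega> ** transpose (J_hat n \<omega>))"
    and Sig_hat_inv: "\<And>n. plug_in M {S. invertible S} matrix_inv (Sig_hat n) (Sig_hat_inv n)"
    and "lam_S > 0" and "lam_G > 0" and "lam_S \<noteq> lam_G"
    and a_S: "a_S = (\<lambda>n. (\<integral>\<omega>. dens_hat K V h lam_S n 0 \<omega> \<partial>M) / f 0)"
    and a_G: "a_G = (\<lambda>n. (\<integral>\<omega>. dens_hat K V h lam_G n 0 \<omega> \<partial>M) / f 0)"
    and A: "A = (\<lambda>n. block_diag (a_S n) (a_G n))"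
    and mu_til: "mu_til = (\<lambda>n \<omega>. A n *v mu_hat n \<omega>)"
    and beta_til: "\<And>n. plug_in M reg_dom g_reg (mu_til n) (beta_til n)"
    and beta_T: "beta_T = (\<lambda>n \<omega>. g_trunc (c n) (mu_til n \<omega>))"
    and J_T: "\<And>n. plug_in M {x. g_trunc (c n) differentiable (at x)}
                (\<lambda>x. jacobian (g_trunc (c n)) (at x)) (mu_til n) (J_T n)"
    \<comment> \<open>hypotheses of the result\<close>
    and "ergodic_seq M (\<lambda>i \<omega>. (X i \<omega>, eps i \<omega>))"
    and "integrable M (\<lambda>\<omega>. (norm (U 0 \<omega>))\<^sup>2)"
    and "h \<longlonglongrightarrow> 0"
    and "filterlim (\<lambda>n. real n * h n) at_top sequentially"
    and "(\<lambda>n. real n * h n *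
            lambda_max (cov_matrix M (\<lambda>\<omega>. (1 / real n) *\<^sub>R (\<Sum>i<n. U i \<omega>)))) \<longlonglongrightarrow> 0"
    and "integrable lborel (\<lambda>u. (K u)\<^sup>2)"
    and "\<mu> \<in> reg_dom"
    and "integrable M (\<lambda>\<omega>. (norm (X 0 \<omega>)) ^ 4)"
    and "AE \<omega> in M.
           0 < nn_cond_exp M (vimage_algebra (space M) (X 0) borel) (\<lambda>\<omega>. ennreal ((eps 0 \<omega>)\<^sup>2)) \<omega> \<and>
           nn_cond_exp M (vimage_algebra (space M) (X 0) borel) (\<lambda>\<omega>. ennreal ((eps 0 \<omega>)\<^sup>2)) \<omega> < \<infinity>"
    and "interior (law_support M (X 0)) \<noteq> {}"
    and "filterlim L at_top sequentially" and "slowly_varying L"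
    and c: "c = (\<lambda>n. (real n * h n) powr (- 1 / 2) * L n)"
    and "c \<longlonglongrightarrow> 0"
    and "\<alpha> \<in> {0<..<1}"
    and Sigma_beta: "Sigma_beta = (c2 / f 0) *\<^sub>R
          (jacobian g_reg (at \<mu>) ** (\<integral>\<omega>. outer (U 0 \<omega>) (U 0 \<omega>) \<partial>M)
             ** transpose (jacobian g_reg (at \<mu>)))"
    and D_T: "D_T = (\<lambda>n \<omega>.
          (deriv (deriv f) 0 * (\<integral>u. u\<^sup>2 * K u \<partial>lborel) / (2 * f 0) * (h n)\<^sup>2) *\<^sub>R
            (J_T n \<omega> *v (block_diag (lam_S\<^sup>2) (lam_G\<^sup>2) *v mu_til n \<omega>)))"
    and Sig_T: "Sig_T = (\<lambda>n \<omega>. J_T n \<omega> ** Sig_mu_hat n \<omega> ** transpose (J_T n \<omega>))"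
    and Sig_T_inv: "\<And>n. plug_in M {S. invertible S} matrix_inv (Sig_T n) (Sig_T_inv n)"
  shows
    "to_zero_in_prob M (\<lambda>n \<omega>. sqrt (real n * h n) *\<^sub>R (beta_T n \<omega> - beta_til n \<omega>)) \<and>
     ((\<lambda>n. sqrt (real n * h n) * norm (A n - mat 1)) \<longlonglongrightarrow> 0 \<longrightarrow>
        conv_in_distr M (\<lambda>n \<omega>. sqrt (real n * h n) *\<^sub>R (beta_T n \<omega> - \<beta>)) (centred_normal Sigma_beta) \<and>
        asymp_confidence_set M (1 - \<alpha>)
          (\<lambda>n \<omega>. {b. real n * h n * ((beta_T n \<omega> - b) \<bullet> (Sig_hat_inv n \<omega> *v (beta_T n \<omega> - b)))
                    \<le> quantile (chi_square (CARD('p) + 1)) (1 - \<alpha>)}) \<beta> \<and>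
        (\<forall>j. asymp_confidence_set M (1 - \<alpha>)
          (\<lambda>n \<omega>. let r = quantile std_normal (1 - \<alpha> / 2) * sqrt (Sig_hat n \<omega> $ j $ j / (real n * h n))
                 in {beta_T n \<omega> $ j - r .. beta_T n \<omega> $ j + r}) (\<beta> $ j))) \<and>
     ((\<exists>\<delta>>0. (\<forall>x\<in>{-\<delta><..<\<delta>}. f differentiable (at x) \<and> deriv f differentiable (at x)) \<and>
             bounded (deriv (deriv f) ` {-\<delta><..<\<delta>})) \<and>
      isCont (deriv (deriv f)) 0 \<and> deriv (deriv f) 0 \<noteq> 0 \<and>
      integrable lborel (\<lambda>u. u\<^sup>2 * K u) \<and>
      (\<exists>a b. 0 < a \<and> (\<forall>n\<ge>1. a \<le> real n powr (1 / 5) * h n \<and> real n powr (1 / 5) * h n \<le> b)) \<longrightarrow>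
        conv_in_distr M (\<lambda>n \<omega>. sqrt (real n * h n) *\<^sub>R (beta_T n \<omega> - D_T n \<omega> - \<beta>))
          (centred_normal Sigma_beta) \<and>
        asymp_confidence_set M (1 - \<alpha>)
          (\<lambda>n \<omega>. {b. real n * h n * ((beta_T n \<omega> - D_T n \<omega> - b) \<bullet>
                      (Sig_T_inv n \<omega> *v (beta_T n \<omega> - D_T n \<omega> - b)))
                    \<le> quantile (chi_square (CARD('p) + 1)) (1 - \<alpha>)}) \<beta> \<and>
        (\<forall>j. asymp_confidence_set M (1 - \<alpha>)
          (\<lambda>n \<omega>. let r = quantile std_normal (1 - \<alpha> / 2) * sqrt (Sig_hat n \<omega> $ j $ j / (real n * h n))
                 in {beta_T n \<omega> $ j - D_T n \<omega> $ j - r .. beta_T n \<omega> $ j - D_T n \<omega> $ j + r})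
          (\<beta> $ j)))"
proof -
  interpret prob_space M by fact
  let ?Z = "\<lambda>i \<omega>. (X i \<omega>, eps i \<omega>)"
  have Z: "stationary_seq M ?Z" "ergodic_seq M ?Z" by fact+
  have f: "\<And>x. 0 \<le> f x" "bounded (range f)" "isCont f 0" "f 0 > 0" by fact+
  have K: "K \<in> borel_measurable borel" "\<And>u. 0 \<le> K u" "bounded (range K)" "\<And>u. K (- u) = K u"
    "has_bochner_integral lborel K 1" "integrable lborel (\<lambda>u. (K u)\<^sup>2)" by fact+
  have h: "\<And>n. n \<ge> 1 \<Longrightarrow> h n > 0" "h \<longlonglongrightarrow> 0" "filterlim (\<lambda>n. real n * h n) at_top sequentially" by fact+
  have V: "indep_vars (\<lambda>_. borel) V UNIV" "\<And>i. distributed M lborel (V i) (\<lambda>x. ennreal (f x))" by fact+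
  have ind: "indep_set
       (sets (vimage_algebra (space M) (\<lambda>\<omega> i. V i \<omega>) (\<Pi>\<^sub>M i\<in>UNIV. borel)))
       (sets (vimage_algebra (space M) (\<lambda>\<omega> i. U i \<omega>) (\<Pi>\<^sub>M i\<in>UNIV. borel)))" by fact
  have sq: "integrable M (\<lambda>\<omega>. (norm (U 0 \<omega>))\<^sup>2)" by fact
  have \<mu>_dom: "\<mu> \<in> reg_dom" by fact
  have \<alpha>: "\<alpha> \<in> {0<..<1}" by fact
  note [measurable] = K(1)
  have Z_m: "?Z i \<in> borel_measurable M" for i by (rule stationary_seqD(1)[OF Z(1)])
  have [measurable]: "fst \<in> borel_measurable (borel :: ((real ^ ('p :: {finite, linorder})) \<times> real) measure)"
    "snd \<in> borel_measurable (borel :: ((real ^ ('p :: {finite, linorder})) \<times> real) measure)"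
    by (intro borel_measurable_continuous_onI continuous_intros)+
  have X_m[measurable]: "X i \<in> borel_measurable M" and eps_m[measurable]: "eps i \<in> borel_measurable M" for i
    using measurable_compose[OF Z_m[of i], of fst borel] measurable_compose[OF Z_m[of i], of snd borel] by simp_all
  have V_m[measurable]: "V i \<in> borel_measurable M" for i
    using V(1) by (simp add: indep_vars_def)
  \<comment> \<open>Writing \<open>U i\<close> as a fixed measurable function of the pair of
    regressors and error lets the ergodic theorem for the pairs serve for \<open>U\<close>.\<close>
  define u :: "(real ^ ('p :: {finite, linorder})) \<times> real \<Rightarrow> real ^ ('p option ltri + 'p option)" where
    "u z = join_vec (vech (outer (with_intercept (fst z)) (with_intercept (fst z))))
      ((\<beta> \<bullet> with_intercept (fst z) + snd z) *\<^sub>R with_intercept (fst z))" for z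
  have u_m[measurable]: "u \<in> borel_measurable borel" unfolding u_def by measurable
  have U_eq: "U i \<omega> = u (?Z i \<omega>)" for i \<omega>
    unfolding U Xt Y u_def by (simp add: inner_with_intercept)
  have U_m[measurable]: "U i \<in> borel_measurable M" for i unfolding U_eq by measurable
  have int_U: "integrable M (U 0)" by (rule second_moment_integrable(1)[OF U_m sq])
  have exp_U: "expectation (U 0) = \<mu>"
    unfolding \<mu> by (rule expectation_join_vec_outer(3)[OF int_U]) (simp add: U)
  have U_model: "U 0 \<omega> = join_vec (vech (outer (Xt 0 \<omega>) (Xt 0 \<omega>))) ((\<beta> \<bullet> Xt 0 \<omega> + eps 0 \<omega>) *\<^sub>R Xt 0 \<omega>)" for \<omega>
    unfolding U_eq u_def Xt by simp
  have ce: "AE \<omega> in M. real_cond_exp M (vimage_algebra (space M) (X 0) borel) (eps 0) \<omega> = 0" by fact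
  have "AE \<omega> in M.
           0 < nn_cond_exp M (vimage_algebra (space M) (X 0) borel) (\<lambda>\<omega>. ennreal ((eps 0 \<omega>)\<^sup>2)) \<omega> \<and>
           nn_cond_exp M (vimage_algebra (space M) (X 0) borel) (\<lambda>\<omega>. ennreal ((eps 0 \<omega>)\<^sup>2)) \<omega> < \<infinity>" by fact
  then have var: "AE \<omega> in M. 0 < nn_cond_exp M (vimage_algebra (space M) (X 0) borel) (\<lambda>\<omega>. ennreal ((eps 0 \<omega>)\<^sup>2)) \<omega>"
    by eventually_elim simp
  have wi_m: "(with_intercept :: real ^ ('p :: {finite, linorder}) \<Rightarrow> _) \<in> borel_measurable borel" by measurable
  have Xt0: "Xt 0 \<omega> = with_intercept (X 0 \<omega>)" for \<omega> by (simp add: Xt)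
  note moments = regression_moments[OF X_m[of 0] eps_m[of 0] Xt0 wi_m U_model sq ce var, unfolded exp_U, OF \<mu>_dom]
  have g\<mu>: "g_reg \<mu> = \<beta>" by (rule moments(1))

  \<comment> \<open>The limit covariance and its nondegeneracy\<close>
  define J where "J = jacobian g_reg (at \<mu>)"
  have J: "J *v x = Dg_reg \<mu> x" for x unfolding J_def by (rule jacobian_g_reg[OF \<mu>_dom])
  have tJ: "(transpose J *v t) \<bullet> x = t \<bullet> (J *v x)" for t x
    by (metis dot_lmul_matrix vector_transpose_matrix transpose_transpose)
  define E2 where "E2 = expectation (\<lambda>\<omega>. outer (U 0 \<omega>) (U 0 \<omega>))"
  have S: "Sigma_beta = (c2 / f 0) *\<^sub>R (J ** E2 ** transpose J)"
    unfolding Sigma_beta J_def E2_def ..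
  \<comment> \<open>If the square of \<open>K\<close> integrated to 0, \<open>K\<close> would vanish
    almost everywhere and could not integrate to 1.\<close>
  have c2_pos: "0 < c2"
  proof (rule ccontr)
    assume "\<not> 0 < c2"
    moreover have "0 \<le> c2" unfolding c2 by simp
    ultimately have "c2 = 0" by simp
    then have "AE u in lborel. (K u)\<^sup>2 = 0"
      unfolding c2 by (subst (asm) integral_nonneg_eq_0_iff_AE[OF K(6)]) auto
    then have "AE u in lborel. K u = 0" by eventually_elim simp
    then have "(\<integral>u. K u \<partial>lborel) = (\<integral>u. 0 \<partial>(lborel :: real measure))"
      by (intro integral_cong_AE) auto
    then show False using K(5) by (simp add: has_bochner_integral_iff)
  qed
  have S_quad: "t \<bullet> (Sigma_beta *v t) = c2 / f 0 * ((transpose J *v t) \<bullet> (E2 *v (transpose J *v t)))" for t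
    unfolding S by (rule sandwich_quadratic_form)
  \<comment> \<open>The form is a positive multiple of the second moment of
    \<open>t \<bullet> Dg_reg \<mu> (U 0 \<omega>)\<close>.\<close>
  have S_pd: "0 < t \<bullet> (Sigma_beta *v t)" if "t \<noteq> 0" for t
    unfolding S_quad E2_def second_moment_matrix(1)[OF U_m sq] tJ J
    using moments(2)[OF that] c2_pos f(4) by simp
  have S_sym: "transpose Sigma_beta = Sigma_beta"
    unfolding S transpose_scaleR matrix_transpose_mul transpose_transpose E2_def
      second_moment_matrix(2)[OF U_m sq] by (simp add: matrix_mul_assoc)
  have S_det: "det Sigma_beta \<noteq> 0" by (rule pd_invertible) (rule S_pd)

  \<comment> \<open>Tightness, consistency and the inactive truncation\<close>
  define r where "r n = sqrt (real n * h n)" for n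
  have r0: "0 \<le> r n" for n using h(1)[of n] by (cases "n = 0") (auto simp: r_def)
  have nh_pos: "\<forall>\<^sub>F n in sequentially. 0 < real n * h n"
    using h(3) by (simp add: filterlim_at_top_dense)
  have r_inf: "filterlim r at_top sequentially"
    unfolding r_def[abs_def] by (rule filterlim_compose[OF sqrt_at_top h(3)])
  define T where "T n \<omega> = r n *\<^sub>R (mu_hat n \<omega> - \<mu>)" for n \<omega>
  have mu_hat_m[measurable]: "mu_hat n \<in> borel_measurable M" for n
    unfolding mu_hat mean_hat_def by measurable
  have T_m[measurable]: "T n \<in> borel_measurable M" for n unfolding T_def by measurable
  have lam: "(\<lambda>n. real n * h n * lambda_max (cov_matrix M (\<lambda>\<omega>. (1 / real n) *\<^sub>R (\<Sum>i<n. U i \<omega>)))) \<longlonglongrightarrow> 0" by fact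
  have T_char: "(\<lambda>n. CLINT \<omega>|M. iexp (t \<bullet> T n \<omega>)) \<longlonglongrightarrow> exp (- ((c2 / f 0) * (t \<bullet> (E2 *v t))) / 2)" for t
    using mean_hat_char_tendsto[OF V ind f K(1,2,3,5,6) h Z U_eq u_m sq lam, of t]
    unfolding T_def r_def mu_hat exp_U c2 E2_def by simp
  have "isCont (\<lambda>t :: real ^ ('p option ltri + 'p option). complex_of_real (exp (- ((c2 / f 0) * (t \<bullet> (E2 *v t))) / 2))) 0"
    by (intro continuous_intros isCont_exp linear_continuous_at matrix_vector_mul_bounded_linear) auto
  then have T_bdd: "bounded_in_prob T"
    by (rule bounded_in_prob_of_char_tendsto[OF T_m T_char])
  let ?P = "in_prob M"
  have r_pos: "\<forall>\<^sub>F x in ?P. 0 < r (fst x)"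
    by (rule eventually_in_prob_fst) (use nh_pos in \<open>simp add: r_def\<close>)
  \<comment> \<open>Consistency is tightness of \<open>T\<close> divided by the diverging scale
    \<open>r\<close>.\<close>
  have mu_hat_lim: "((\<lambda>x. mu_hat (fst x) (snd x)) \<longlongrightarrow> \<mu>) ?P"
  proof (rule LIM_zero_cancel, rule Lim_null_comparison)
    have "((\<lambda>x. inverse (r (fst x))) \<longlongrightarrow> 0) ?P"
      by (rule tendsto_in_prob_fst[OF tendsto_inverse_0_at_top[OF r_inf]])
    from bounded_in_prob_tendsto_0[OF this T_bdd]
    show "((\<lambda>x. inverse (r (fst x)) * norm (T (fst x) (snd x))) \<longlongrightarrow> 0) ?P" .
    show "\<forall>\<^sub>F x in ?P. norm (mu_hat (fst x) (snd x) - \<mu>) \<le> inverse (r (fst x)) * norm (T (fst x) (snd x))"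
      using r_pos by eventually_elim (simp add: T_def mult.assoc[symmetric])
  qed
  have lam_pos: "lam_S > 0" "lam_G > 0" by fact+
  have "a_S \<longlonglongrightarrow> 1" "a_G \<longlonglongrightarrow> 1"
    unfolding a_S a_G by (intro dens_hat_mean_tendsto V(2) f K(1,3,4,5) h(1,2) lam_pos, assumption?)+
  then have "A \<longlonglongrightarrow> mat 1" unfolding A block_diag_1[symmetric] by (rule tendsto_block_diag)
  then have A_lim: "((\<lambda>x. A (fst x)) \<longlongrightarrow> mat 1) ?P" by (rule tendsto_in_prob_fst)
  have mu_til_m[measurable]: "mu_til n \<in> borel_measurable M" for n unfolding mu_til by measurable
  have mu_til_lim: "((\<lambda>x. mu_til (fst x) (snd x)) \<longlongrightarrow> \<mu>) ?P"
    using tendsto_matrix_vector_mult[OF A_lim mu_hat_lim] by (simp add: mu_til)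
  have c_lim: "c \<longlonglongrightarrow> 0" by fact
  have D\<mu>: "0 < Delta \<mu>" using \<mu>_dom by (simp add: reg_dom_def)
  have D_pos: "\<forall>\<^sub>F x in ?P. 0 < Delta (mu_til (fst x) (snd x))"
    using order_tendstoD(1)[OF tendsto_Delta[OF mu_til_lim] D\<mu>] .
  have "((\<lambda>x. Delta (mu_til (fst x) (snd x)) - c (fst x)) \<longlongrightarrow> Delta \<mu> - 0) ?P"
    by (intro tendsto_diff tendsto_Delta mu_til_lim tendsto_in_prob_fst[OF c_lim])
  from order_tendstoD(1)[OF this, of 0] D\<mu>
  have D_c: "\<forall>\<^sub>F x in ?P. c (fst x) < Delta (mu_til (fst x) (snd x))" by simp
  have til_dom: "\<forall>\<^sub>F x in ?P. mu_til (fst x) (snd x) \<in> reg_dom"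
    using D_pos by (simp add: reg_dom_def)
  have beta_T_eq: "\<forall>\<^sub>F x in ?P. beta_T (fst x) (snd x) = g_reg (mu_til (fst x) (snd x))"
    using D_c D_pos by eventually_elim (simp add: beta_T g_trunc_eq_g_reg)
  have beta_til_eq: "\<forall>\<^sub>F x in ?P. beta_til (fst x) (snd x) = g_reg (mu_til (fst x) (snd x))"
    by (rule plug_in_eventually[OF beta_til til_dom])
  have beta_T_m[measurable]: "beta_T n \<in> borel_measurable M" for n unfolding beta_T by measurable
  \<comment> \<open>The two estimators coincide with probability tending to one, so the growing
    factor multiplies an exact 0.\<close>
  have claim0: "to_zero_in_prob M (\<lambda>n \<omega>. sqrt (real n * h n) *\<^sub>R (beta_T n \<omega> - beta_til n \<omega>))"
  proof (rule to_zero_in_prob_tendsto, rule tendsto_eventually)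
    show "\<forall>\<^sub>F x in ?P. sqrt (real (fst x) * h (fst x)) *\<^sub>R (beta_T (fst x) (snd x) - beta_til (fst x) (snd x)) = 0"
      using beta_T_eq beta_til_eq by eventually_elim simp
  qed

  \<comment> \<open>Consistency of Jacobians and covariance estimates\<close>
  have hat_dom: "\<forall>\<^sub>F x in ?P. mu_hat (fst x) (snd x) \<in> reg_dom"
    by (rule eventually_reg_dom[OF \<mu>_dom mu_hat_lim])
  have J_hat_lim: "((\<lambda>x. J_hat (fst x) (snd x)) \<longlongrightarrow> J) ?P"
  proof (rule Lim_transform_eventually[OF tendsto_jacobian_g_reg[OF mu_hat_lim \<mu>_dom, folded J_def]])
    show "\<forall>\<^sub>F x in ?P. jacobian g_reg (at (mu_hat (fst x) (snd x))) = J_hat (fst x) (snd x)"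
      using plug_in_eventually[OF J_hat hat_dom] by eventually_elim simp
  qed
  \<comment> \<open>The truncated map varies with \<open>n\<close> through \<open>c n\<close>, so
    continuity of one fixed Jacobian does not apply to it directly. On the event
    \<open>c n < Delta\<close> its Jacobian is that of the fixed map \<open>g_reg\<close>.\<close>
  have J_T_lim: "((\<lambda>x. J_T (fst x) (snd x)) \<longlongrightarrow> J) ?P"
  proof (rule Lim_transform_eventually[OF tendsto_jacobian_g_reg[OF mu_til_lim \<mu>_dom, folded J_def]])
    have "\<forall>\<^sub>F x in ?P. mu_til (fst x) (snd x) \<in> {y. g_trunc (c (fst x)) differentiable (at y)}"
      using D_c D_pos by eventually_elim (simp add: jacobian_g_trunc(1))
    from plug_in_eventually[OF J_T this] D_c D_pos
    show "\<forall>\<^sub>F x in ?P. jacobian g_reg (at (mu_til (fst x) (snd x))) = J_T (fst x) (snd x)"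
      by eventually_elim (simp add: jacobian_g_trunc(2))
  qed
  have Smu_lim: "((\<lambda>x. Sig_mu_hat (fst x) (snd x)) \<longlongrightarrow> (c2 / f 0) *\<^sub>R E2) ?P"
    unfolding Sig_mu_hat E2_def
    by (intro tendsto_scaleR tendsto_const second_moment_average_tendsto[OF Z U_eq u_m sq])
  have S': "J ** ((c2 / f 0) *\<^sub>R E2) ** transpose J = Sigma_beta"
    unfolding S by (simp add: matrix_mult_scaleR)
  have Sig_hat_lim: "((\<lambda>x. Sig_hat (fst x) (snd x)) \<longlongrightarrow> Sigma_beta) ?P"
    unfolding Sig_hat S'[symmetric] by (intro tendsto_intros J_hat_lim Smu_lim)
  have Sig_T_lim: "((\<lambda>x. Sig_T (fst x) (snd x)) \<longlongrightarrow> Sigma_beta) ?P"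
    unfolding Sig_T S'[symmetric] by (intro tendsto_intros J_T_lim Smu_lim)
  note Sig_hat_inv_lim = plug_in_inverse_tendsto[OF Sig_hat_inv Sig_hat_lim S_det]
  note Sig_T_inv_lim = plug_in_inverse_tendsto[OF Sig_T_inv Sig_T_lim S_det]
  have [measurable]: "J_hat n \<in> borel_measurable M" "J_T n \<in> borel_measurable M"
    "Sig_hat_inv n \<in> borel_measurable M" "Sig_T_inv n \<in> borel_measurable M" for n
    using J_hat J_T Sig_hat_inv Sig_T_inv unfolding plug_in_def by blast+
  have [measurable]: "Sig_mu_hat n \<in> borel_measurable M" for n unfolding Sig_mu_hat by measurable
  have Sig_hat_m[measurable]: "Sig_hat n \<in> borel_measurable M" for n unfolding Sig_hat by measurable
  have D_T_m[measurable]: "D_T n \<in> borel_measurable M" for n unfolding D_T by measurable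

  \<comment> \<open>Inference from a linear expansion\<close>
  have card: "CARD('p option) = CARD('p) + 1" by simp
  \<comment> \<open>Shared by both cases: an estimator whose scaled error is \<open>J *v T\<close>
    up to o_P(1) inherits the limit law by evaluating the characteristic function of
    \<open>T\<close> at \<open>transpose J *v t\<close>.\<close>
  have infer: "conv_in_distr M (\<lambda>n \<omega>. r n *\<^sub>R (b n \<omega> - \<beta>)) (centred_normal Sigma_beta) \<and>
      asymp_confidence_set M (1 - \<alpha>)
        (\<lambda>n \<omega>. {c. real n * h n * ((b n \<omega> - c) \<bullet> (Sinv n \<omega> *v (b n \<omega> - c))) \<le> quantile (chi_square (CARD('p) + 1)) (1 - \<alpha>)}) \<beta> \<and>
      (\<forall>j. asymp_confidence_set M (1 - \<alpha>)
        (\<lambda>n \<omega>. let r = quantile std_normal (1 - \<alpha> / 2) * sqrt (Sig_hat n \<omega> $ j $ j / (real n * h n))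
          in {b n \<omega> $ j - r .. b n \<omega> $ j + r}) (\<beta> $ j))"
    if b_m[measurable]: "\<And>n. b n \<in> borel_measurable M" and Sinv_m: "\<And>n. Sinv n \<in> borel_measurable M"
      and Sinv_lim: "((\<lambda>x. Sinv (fst x) (snd x)) \<longlongrightarrow> matrix_inv Sigma_beta) ?P"
      and diff: "((\<lambda>x. r (fst x) *\<^sub>R (b (fst x) (snd x) - \<beta>) - J *v T (fst x) (snd x)) \<longlongrightarrow> 0) ?P"
    for b and Sinv :: "nat \<Rightarrow> 'a \<Rightarrow> real ^ ('p option) ^ ('p option)"
  proof -
    have "(\<lambda>n. CLINT \<omega>|M. iexp (t \<bullet> (J *v T n \<omega>))) \<longlonglongrightarrow> exp (- (t \<bullet> (Sigma_beta *v t)) / 2)" for t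
      using T_char[of "transpose J *v t"] unfolding S_quad tJ .
    then have char: "(\<lambda>n. CLINT \<omega>|M. iexp (t \<bullet> (r n *\<^sub>R (b n \<omega> - \<beta>)))) \<longlonglongrightarrow> exp (- (t \<bullet> (Sigma_beta *v t)) / 2)" for t
      by (intro char_tendsto_cong[OF _ _ _ diff]) measurable
    note inf = asymptotic_normal_inference[where k = "\<lambda>n. real n * h n" and \<theta> = \<beta>, folded r_def card,
        OF b_m Sinv_m Sig_hat_m nh_pos char S_sym S_pd Sinv_lim Sig_hat_lim \<alpha>]
    show ?thesis using inf by (simp only: card) blast
  qed

  \<comment> \<open>\<open>R\<close> is the scaled error after applying \<open>A n\<close>. It
    exceeds \<open>T\<close> by the scaled effect of \<open>A n - mat 1\<close>, and the two cases
    differ only in the size of that term.\<close>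
  define R where "R n \<omega> = r n *\<^sub>R (mu_til n \<omega> - \<mu>)" for n \<omega>
  have R_eq: "R n \<omega> = T n \<omega> + (r n *\<^sub>R (A n - mat 1)) *v mu_hat n \<omega>" for n \<omega>
    unfolding R_def T_def mu_til
    by (simp add: scaleR_matrix_vector_assoc[symmetric] matrix_vector_mult_diff_rdistrib
      scaleR_right_distrib[symmetric])
  have linearise: "((\<lambda>x. r (fst x) *\<^sub>R (beta_T (fst x) (snd x) - \<beta>) - J *v R (fst x) (snd x)) \<longlongrightarrow> 0) ?P"
    if "bounded_in_prob R"
  proof (rule Lim_transform_eventually)
    show "((\<lambda>x. r (fst x) *\<^sub>R (g_reg (mu_til (fst x) (snd x)) - g_reg \<mu>) - Dg_reg \<mu> (r (fst x) *\<^sub>R (mu_til (fst x) (snd x) - \<mu>))) \<longlongrightarrow> 0) ?P"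
      by (rule delta_method_in_prob[OF g_reg_has_derivative[OF \<mu>_dom] mu_til_lim that[unfolded R_def[abs_def]]])
    show "\<forall>\<^sub>F x in ?P. r (fst x) *\<^sub>R (g_reg (mu_til (fst x) (snd x)) - g_reg \<mu>) - Dg_reg \<mu> (r (fst x) *\<^sub>R (mu_til (fst x) (snd x) - \<mu>)) =
        r (fst x) *\<^sub>R (beta_T (fst x) (snd x) - \<beta>) - J *v R (fst x) (snd x)"
      using beta_T_eq by eventually_elim (simp only: g\<mu> R_def J)
  qed

  have J_0: "((\<lambda>x. J *v W x) \<longlongrightarrow> 0) ?P" if "(W \<longlongrightarrow> 0) ?P" for W :: "nat \<times> 'a \<Rightarrow> _"
    using tendsto_matrix_vector_mult[OF tendsto_const that, of J] by simp

  have part1: "conv_in_distr M (\<lambda>n \<omega>. sqrt (real n * h n) *\<^sub>R (beta_T n \<omega> - \<beta>)) (centred_normal Sigma_beta) \<and>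
        asymp_confidence_set M (1 - \<alpha>)
          (\<lambda>n \<omega>. {b. real n * h n * ((beta_T n \<omega> - b) \<bullet> (Sig_hat_inv n \<omega> *v (beta_T n \<omega> - b)))
                    \<le> quantile (chi_square (CARD('p) + 1)) (1 - \<alpha>)}) \<beta> \<and>
        (\<forall>j. asymp_confidence_set M (1 - \<alpha>)
          (\<lambda>n \<omega>. let r = quantile std_normal (1 - \<alpha> / 2) * sqrt (Sig_hat n \<omega> $ j $ j / (real n * h n))
                 in {beta_T n \<omega> $ j - r .. beta_T n \<omega> $ j + r}) (\<beta> $ j))"
    if H: "(\<lambda>n. sqrt (real n * h n) * norm (A n - mat 1)) \<longlonglongrightarrow> 0"
  proof -
    have "(\<lambda>n. norm (r n *\<^sub>R (A n - mat 1))) \<longlonglongrightarrow> 0"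
      using H r0 by (simp add: r_def[symmetric])
    then have "(\<lambda>n. r n *\<^sub>R (A n - mat 1)) \<longlonglongrightarrow> 0" by (rule tendsto_norm_zero_cancel)
    from tendsto_matrix_vector_mult[OF tendsto_in_prob_fst[OF this] mu_hat_lim]
    have RT: "((\<lambda>x. R (fst x) (snd x) - T (fst x) (snd x)) \<longlongrightarrow> 0) ?P" by (simp add: R_eq)
    from bounded_in_prob_add[OF T_bdd bounded_in_prob_tendsto[OF RT]]
    have "bounded_in_prob R" by simp
    from tendsto_add[OF linearise[OF this] J_0[OF RT]]
    have "((\<lambda>x. r (fst x) *\<^sub>R (beta_T (fst x) (snd x) - \<beta>) - J *v T (fst x) (snd x)) \<longlongrightarrow> 0) ?P"
      by (simp add: matrix_vector_mult_diff_distrib)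
    from infer[OF beta_T_m _ Sig_hat_inv_lim this] show ?thesis by (simp only: r_def) measurable
  qed

  have part2: "conv_in_distr M (\<lambda>n \<omega>. sqrt (real n * h n) *\<^sub>R (beta_T n \<omega> - D_T n \<omega> - \<beta>))
          (centred_normal Sigma_beta) \<and>
        asymp_confidence_set M (1 - \<alpha>)
          (\<lambda>n \<omega>. {b. real n * h n * ((beta_T n \<omega> - D_T n \<omega> - b) \<bullet>
                      (Sig_T_inv n \<omega> *v (beta_T n \<omega> - D_T n \<omega> - b)))
                    \<le> quantile (chi_square (CARD('p) + 1)) (1 - \<alpha>)}) \<beta> \<and>
        (\<forall>j. asymp_confidence_set M (1 - \<alpha>)
          (\<lambda>n \<omega>. let r = quantile std_normal (1 - \<alpha> / 2) * sqrt (Sig_hat n \<omega> $ j $ j / (real n * h n))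
                 in {beta_T n \<omega> $ j - D_T n \<omega> $ j - r .. beta_T n \<omega> $ j - D_T n \<omega> $ j + r})
          (\<beta> $ j))"
    if d: "d > 0" "\<forall>x\<in>{-d<..<d}. f differentiable (at x) \<and> deriv f differentiable (at x)"
      "bounded (deriv (deriv f) ` {-d<..<d})" "isCont (deriv (deriv f)) 0"
      and K2: "integrable lborel (\<lambda>u. u\<^sup>2 * K u)"
      and ab: "\<forall>n\<ge>1. a \<le> real n powr (1 / 5) * h n \<and> real n powr (1 / 5) * h n \<le> b" for d a b
  proof -
    define \<kappa> where "\<kappa> = deriv (deriv f) 0 * (\<integral>u. u\<^sup>2 * K u \<partial>lborel) / (2 * f 0)"
    \<comment> \<open>The size of the scaled bias: \<open>s n\<close> is the square root of
      \<open>real n * h n ^ 5\<close>, which the bandwidth order n^(-1/5) keeps bounded but does not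
      send to 0.\<close>
    define s where "s n = r n * (h n)\<^sup>2" for n
    have s_bdd: "\<bar>s n\<bar> \<le> sqrt (b ^ 5)" for n
    proof (cases "n = 0")
      case True
      \<comment> \<open>For \<open>n = 0\<close> the left side is 0; the bound at index 1 shows that
        \<open>b\<close> is nonnegative, hence so is the right side.\<close>
      have "0 \<le> real 1 powr (1 / 5) * h 1" using h(1)[of 1] by simp
      also have "\<dots> \<le> b" using ab by blast
      finally show ?thesis using True by (simp add: s_def r_def)
    next
      case False
      then have n: "n \<ge> 1" by simp
      have "(real n powr (1 / 5)) ^ 5 = real n powr (1 / 5 * 5)"
        using False by (simp add: powr_power)
      then have "real n * h n ^ 5 = (real n powr (1 / 5) * h n) ^ 5"
        using False by (simp add: power_mult_distrib)
      also have "\<dots> \<le> b ^ 5"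
        using ab n h(1)[OF n] by (intro power_mono) auto
      finally have "sqrt (real n * h n ^ 5) \<le> sqrt (b ^ 5)" by simp
      moreover have "real n * h n ^ 5 = (real n * h n) * ((h n)\<^sup>2)\<^sup>2"
        by (simp add: power2_eq_square eval_nat_numeral)
      then have "s n = sqrt (real n * h n ^ 5)"
        unfolding s_def r_def by (simp only: real_sqrt_mult real_sqrt_abs) simp
      moreover have "0 \<le> s n" using r0 by (simp add: s_def)
      ultimately show ?thesis by simp
    qed
    \<comment> \<open>The relative scaling error in units of \<open>(h n)\<^sup>2\<close>; it tends
      to \<open>\<kappa> *\<^sub>R \<Lambda>\<close>.\<close>
    define B where "B n = (1 / (h n)\<^sup>2) *\<^sub>R (A n - mat 1)" for n
    define \<Lambda> :: "real ^ ('p option ltri + 'p option) ^ ('p option ltri + 'p option)"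
      where "\<Lambda> = block_diag (lam_S\<^sup>2) (lam_G\<^sup>2)"
    have bias: "(\<lambda>n. (expectation (\<lambda>\<omega>. dens_hat K V h l n 0 \<omega>) / f 0 - 1) / (h n)\<^sup>2) \<longlonglongrightarrow> \<kappa> * l\<^sup>2"
      if "0 < l" for l
      unfolding \<kappa>_def
      by (rule dens_hat_bias_tendsto[OF V(2) f(1,2,4) d(1) _ d(3,4) K(1,3,2,4,5) K2 h(2,1) that])
         (use d(2) in auto)
    have "B \<longlonglongrightarrow> block_diag (\<kappa> * lam_S\<^sup>2) (\<kappa> * lam_G\<^sup>2)"
      unfolding B_def A block_diag_diff_scaleR a_S a_G
      using bias[OF lam_pos(1)] bias[OF lam_pos(2)] by (intro tendsto_block_diag) simp_all
    then have B_lim: "((\<lambda>x. B (fst x)) \<longlongrightarrow> \<kappa> *\<^sub>R \<Lambda>) ?P"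
      unfolding \<Lambda>_def block_diag_scaleR by (rule tendsto_in_prob_fst)
    note BM = tendsto_matrix_vector_mult[OF B_lim mu_hat_lim]
    have RT: "R n \<omega> = T n \<omega> + s n *\<^sub>R (B n *v mu_hat n \<omega>)" for n \<omega>
    \<comment> \<open>Nothing is assumed about \<open>h 0\<close>, but \<open>r 0 = 0\<close> makes
      both sides 0.\<close>
    proof (cases "n = 0")
      case True
      then have "r n = 0" by (simp add: r_def)
      then show ?thesis by (simp add: R_eq s_def)
    next
      case False
      then have "h n \<noteq> 0" using h(1)[of n] by simp
      then have "r n *\<^sub>R (A n - mat 1) = s n *\<^sub>R B n" by (simp add: s_def B_def)
      then show ?thesis unfolding R_eq by (simp add: scaleR_matrix_vector_assoc)
    qed
    have "bounded_in_prob (\<lambda>n \<omega>. s n *\<^sub>R (B n *v mu_hat n \<omega>))"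
      by (rule bounded_in_prob_bounded_scaleR[OF always_eventually bounded_in_prob_tendsto])
         (use s_bdd BM in auto)
    from bounded_in_prob_add[OF T_bdd this] have R_bdd: "bounded_in_prob R"
      unfolding RT[symmetric, abs_def] .
    \<comment> \<open>The linearised bias minus its estimate, both in units of
      \<open>(h n)\<^sup>2\<close>. They have the common limit
      \<open>\<kappa> *\<^sub>R (J *v (\<Lambda> *v \<mu>))\<close>, so \<open>Q\<close> tends to 0
      and the bounded factor \<open>s n\<close> does no damage.\<close>
    define Q where "Q x = J *v (B (fst x) *v mu_hat (fst x) (snd x)) -
      \<kappa> *\<^sub>R (J_T (fst x) (snd x) *v (\<Lambda> *v mu_til (fst x) (snd x)))" for x
    have "(Q \<longlongrightarrow> J *v ((\<kappa> *\<^sub>R \<Lambda>) *v \<mu>) - \<kappa> *\<^sub>R (J *v (\<Lambda> *v \<mu>))) ?P"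
      unfolding Q_def by (intro tendsto_intros B_lim mu_hat_lim mu_til_lim J_T_lim)
    then have Q: "(Q \<longlongrightarrow> 0) ?P"
      by (simp add: scaleR_matrix_vector_assoc[symmetric] matrix_vector_mult_scaleR)
    have sQ: "((\<lambda>x. s (fst x) *\<^sub>R Q x) \<longlongrightarrow> 0) ?P"
    proof (rule Lim_null_comparison)
      show "((\<lambda>x. sqrt (b ^ 5) * norm (Q x)) \<longlongrightarrow> 0) ?P"
        using tendsto_mult[OF tendsto_const tendsto_norm_zero[OF Q]] by simp
      show "\<forall>\<^sub>F x in ?P. norm (s (fst x) *\<^sub>R Q x) \<le> sqrt (b ^ 5) * norm (Q x)"
        using s_bdd by (intro always_eventually allI) (simp add: mult_right_mono)
    qed
    have "((\<lambda>x. r (fst x) *\<^sub>R (beta_T (fst x) (snd x) - D_T (fst x) (snd x) - \<beta>) - J *v T (fst x) (snd x)) \<longlongrightarrow> 0) ?P"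
    proof (rule Lim_transform_eventually[OF _ always_eventually], rule tendsto_add_zero[OF linearise[OF R_bdd] sQ], rule allI)
      fix x :: "nat \<times> 'a"
      obtain n \<omega> where x: "x = (n, \<omega>)" by fastforce
      have "r n *\<^sub>R D_T n \<omega> = s n *\<^sub>R (\<kappa> *\<^sub>R (J_T n \<omega> *v (\<Lambda> *v mu_til n \<omega>)))"
        unfolding D_T \<kappa>_def \<Lambda>_def s_def by (simp add: mult_ac)
      then show "r (fst x) *\<^sub>R (beta_T (fst x) (snd x) - \<beta>) - J *v R (fst x) (snd x) + s (fst x) *\<^sub>R Q x =
          r (fst x) *\<^sub>R (beta_T (fst x) (snd x) - D_T (fst x) (snd x) - \<beta>) - J *v T (fst x) (snd x)"
        by (simp add: x RT Q_def matrix_vector_right_distrib matrix_vector_mult_scaleR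
          scaleR_right_diff_distrib)
    qed
    from infer[OF _ _ Sig_T_inv_lim this]
    show ?thesis by (simp only: r_def vector_minus_component) measurable
  qed

  show ?thesis
    using claim0 part1 part2 by blast
qed

end
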